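(* Let the curve $\mathcal X$ describe a minimum-time path that solves the problem described in the context and let $x,y,\theta$ be its associated functions with input $u$. Consider pairs of consecutive pieces $\mathcal X_{j-1},\mathcal X_j$, $j\in\{1,2,\dots,J-1\}$, such that the path pieces across the boundary are of type $\mathcal L_p\mathcal C_{p-p'}\mathcal L_{p'}$. For each such pair, suppose the end points (opposite to the intersection with the boundary) of those path pieces are in $\mathcal P_p^\circ$ and $\mathcal P_{p'}^\circ$, respectively, for some $p,p'\in Q$, and suppose the Assumption (1)-(2) in the context holds. Let $\theta_p$, $\theta_{p'}$ be the orientations of the initial and final path pieces $\mathcal L_p$ and $\mathcal L_{p'}$ (i.e. the initial and final angles of the path piece intersecting the boundary), let $\theta^*$ be the orientation of the vehicle at the boundary crossing, all measured with respect to the normal to the boundary between $\mathcal P_p$ and $\mathcal P_{p'}$ at the crossing point, and put $\Delta\theta_p:=\theta^*-\theta_p$, $\Delta\theta_{p'}:=\theta_{p'}-\theta^*$. If the path piece intersecting the boundary between $\mathcal P_p$ and $\mathcal P_{p'}$ is of type $\mathcal C_{p-p'}$, then $$\frac{v_p}{v_{p'}}=\frac{\sin\theta_p}{\sin\theta_{p'}},$$ $$\frac{r_p}{r_{p'}}=\frac{v_p}{v_{p'}}\left(\frac{1-\cos\Delta\theta_{p'}}{1-\cos\Delta\theta_p}\right)=\frac{\sin\theta_p\,(1-\cos\Delta\theta_{p'})}{\sin\theta_{p'}\,(1-\cos\Delta\theta_p)}.$$ Moreover, if the path piece intersecting the boundary between $\mathcal P_p$ and $\mathcal P_{p'}$ is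 of type $\mathcal L$ and $v_p\ne v_{p'}$, then $\theta_p$ and $\theta_{p'}$ are equal to zero or any multiple of $\pi$.
   Context: Problem. Let $\mathcal P\subset\mathbb R^2$ be a connected set with $\mathcal P=\bigcup_{q\in Q}\mathcal P_q$, $Q=\{1,\dots,N\}$, where $\mathcal P_1,\dots,\mathcal P_N\subset\mathcal P$ are disjoint polytopes with nonempty interior. Each $\mathcal P_q$ has a speed $v_q>0$ and a minimum turning radius $r_q>0$; neighboring regions differ in speed, in minimum turning radius, or both. Put $\overline u_q:=v_q/r_q$ and $U_q:=[-\overline u_q,\overline u_q]$. A particle with position $(x,y)\in\mathbb R^2$ and orientation $\theta\in\mathbb R$ (measured from the vertical axis) moves in region $\mathcal P_q$ by $$\dot x=v_q\sin\theta,\qquad \dot y=v_q\cos\theta,\qquad \dot\theta=u,\qquad |u|\le\overline u_q,$$ with $u$ piecewise continuous; its velocity vector is $[v_q\sin\theta, v_q\cos\theta]^\top$. Given $(x,y)^i\in\mathcal P_{q^i}^\circ$ with initial velocity vector $\nu^i$ and $(x,y)^f\in\mathcal P_{q^f}^\circ$ with final velocity vector $\nu^f$ ($q^i,q^f\in Q$; $S^\circ$ is the interior of $S$), the problem is to travel from the initial to the final configuration inside $\mathcal P$ in minimum time. Solutions. The path $\mathcal X\subset\mathcal P$ (a continuously differentiable curve) is partitioned into finitely many curves $\mathcal X_0,\dots,\mathcal X_{J-1}$, with $\mathcal X_j$ in $\mathcal P_{q_j}$, $q_j\in Q$, $q_j\ne q_{j+1}$; $t_j\ge0$ is the time at which $\mathcal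 X_j$ starts ($t_0=0$) and $t_J$ the time at which $(x,y)^f$ is reached. The functions $x,y,\theta,q$ (and $u$) are defined on $E:=\bigcup_{j=0}^{J-1}([t_j,t_{j+1}]\times\{j\})$, the second argument counting the crossings made so far; on each $[t_j,t_{j+1}]\times\{j\}$ they satisfy the dynamics above with $q(t,j)=q_j$ constant, and $(x,y,\theta)$ is absolutely continuous in $t$ (values at end points being one-sided limits where necessary). At crossings $(x,y,\theta)(t_{j+1},j+1)=(x,y,\theta)(t_{j+1},j)$, while $q(t_{j+1},j+1)$ is the index of the new region. Write $\xi=[x,y,\theta]^\top$; $(\xi,q)$ with $\mathrm{dom}(\xi,q)=E$ is the solution associated with $\mathcal X$. Assumption on the solution $(\xi,q)$: (1) The set $\{t : (t,j)\in\mathrm{dom}(\xi,q),\ (x(t,j),y(t,j))\in\partial\mathcal P_{q(t,j)}\}$ has zero Lebesgue measure. (2) For every $(t,j)$ such that $(t,j),(t,j+1)\in\mathrm{dom}(\xi,q)$, there exist unique $p,p'\in Q$ such that $(x,y)(t,j)\in\partial\overline{\mathcal P}_p\cap\partial\overline{\mathcal P}_{p'}$, and the boundaries $\partial\overline{\mathcal P}_p$, $\partial\overline{\mathcal P}_{p'}$ are locally smooth at $(x(t,j),y(t,j))$. Path pieces. Within a region $\mathcal P_q$: $\mathcal L$ denotes a straight line piece; $\mathcal C$ denotes an arc of a circle of the minimum turning radius $r_q$ ($\mathcal C^+$ if traveled clockwise, $\mathcal C^-$ if counter-clockwise). A subscript $p$, $p'$ or $p-p'$ on a piece means that it lies in region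 $\mathcal P_p$, in $\mathcal P_{p'}$, or spans both regions (crossing from $\mathcal P_p$ to $\mathcal P_{p'}$). A piece $\mathcal C_{p-p'}$ consists of an arc of radius $r_p$ in $\mathcal P_p$ followed across the boundary by an arc of radius $r_{p'}$ in $\mathcal P_{p'}$, turned in the same sense. In $\mathcal L_p\mathcal C_{p-p'}\mathcal L_{p'}$ the vehicle travels from $\mathcal P_p$ to $\mathcal P_{p'}$ along a line in $\mathcal P_p$, then $\mathcal C_{p-p'}$, then a line in $\mathcal P_{p'}$. Boundary coordinates. At a crossing at $(x^*,y^* )$, angles with respect to the normal to the boundary are obtained through the change of coordinates $x'=(x-x^* )\cos\varphi+(y-y^* )\sin\varphi$, $y'=-(x-x^* )\sin\varphi+(y-y^* )\cos\varphi$, $\theta'=\theta+\varphi$, where $\varphi$ is the angle of the tangent line to the boundary at the crossing; in the new coordinates the boundary is tangent to $\{y'=0\}$, and $\theta'$ is the orientation with respect to the normal to the boundary.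
   Formalization: The two arcs of the piece C_{p-p'} are assumed to lie in the interiors of P_p and P_{p'} except at the crossing point; if an arc may graze another edge of its region (an outer wall, say), the claimed equations can fail. *)

theory Defs
  imports "HOL-Analysis.Analysis"
begin

section \<open>Heterogeneous terrain\<close>

record terrain =
  num_regions :: nat
  region :: "nat \<Rightarrow> (real \<times> real) set"
  speed :: "nat \<Rightarrow> real"
  radius :: "nat \<Rightarrow> real"

definition indices :: "terrain \<Rightarrow> nat set" where
  "indices T = {1..num_regions T}"

definition whole :: "terrain \<Rightarrow> (real \<times> real) set" where
  "whole T = (\<Union>q\<in>indices T. region T q)"

text \<open>
  Finitely many, but at least two, disjoint closed polytopes never have a connected union.  So the
  regions are polytopes from which some of the (relatively open) faces may be missing: half-open
  polytopes, given by finitely many strict and non-strict linear inequalities, are the typical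
  case, and closed as well as open polytopes are covered.
\<close>

definition polytope_region :: "(real \<times> real) set \<Rightarrow> bool" where
  "polytope_region S \<longleftrightarrow> polytope (closure S) \<and> interior S \<noteq> {} \<and>
     (\<forall>F. F face_of closure S \<longrightarrow> rel_interior F \<subseteq> S \<or> rel_interior F \<inter> S = {})"

text \<open>Neighboring regions are those whose closures have a common edge segment.\<close>

definition neighboring :: "terrain \<Rightarrow> nat \<Rightarrow> nat \<Rightarrow> bool" where
  "neighboring T p q \<longleftrightarrow> p \<noteq> q \<and>
     aff_dim (closure (region T p) \<inter> closure (region T q)) = 1"

definition valid_terrain :: "terrain \<Rightarrow> bool" where
  "valid_terrain T \<longleftrightarrow>
     (\<forall>q\<in>indices T. polytope_region (region T q)) \<and>
     (\<forall>p\<in>indices T. \<forall>q\<in>indices T. p \<noteq> q \<longrightarrow> region T p \<inter> region T q = {}) \<and>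
     connected (whole T) \<and>
     (\<forall>q\<in>indices T. speed T q > 0 \<and> radius T q > 0) \<and>
     (\<forall>p\<in>indices T. \<forall>q\<in>indices T. neighboring T p q \<longrightarrow>
        speed T p \<noteq> speed T q \<or> radius T p \<noteq> radius T q)"

definition max_turn_rate :: "terrain \<Rightarrow> nat \<Rightarrow> real" where
  "max_turn_rate T q = speed T q / radius T q"

section \<open>Solutions on hybrid time domains\<close>

text \<open>
  A candidate consists of the number \<open>J\<close> of pieces, the times \<open>t\<^sub>0, \<dots>, t\<^sub>J\<close>, the regions
  \<open>q\<^sub>0, \<dots>, q\<^bsub>J-1\<^esub>\<close> (the function \<open>q\<close> has the constant value \<open>q\<^sub>j\<close> on the \<open>j\<close>-th piece), and the
  functions \<open>x\<close>, \<open>y\<close>, \<open>\<theta>\<close>, \<open>u\<close> of hybrid time \<open>(t, j)\<close>, whose values matter on the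
  hybrid time domain only.  The angle \<open>\<theta>\<close> is measured clockwise from the vertical axis.
\<close>

record hybrid_path =
  pieces :: nat
  time :: "nat \<Rightarrow> real"
  reg :: "nat \<Rightarrow> nat"
  xpos :: "real \<times> nat \<Rightarrow> real"
  ypos :: "real \<times> nat \<Rightarrow> real"
  orient :: "real \<times> nat \<Rightarrow> real"
  ctrl :: "real \<times> nat \<Rightarrow> real"

definition hdom :: "hybrid_path \<Rightarrow> (real \<times> nat) set" where
  "hdom X = (\<Union>j<pieces X. {time X j..time X (Suc j)} \<times> {j})"

definition pos :: "hybrid_path \<Rightarrow> real \<times> nat \<Rightarrow> real \<times> real" where
  "pos X h = (xpos X h, ypos X h)"

definition velocity :: "terrain \<Rightarrow> hybrid_path \<Rightarrow> real \<times> nat \<Rightarrow> real \<times> real" where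
  "velocity T X h = (speed T (reg X (snd h)) * sin (orient X h),
                     speed T (reg X (snd h)) * cos (orient X h))"

definition duration :: "hybrid_path \<Rightarrow> real" where
  "duration X = time X (pieces X)"

definition abs_continuous_on :: "real \<Rightarrow> real \<Rightarrow> (real \<Rightarrow> real) \<Rightarrow> bool" where
  "abs_continuous_on a b f \<longleftrightarrow> (\<forall>e>0. \<exists>d>0. \<forall>D :: (real \<times> real) set.
     finite D \<and> (\<forall>(l, r)\<in>D. a \<le> l \<and> l \<le> r \<and> r \<le> b) \<and>
     pairwise (\<lambda>(l, r) (l', r'). {l<..<r} \<inter> {l'<..<r'} = {}) D \<and>
     (\<Sum>(l, r)\<in>D. r - l) < d \<longrightarrow> (\<Sum>(l, r)\<in>D. \<bar>f r - f l\<bar>) < e)"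

definition piecewise_continuous_on :: "real \<Rightarrow> real \<Rightarrow> (real \<Rightarrow> real) \<Rightarrow> bool" where
  "piecewise_continuous_on a b f \<longleftrightarrow>
     (\<exists>S. finite S \<and> continuous_on ({a..b} - S) f) \<and>
     (\<forall>s\<in>{a..<b}. \<exists>l. (f \<longlongrightarrow> l) (at_right s)) \<and>
     (\<forall>s\<in>{a<..b}. \<exists>l. (f \<longlongrightarrow> l) (at_left s))"

text \<open>As the input is piecewise continuous, the dynamics may fail at finitely many times only.\<close>

definition dynamics_on_piece :: "terrain \<Rightarrow> hybrid_path \<Rightarrow> nat \<Rightarrow> bool" where
  "dynamics_on_piece T X j \<longleftrightarrow> (let a = time X j; b = time X (Suc j); q = reg X j in
     abs_continuous_on a b (\<lambda>s. xpos X (s, j)) \<and>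
     abs_continuous_on a b (\<lambda>s. ypos X (s, j)) \<and>
     abs_continuous_on a b (\<lambda>s. orient X (s, j)) \<and>
     piecewise_continuous_on a b (\<lambda>s. ctrl X (s, j)) \<and>
     (\<forall>s\<in>{a..b}. \<bar>ctrl X (s, j)\<bar> \<le> max_turn_rate T q) \<and>
     (\<exists>S. finite S \<and> (\<forall>s\<in>{a<..<b} - S.
        ((\<lambda>s. xpos X (s, j)) has_real_derivative speed T q * sin (orient X (s, j))) (at s) \<and>
        ((\<lambda>s. ypos X (s, j)) has_real_derivative speed T q * cos (orient X (s, j))) (at s) \<and>
        ((\<lambda>s. orient X (s, j)) has_real_derivative ctrl X (s, j)) (at s))))"

text \<open>
  The end points of a piece need not belong to the half-open region of that piece; they only have
  to belong to the whole terrain (and, by continuity, to the closure of the region).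
\<close>

definition hybrid_solution :: "terrain \<Rightarrow> hybrid_path \<Rightarrow> bool" where
  "hybrid_solution T X \<longleftrightarrow>
     pieces X \<ge> 1 \<and> time X 0 = 0 \<and>
     (\<forall>j<pieces X. time X j < time X (Suc j) \<and> reg X j \<in> indices T \<and>
        dynamics_on_piece T X j \<and>
        (\<forall>s\<in>{time X j<..<time X (Suc j)}. pos X (s, j) \<in> region T (reg X j))) \<and>
     (\<forall>h\<in>hdom X. pos X h \<in> whole T) \<and>
     (\<forall>j. Suc j < pieces X \<longrightarrow> reg X j \<noteq> reg X (Suc j) \<and>
        xpos X (time X (Suc j), Suc j) = xpos X (time X (Suc j), j) \<and>
        ypos X (time X (Suc j), Suc j) = ypos X (time X (Suc j), j) \<and>
        orient X (time X (Suc j), Suc j) = orient X (time X (Suc j), j))"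

record endpoint_data =
  init_reg :: nat
  init_pos :: "real \<times> real"
  init_vel :: "real \<times> real"
  final_reg :: nat
  final_pos :: "real \<times> real"
  final_vel :: "real \<times> real"

definition valid_endpoints :: "terrain \<Rightarrow> endpoint_data \<Rightarrow> bool" where
  "valid_endpoints T B \<longleftrightarrow> init_reg B \<in> indices T \<and> final_reg B \<in> indices T \<and>
     init_pos B \<in> interior (region T (init_reg B)) \<and>
     final_pos B \<in> interior (region T (final_reg B))"

definition solves :: "terrain \<Rightarrow> endpoint_data \<Rightarrow> hybrid_path \<Rightarrow> bool" where
  "solves T B X \<longleftrightarrow> hybrid_solution T X \<and>
     (let h\<^sub>i = (0, 0); h\<^sub>f = (duration X, pieces X - 1) in
        reg X 0 = init_reg B \<and> pos X h\<^sub>i = init_pos B \<and> velocity T X h\<^sub>i = init_vel B \<and>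
        reg X (pieces X - 1) = final_reg B \<and> pos X h\<^sub>f = final_pos B \<and>
        velocity T X h\<^sub>f = final_vel B)"

definition minimum_time :: "terrain \<Rightarrow> endpoint_data \<Rightarrow> hybrid_path \<Rightarrow> bool" where
  "minimum_time T B X \<longleftrightarrow> solves T B X \<and> (\<forall>Y. solves T B Y \<longrightarrow> duration X \<le> duration Y)"

section \<open>Boundary coordinates and the assumption on crossings\<close>

definition bdry_x :: "real \<times> real \<Rightarrow> real \<Rightarrow> real \<times> real \<Rightarrow> real" where
  "bdry_x z \<phi> w = (fst w - fst z) * cos \<phi> + (snd w - snd z) * sin \<phi>"

definition bdry_y :: "real \<times> real \<Rightarrow> real \<Rightarrow> real \<times> real \<Rightarrow> real" where
  "bdry_y z \<phi> w = - (fst w - fst z) * sin \<phi> + (snd w - snd z) * cos \<phi>"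

text \<open>
  Near \<open>z\<close>, the set \<open>C\<close> is a continuously differentiable curve whose tangent line at \<open>z\<close> has
  angle \<open>\<phi>\<close>: in the coordinates rotated by \<open>\<phi>\<close> and centered at \<open>z\<close> it is the graph of a
  function that vanishes together with its derivative at the origin.
\<close>

definition tangent_angle :: "(real \<times> real) set \<Rightarrow> real \<times> real \<Rightarrow> real \<Rightarrow> bool" where
  "tangent_angle C z \<phi> \<longleftrightarrow> (\<exists>\<epsilon>>0. \<exists>\<delta>>0. \<exists>g g' :: real \<Rightarrow> real.
     (\<forall>s\<in>{-\<epsilon><..<\<epsilon>}. (g has_real_derivative g' s) (at s)) \<and>
     continuous_on {-\<epsilon><..<\<epsilon>} g' \<and> g 0 = 0 \<and> g' 0 = 0 \<and>
     (\<forall>w. \<bar>bdry_x z \<phi> w\<bar> < \<epsilon> \<and> \<bar>bdry_y z \<phi> w\<bar> < \<delta> \<longrightarrow>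
        (w \<in> C \<longleftrightarrow> bdry_y z \<phi> w = g (bdry_x z \<phi> w))))"

definition locally_smooth :: "(real \<times> real) set \<Rightarrow> real \<times> real \<Rightarrow> bool" where
  "locally_smooth C z \<longleftrightarrow> (\<exists>\<phi>. tangent_angle C z \<phi>)"

definition closed_boundary :: "terrain \<Rightarrow> nat \<Rightarrow> (real \<times> real) set" where
  "closed_boundary T q = frontier (closure (region T q))"

text \<open>In the second part the indices of the two regions are unique as an unordered pair.\<close>

definition crossing_assumption :: "terrain \<Rightarrow> hybrid_path \<Rightarrow> bool" where
  "crossing_assumption T X \<longleftrightarrow>
     {s. \<exists>j. (s, j) \<in> hdom X \<and> pos X (s, j) \<in> frontier (region T (reg X j))}
       \<in> null_sets lebesgue \<and>
     (\<forall>s j. (s, j) \<in> hdom X \<and> (s, Suc j) \<in> hdom X \<longrightarrow>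
        (\<exists>p\<in>indices T. \<exists>p'\<in>indices T. p \<noteq> p' \<and>
           pos X (s, j) \<in> closed_boundary T p \<inter> closed_boundary T p' \<and>
           locally_smooth (closed_boundary T p) (pos X (s, j)) \<and>
           locally_smooth (closed_boundary T p') (pos X (s, j)) \<and>
           (\<forall>k\<in>indices T. \<forall>k'\<in>indices T. k \<noteq> k' \<and>
              pos X (s, j) \<in> closed_boundary T k \<inter> closed_boundary T k' \<longrightarrow>
              {k, k'} = {p, p'})))"

section \<open>Path pieces\<close>

definition line_piece :: "hybrid_path \<Rightarrow> nat \<Rightarrow> real \<Rightarrow> real \<Rightarrow> bool" where
  "line_piece X j a b \<longleftrightarrow> a < b \<and>
     (\<lambda>s. pos X (s, j)) ` {a..b} = closed_segment (pos X (a, j)) (pos X (b, j))"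

datatype sense = Clockwise | Counterclockwise

fun sense_sign :: "sense \<Rightarrow> real" where
  "sense_sign Clockwise = 1"
| "sense_sign Counterclockwise = - 1"

text \<open>
  The heading is \<open>(sin \<theta>, cos \<theta>)\<close>, so \<open>(cos \<theta>, - sin \<theta>)\<close> points to the right of the
  vehicle: the fixed center lies at the distance of the turning radius to the right if the circle
  is traveled clockwise, and to the left otherwise.
\<close>

definition arc_piece :: "terrain \<Rightarrow> hybrid_path \<Rightarrow> sense \<Rightarrow> nat \<Rightarrow> real \<Rightarrow> real \<Rightarrow> bool" where
  "arc_piece T X \<sigma> j a b \<longleftrightarrow> a < b \<and> (\<exists>c. \<forall>s\<in>{a..b}.
     c = pos X (s, j) + (sense_sign \<sigma> * radius T (reg X j)) *\<^sub>R
           (cos (orient X (s, j)), - sin (orient X (s, j))))"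

text \<open>
  Between the times \<open>a\<close> and \<open>d\<close>, the path crosses from piece \<open>j - 1\<close> to piece \<open>j\<close> along a line,
  two arcs traveled in the same sense on either side of the boundary, and a line.  The arcs lie
  inside their regions, so that they meet the boundary at the crossing only; in particular they
  do not graze other edges.
\<close>

definition crosses_LCL :: "terrain \<Rightarrow> hybrid_path \<Rightarrow> nat \<Rightarrow> real \<Rightarrow> real \<Rightarrow> bool" where
  "crosses_LCL T X j a d \<longleftrightarrow> (\<exists>\<sigma> b c. b < time X j \<and> time X j < c \<and>
     line_piece X (j - 1) a b \<and> arc_piece T X \<sigma> (j - 1) b (time X j) \<and>
     arc_piece T X \<sigma> j (time X j) c \<and> line_piece X j c d \<and>
     (\<forall>s\<in>{b..<time X j}. pos X (s, j - 1) \<in> interior (region T (reg X (j - 1)))) \<and>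
     (\<forall>s\<in>{time X j<..c}. pos X (s, j) \<in> interior (region T (reg X j))))"

text \<open>
  The arcs are replaced by straight pieces.  As the orientation is continuous at crossings, the two
  lines below form a single straight line across the boundary.
\<close>

definition crosses_L :: "hybrid_path \<Rightarrow> nat \<Rightarrow> real \<Rightarrow> real \<Rightarrow> bool" where
  "crosses_L X j a d \<longleftrightarrow> line_piece X (j - 1) a (time X j) \<and> line_piece X j (time X j) d"

end

theory Submission
  imports Defs
begin

text \<open>
  A minimum-time path cannot be shortened by moving the point at which it crosses the boundary, nor
  by changing the heading with which it crosses. Both conditions of the theorem are the
  vanishing of the first derivative of travel time under such a variation.

  Near the crossing the two regions fill the two sides of a straight edge. The path through the
  crossing is varied as follows. The crossing point is displaced along the edge, the durations of
  the two arcs are changed so that the headings still agree at the edge, and the two straight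
  pieces are replaced by flat S-shaped curves which absorb the resulting displacement of their
  end points while all headings at these end points are kept. The decisive estimate is
  \<open>lateral_shift\<close>: an S-curve that moves by \<open>n\<close> forward and by \<open>m\<close> sideways takes at most the
  time \<open>n / v + m\<^sup>2 / (n * v)\<close>, so sideways displacements are free to first order. Forward
  displacements cost their length divided by the speed. Hence moving the crossing by \<open>c * h\<close> along
  the edge changes the time by \<open>c * h * (sin \<theta>\<^sub>p / v\<^sub>p - sin \<theta>\<^sub>p' / v\<^sub>p')\<close> to first order,
  and prolonging the arc before the crossing by \<open>k * h\<close> costs \<open>k * h * (1 - cos \<Delta>\<theta>\<^sub>p)\<close>: the
  duration of the extra turn, less what it advances along the first line
  (\<open>approach_variation\<close>). The part after the crossing is treated by the same lemma, read backwards
  in time. Since both arcs turn in the same sense, keeping the headings equal at the edge means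
  that one of them is prolonged and the other one shortened, in inverse ratio to their turning
  rates \<open>v\<^sub>p / r\<^sub>p\<close> and \<open>v\<^sub>p' / r\<^sub>p'\<close>; this turns the second condition into the relation of the radii.

  For a crossing by straight pieces only the displacement along the edge is used. It gives
  \<open>sin \<theta>\<^sub>p / v\<^sub>p = sin \<theta>\<^sub>p / v\<^sub>p'\<close>, hence \<open>sin \<theta>\<^sub>p = 0\<close> for different speeds.

  The denominators do not vanish for geometric reasons. An arc that is a full turn would have its
  far end at the crossing point, but that end is interior to a region. If both lines were
  perpendicular to the edge, then one of the two arcs would end on the wrong side of it.
\<close>

section \<open>Frames moving with the vehicle\<close>

definition heading :: "real \<Rightarrow> real \<times> real" where
  "heading \<theta> = (sin \<theta>, cos \<theta>)"

definition rightward :: "real \<Rightarrow> real \<times> real" where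
  "rightward \<theta> = (cos \<theta>, - sin \<theta>)"

lemma inner_heading: "heading \<alpha> \<bullet> heading \<beta> = cos (\<alpha> - \<beta>)"
  and inner_heading_rightward: "heading \<alpha> \<bullet> rightward \<beta> = sin (\<alpha> - \<beta>)"
  and inner_rightward: "rightward \<alpha> \<bullet> rightward \<beta> = cos (\<alpha> - \<beta>)"
  by (simp_all add: heading_def rightward_def cos_diff sin_diff algebra_simps)

lemma norm_heading [simp]: "norm (heading \<theta>) = 1"
  by (simp add: norm_eq_sqrt_inner inner_heading)

lemma norm_rightward [simp]: "norm (rightward \<theta>) = 1"
  by (simp add: norm_eq_sqrt_inner inner_rightward)

lemma rightward_add: "rightward (\<theta> + x) = cos x *\<^sub>R rightward \<theta> - sin x *\<^sub>R heading \<theta>"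
  by (simp add: heading_def rightward_def sin_add cos_add algebra_simps)

lemma frame_expansion: "w = (w \<bullet> heading \<theta>) *\<^sub>R heading \<theta> + (w \<bullet> rightward \<theta>) *\<^sub>R rightward \<theta>"
proof -
  obtain a b where w: "w = (a, b)" by fastforce
  have "(sin \<theta>)\<^sup>2 + (cos \<theta>)\<^sup>2 = 1" by simp
  then have "a = (a * sin \<theta> + b * cos \<theta>) * sin \<theta> + (a * cos \<theta> - b * sin \<theta>) * cos \<theta>"
    and "b = (a * sin \<theta> + b * cos \<theta>) * cos \<theta> - (a * cos \<theta> - b * sin \<theta>) * sin \<theta>"
    by algebra+
  then show ?thesis by (simp add: w heading_def rightward_def)
qed

lemma heading_minus_pi: "heading (\<theta> - pi) = - heading \<theta>"
  and heading_plus_pi: "heading (\<theta> + pi) = - heading \<theta>"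
  by (simp_all add: heading_def)

lemma has_vector_derivative_heading:
  assumes "(f has_real_derivative f') (at s)"
  shows "((\<lambda>s. heading (f s)) has_vector_derivative f' *\<^sub>R rightward (f s)) (at s)"
  unfolding heading_def rightward_def scaleR_Pair
  by (intro has_vector_derivative_Pair)
    (use assms in \<open>auto intro!: derivative_eq_intros simp flip: has_real_derivative_iff_has_vector_derivative\<close>)

lemma has_vector_derivative_rightward:
  assumes "(f has_real_derivative f') (at s)"
  shows "((\<lambda>s. rightward (f s)) has_vector_derivative - f' *\<^sub>R heading (f s)) (at s)"
  unfolding heading_def rightward_def scaleR_Pair
  by (intro has_vector_derivative_Pair)
    (use assms in \<open>auto intro!: derivative_eq_intros simp flip: has_real_derivative_iff_has_vector_derivative\<close>)

section \<open>Paths with bounded turning rate\<close>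

text \<open>
  The dynamics within a region, with absolute continuity weakened to continuity. The weaker form is
  easier to establish for paths assembled from pieces, and it is equivalent because the derivatives
  are bounded (\<open>dynamics_on_piece_iff_steers\<close>).
\<close>

definition steers ::
  "real \<Rightarrow> real \<Rightarrow> (real \<Rightarrow> real \<times> real) \<Rightarrow> (real \<Rightarrow> real) \<Rightarrow> (real \<Rightarrow> real) \<Rightarrow> real \<Rightarrow> real \<Rightarrow> bool"
  where "steers v w P \<theta> u a b \<longleftrightarrow>
     continuous_on {a..b} P \<and> continuous_on {a..b} \<theta> \<and> piecewise_continuous_on a b u \<and>
     (\<forall>s\<in>{a..b}. \<bar>u s\<bar> \<le> w) \<and>
     (\<exists>S. finite S \<and> (\<forall>s\<in>{a<..<b} - S.
        (P has_vector_derivative v *\<^sub>R heading (\<theta> s)) (at s) \<and>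
        (\<theta> has_real_derivative u s) (at s)))"

text \<open>A single interval is an admissible disjoint family.\<close>

lemma abs_continuous_imp_continuous:
  assumes "abs_continuous_on a b f"
  shows "continuous_on {a..b} f"
  unfolding continuous_on_iff
proof (intro ballI allI impI)
  fix s e :: real assume s: "s \<in> {a..b}" and "e > 0"
  then obtain \<delta> where \<delta>: "\<delta> > 0" "\<forall>D :: (real \<times> real) set.
     finite D \<and> (\<forall>(l, r)\<in>D. a \<le> l \<and> l \<le> r \<and> r \<le> b) \<and>
     pairwise (\<lambda>(l, r) (l', r'). {l<..<r} \<inter> {l'<..<r'} = {}) D \<and>
     (\<Sum>(l, r)\<in>D. r - l) < \<delta> \<longrightarrow> (\<Sum>(l, r)\<in>D. \<bar>f r - f l\<bar>) < e"
    using assms unfolding abs_continuous_on_def by blast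
  have close: "\<bar>f r - f l\<bar> < e" if "a \<le> l" "l \<le> r" "r \<le> b" "r - l < \<delta>" for l r
    using \<delta>(2)[rule_format, of "{(l, r)}"] that by (simp add: pairwise_def)
  have "dist (f s') (f s) < e" if "s' \<in> {a..b}" "dist s' s < \<delta>" for s'
  proof (cases "s' \<le> s")
    case True
    then show ?thesis using close[of s' s] that s by (simp add: dist_real_def abs_minus_commute)
  next
    case False
    then show ?thesis using close[of s s'] that s by (simp add: dist_real_def)
  qed
  then show "\<exists>\<delta>>0. \<forall>s'\<in>{a..b}. dist s' s < \<delta> \<longrightarrow> dist (f s') (f s) < e"
    using \<delta>(1) by blast
qed

text \<open>
  By the fundamental theorem of calculus, which tolerates finitely many exceptional points, such a
  function is Lipschitz continuous.
\<close>

lemma bounded_derivative_imp_abs_continuous: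
  fixes f :: "real \<Rightarrow> real"
  assumes "continuous_on {a..b} f" and "finite S" and "M \<ge> 0"
    and "\<And>s. s \<in> {a<..<b} - S \<Longrightarrow> \<exists>f'. (f has_real_derivative f') (at s) \<and> \<bar>f'\<bar> \<le> M"
  shows "abs_continuous_on a b f"
proof -
  obtain f' where f': "\<And>s. s \<in> {a<..<b} - S \<Longrightarrow> (f has_real_derivative f' s) (at s) \<and> \<bar>f' s\<bar> \<le> M"
    using assms(4) by metis
  have lip: "\<bar>f r - f l\<bar> \<le> M * (r - l)" if "a \<le> l" "l \<le> r" "r \<le> b" for l r
  proof -
    define h where "h s = (if s \<in> {a<..<b} - S then f' s else 0)" for s
    have "(h has_integral f r - f l) {l..r}"
    proof (rule fundamental_theorem_of_calculus_interior_strong[OF \<open>finite S\<close> \<open>l \<le> r\<close>])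
      show "continuous_on {l..r} f"
        using assms(1) that by (auto intro: continuous_on_subset)
      show "(f has_vector_derivative h s) (at s)" if "s \<in> {l<..<r} - S" for s
        using f'[of s] that \<open>a \<le> l\<close> \<open>r \<le> b\<close>
        by (auto simp: h_def has_real_derivative_iff_has_vector_derivative)
    qed
    then show ?thesis
      using has_integral_bound_real[of M "{}" h "f r - f l" l r] f' \<open>M \<ge> 0\<close> that
      by (auto simp: h_def)
  qed
  show ?thesis
    unfolding abs_continuous_on_def
  proof (intro allI impI)
    fix e :: real assume "e > 0"
    have "(\<Sum>(l, r)\<in>D. \<bar>f r - f l\<bar>) < e"
      if "\<forall>(l, r)\<in>D. a \<le> l \<and> l \<le> r \<and> r \<le> b" "(\<Sum>(l, r)\<in>D. r - l) < e / (M + 1)" for D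
    proof -
      have "(\<Sum>(l, r)\<in>D. \<bar>f r - f l\<bar>) \<le> (\<Sum>(l, r)\<in>D. M * (r - l))"
        using that lip by (intro sum_mono) auto
      also have "\<dots> = M * (\<Sum>(l, r)\<in>D. r - l)"
        by (simp add: sum_distrib_left case_prod_beta)
      also have "\<dots> \<le> (M + 1) * (\<Sum>(l, r)\<in>D. r - l)"
        using that by (intro mult_right_mono sum_nonneg) auto
      also have "\<dots> < e"
        using that(2) \<open>M \<ge> 0\<close> by (simp add: pos_less_divide_eq mult.commute)
      finally show ?thesis .
    qed
    then show "\<exists>\<delta>>0. \<forall>D. finite D \<and> (\<forall>(l, r)\<in>D. a \<le> l \<and> l \<le> r \<and> r \<le> b) \<and>
        pairwise (\<lambda>(l, r) (l', r'). {l<..<r} \<inter> {l'<..<r'} = {}) D \<and> (\<Sum>(l, r)\<in>D. r - l) < \<delta> \<longrightarrow>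
        (\<Sum>(l, r)\<in>D. \<bar>f r - f l\<bar>) < e"
      using \<open>e > 0\<close> \<open>M \<ge> 0\<close> by (intro exI[of _ "e / (M + 1)"]) auto
  qed
qed

lemma has_vector_derivative_Pair_iff:
  "((\<lambda>s. (f s, g s)) has_vector_derivative (f', g')) (at s) \<longleftrightarrow>
    (f has_real_derivative f') (at s) \<and> (g has_real_derivative g') (at s)"
proof
  assume *: "((\<lambda>s. (f s, g s)) has_vector_derivative (f', g')) (at s)"
  show "(f has_real_derivative f') (at s) \<and> (g has_real_derivative g') (at s)"
    using bounded_linear.has_vector_derivative[OF bounded_linear_fst *]
      bounded_linear.has_vector_derivative[OF bounded_linear_snd *]
    by (simp add: has_real_derivative_iff_has_vector_derivative)
qed (auto intro: has_vector_derivative_Pair simp: has_real_derivative_iff_has_vector_derivative)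

lemma dynamics_on_piece_iff_steers:
  "dynamics_on_piece T X j \<longleftrightarrow>
    steers (speed T (reg X j)) (max_turn_rate T (reg X j)) (\<lambda>s. pos X (s, j))
      (\<lambda>s. orient X (s, j)) (\<lambda>s. ctrl X (s, j)) (time X j) (time X (Suc j))"
  (is "?L \<longleftrightarrow> ?R")
proof
  assume ?L
  then show ?R
    by (auto simp: dynamics_on_piece_def steers_def Let_def pos_def heading_def
        has_vector_derivative_Pair_iff intro!: abs_continuous_imp_continuous continuous_intros)
next
  assume R: ?R
  let ?v = "speed T (reg X j)" and ?w = "max_turn_rate T (reg X j)"
    and ?a = "time X j" and ?b = "time X (Suc j)"
  obtain S where S: "finite S" "\<And>s. s \<in> {?a<..<?b} - S \<Longrightarrow>
      ((\<lambda>s. xpos X (s, j)) has_real_derivative ?v * sin (orient X (s, j))) (at s) \<and>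
      ((\<lambda>s. ypos X (s, j)) has_real_derivative ?v * cos (orient X (s, j))) (at s) \<and>
      ((\<lambda>s. orient X (s, j)) has_real_derivative ctrl X (s, j)) (at s)"
    using R unfolding steers_def by (auto simp: pos_def heading_def has_vector_derivative_Pair_iff)
  have c: "continuous_on {?a..?b} (\<lambda>s. pos X (s, j))" "continuous_on {?a..?b} (\<lambda>s. orient X (s, j))"
    and u: "\<And>s. s \<in> {?a..?b} \<Longrightarrow> \<bar>ctrl X (s, j)\<bar> \<le> ?w"
    using R unfolding steers_def by auto
  have "continuous_on {?a..?b} (\<lambda>s. xpos X (s, j))" "continuous_on {?a..?b} (\<lambda>s. ypos X (s, j))"
    using continuous_on_fst[OF c(1)] continuous_on_snd[OF c(1)] by (simp_all add: pos_def)
  moreover have "\<bar>?v * sin x\<bar> \<le> \<bar>?v\<bar>" "\<bar>?v * cos x\<bar> \<le> \<bar>?v\<bar>" for x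
    by (simp_all add: abs_mult mult_left_le)
  ultimately have "abs_continuous_on ?a ?b (\<lambda>s. xpos X (s, j))"
    and "abs_continuous_on ?a ?b (\<lambda>s. ypos X (s, j))"
    using S by (metis abs_ge_zero bounded_derivative_imp_abs_continuous)+
  moreover have "abs_continuous_on ?a ?b (\<lambda>s. orient X (s, j))"
  proof (rule bounded_derivative_imp_abs_continuous[OF c(2) S(1), of "\<bar>?w\<bar>"])
    fix s assume "s \<in> {?a<..<?b} - S"
    then show "\<exists>f'. ((\<lambda>s. orient X (s, j)) has_real_derivative f') (at s) \<and> \<bar>f'\<bar> \<le> \<bar>?w\<bar>"
      using S(2)[of s] u[of s] by (intro exI[of _ "ctrl X (s, j)"]) auto
  qed simp
  ultimately show ?L
    using R S unfolding dynamics_on_piece_def steers_def Let_def by blast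
qed

text \<open>
  Excluding the end points of the interval as well makes the domain of continuity open, so that
  continuity becomes a local property.
\<close>

lemma piecewise_continuous_on_iff_isCont:
  "piecewise_continuous_on a b f \<longleftrightarrow>
     (\<exists>S. finite S \<and> (\<forall>s\<in>{a<..<b} - S. isCont f s)) \<and>
     (\<forall>s\<in>{a..<b}. \<exists>l. (f \<longlongrightarrow> l) (at_right s)) \<and>
     (\<forall>s\<in>{a<..b}. \<exists>l. (f \<longlongrightarrow> l) (at_left s))"
proof -
  have "(\<exists>S. finite S \<and> continuous_on ({a..b} - S) f) \<longleftrightarrow>
     (\<exists>S. finite S \<and> (\<forall>s\<in>{a<..<b} - S. isCont f s))"
  proof (intro iffI; elim exE conjE)
    fix S assume S: "finite S" "continuous_on ({a..b} - S) f"
    have "open ({a<..<b} - S)" using S by (simp add: open_Diff finite_imp_closed)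
    then have "\<forall>s\<in>{a<..<b} - S. isCont f s"
      using continuous_on_subset[OF S(2), of "{a<..<b} - S"] continuous_on_eq_continuous_at
      by (smt (verit) Diff_iff atLeastAtMost_iff greaterThanLessThan_iff subsetI)
    then show "\<exists>S. finite S \<and> (\<forall>s\<in>{a<..<b} - S. isCont f s)" using S by blast
  next
    fix S assume S: "finite S" "\<forall>s\<in>{a<..<b} - S. isCont f s"
    have "continuous_on ({a..b} - (insert a (insert b S))) f"
      using S(2) by (intro continuous_at_imp_continuous_on) auto
    then show "\<exists>S. finite S \<and> continuous_on ({a..b} - S) f"
      using S(1) by (intro exI[of _ "insert a (insert b S)"]) simp
  qed
  then show ?thesis unfolding piecewise_continuous_on_def by blast
qed

lemma steers_subinterval:
  assumes "steers v w P \<theta> u a b" "a \<le> a'" "b' \<le> b"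
  shows "steers v w P \<theta> u a' b'"
proof -
  have sub: "{a'..b'} \<subseteq> {a..b}" "{a'<..<b'} \<subseteq> {a<..<b}" "{a'..<b'} \<subseteq> {a..<b}" "{a'<..b'} \<subseteq> {a<..b}"
    using assms by auto
  have "piecewise_continuous_on a b u" using assms(1) by (simp add: steers_def)
  then have "piecewise_continuous_on a' b' u"
    unfolding piecewise_continuous_on_iff_isCont using sub by (meson Diff_mono in_mono subset_refl)
  then show ?thesis
    using assms(1) sub unfolding steers_def by (meson Diff_mono continuous_on_subset in_mono subset_refl)
qed

lemma limit_exists_cong:
  assumes "\<forall>\<^sub>F r in F. f r = g r" "\<exists>l. (g \<longlongrightarrow> l) F"
  shows "\<exists>l. (f \<longlongrightarrow> l) F"
  using assms tendsto_cong by fast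

lemma steers_join:
  assumes "steers v w P1 \<theta>1 u1 a b" and "steers v w P2 \<theta>2 u2 b c" and "a \<le> b" "b \<le> c"
    and "P1 b = P2 b" "\<theta>1 b = \<theta>2 b"
  shows "steers v w (\<lambda>s. if s \<le> b then P1 s else P2 s) (\<lambda>s. if s \<le> b then \<theta>1 s else \<theta>2 s)
    (\<lambda>s. if s \<le> b then u1 s else u2 s) a c"
proof -
  have lt: "\<forall>\<^sub>F r in nhds s. r < b" if "s < b" for s
    using that by (rule eventually_nhds_in_open[of "{..<b}", simplified])
  have gt: "\<forall>\<^sub>F r in nhds s. r > b" if "s > b" for s
    using that by (rule eventually_nhds_in_open[of "{b<..}", simplified])
  let ?P = "\<lambda>s. if s \<le> b then P1 s else P2 s" and ?\<theta> = "\<lambda>s. if s \<le> b then \<theta>1 s else \<theta>2 s"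
    and ?u = "\<lambda>s. if s \<le> b then u1 s else u2 s"
  obtain S1 where S1: "finite S1" "\<And>s. s \<in> {a<..<b} - S1 \<Longrightarrow>
        (P1 has_vector_derivative v *\<^sub>R heading (\<theta>1 s)) (at s) \<and> (\<theta>1 has_real_derivative u1 s) (at s)"
    using assms(1) unfolding steers_def by blast
  obtain S2 where S2: "finite S2" "\<And>s. s \<in> {b<..<c} - S2 \<Longrightarrow>
        (P2 has_vector_derivative v *\<^sub>R heading (\<theta>2 s)) (at s) \<and> (\<theta>2 has_real_derivative u2 s) (at s)"
    using assms(2) unfolding steers_def by blast
  have deriv: "(?P has_vector_derivative v *\<^sub>R heading (?\<theta> s)) (at s) \<and> (?\<theta> has_real_derivative ?u s) (at s)"
    if "s \<in> {a<..<c} - (insert b (S1 \<union> S2))" for s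
  proof (cases "s < b")
    case True
    have "(?P has_vector_derivative v *\<^sub>R heading (\<theta>1 s)) (at s)" "(?\<theta> has_real_derivative u1 s) (at s)"
      using True that S1(2)[of s]
        has_vector_derivative_transform_within_open[of P1 _ s "{..<b}" ?P]
        has_field_derivative_transform_within_open[of \<theta>1 _ s "{..<b}" ?\<theta>] by auto
    then show ?thesis using True by auto
  next
    case False
    then have "s > b" using that by auto
    then have "(?P has_vector_derivative v *\<^sub>R heading (\<theta>2 s)) (at s)" "(?\<theta> has_real_derivative u2 s) (at s)"
      using that S2(2)[of s]
        has_vector_derivative_transform_within_open[of P2 _ s "{b<..}" ?P]
        has_field_derivative_transform_within_open[of \<theta>2 _ s "{b<..}" ?\<theta>] by auto
    then show ?thesis using \<open>s > b\<close> by auto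
  qed
  have cont: "continuous_on {a..c} ?P" "continuous_on {a..c} ?\<theta>"
  proof -
    have eq: "{a..c} = {a..b} \<union> {b..c}" using assms by auto
    show "continuous_on {a..c} ?P" "continuous_on {a..c} ?\<theta>"
      unfolding eq using assms by (auto intro!: continuous_on_If simp: steers_def)
  qed
  have pw: "piecewise_continuous_on a c ?u"
    unfolding piecewise_continuous_on_iff_isCont
  proof (intro conjI ballI)
    have pc: "piecewise_continuous_on a b u1" "piecewise_continuous_on b c u2"
      using assms by (auto simp: steers_def)
    obtain R1 where R1: "finite R1" "\<And>s. s \<in> {a<..<b} - R1 \<Longrightarrow> isCont u1 s"
      using pc(1) unfolding piecewise_continuous_on_iff_isCont by blast
    obtain R2 where R2: "finite R2" "\<And>s. s \<in> {b<..<c} - R2 \<Longrightarrow> isCont u2 s"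
      using pc(2) unfolding piecewise_continuous_on_iff_isCont by blast
    have "isCont ?u s" if "s \<in> {a<..<c} - (insert b (R1 \<union> R2))" for s
    proof (cases "s < b")
      case True
      then have "isCont u1 s" using that R1 by auto
      moreover have ev: "\<forall>\<^sub>F r in nhds s. ?u r = u1 r" using lt[OF True] by eventually_elim auto
      ultimately show ?thesis using isCont_cong[OF ev] by blast
    next
      case False
      then have "s > b" using that by auto
      then have "isCont u2 s" using that R2 by auto
      moreover have ev: "\<forall>\<^sub>F r in nhds s. ?u r = u2 r" using gt[OF \<open>s > b\<close>] by eventually_elim auto
      ultimately show ?thesis using isCont_cong[OF ev] by blast
    qed
    then show "\<exists>S. finite S \<and> (\<forall>s\<in>{a<..<c} - S. isCont ?u s)"
      using R1(1) R2(1) by (intro exI[of _ "insert b (R1 \<union> R2)"]) auto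
    show "\<exists>l. (?u \<longlongrightarrow> l) (at_right s)" if s: "s \<in> {a..<c}" for s
    proof (cases "s < b")
      case True
      then have "\<forall>\<^sub>F r in at_right s. ?u r = u1 r" unfolding eventually_at_right_field
        by (intro exI[of _ b]) auto
      moreover have "\<exists>l. (u1 \<longlongrightarrow> l) (at_right s)"
        using pc(1) s True unfolding piecewise_continuous_on_def by auto
      ultimately show ?thesis by (rule limit_exists_cong)
    next
      case False
      then have "\<forall>\<^sub>F r in at_right s. ?u r = u2 r" unfolding eventually_at_right_field
        by (intro exI[of _ "s + 1"]) auto
      moreover have "\<exists>l. (u2 \<longlongrightarrow> l) (at_right s)"
        using pc(2) s False unfolding piecewise_continuous_on_def by auto
      ultimately show ?thesis by (rule limit_exists_cong)
    qed
    show "\<exists>l. (?u \<longlongrightarrow> l) (at_left s)" if s: "s \<in> {a<..c}" for s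
    proof (cases "s \<le> b")
      case True
      then have "\<forall>\<^sub>F r in at_left s. ?u r = u1 r" unfolding eventually_at_left_field
        by (intro exI[of _ "s - 1"]) auto
      moreover have "\<exists>l. (u1 \<longlongrightarrow> l) (at_left s)"
        using pc(1) s True unfolding piecewise_continuous_on_def by auto
      ultimately show ?thesis by (rule limit_exists_cong)
    next
      case False
      then have "\<forall>\<^sub>F r in at_left s. ?u r = u2 r" unfolding eventually_at_left_field
        by (intro exI[of _ b]) auto
      moreover have "\<exists>l. (u2 \<longlongrightarrow> l) (at_left s)"
        using pc(2) s False unfolding piecewise_continuous_on_def by auto
      ultimately show ?thesis by (rule limit_exists_cong)
    qed
  qed
  have "finite (insert b (S1 \<union> S2))" using S1(1) S2(1) by simp
  moreover have "\<forall>s\<in>{a..c}. \<bar>?u s\<bar> \<le> w" using assms unfolding steers_def by auto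
  ultimately show ?thesis unfolding steers_def using deriv cont pw by blast
qed

lemma limit_exists_compose:
  fixes g :: "real \<Rightarrow> real"
  assumes "filterlim f G F" "\<exists>l. (g \<longlongrightarrow> l) G"
  shows "\<exists>l. ((\<lambda>x. g (f x)) \<longlongrightarrow> l) F" "\<exists>l. ((\<lambda>x. - g (f x)) \<longlongrightarrow> l) F"
  using assms filterlim_compose tendsto_minus by blast+

lemma steers_shift:
  assumes "steers v w P \<theta> u a b"
  shows "steers v w (\<lambda>s. P (s - h)) (\<lambda>s. \<theta> (s - h)) (\<lambda>s. u (s - h)) (a + h) (b + h)"
proof -
  obtain S where S: "finite S" "\<And>s. s \<in> {a<..<b} - S \<Longrightarrow>
        (P has_vector_derivative v *\<^sub>R heading (\<theta> s)) (at s) \<and> (\<theta> has_real_derivative u s) (at s)"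
    using assms unfolding steers_def by blast
  have pc: "piecewise_continuous_on a b u" using assms by (simp add: steers_def)
  obtain R where R: "finite R" "\<And>s. s \<in> {a<..<b} - R \<Longrightarrow> isCont u s"
    using pc unfolding piecewise_continuous_on_iff_isCont by blast
  have "((\<lambda>s. P (s - h)) has_vector_derivative v *\<^sub>R heading (\<theta> (s - h))) (at s) \<and>
      ((\<lambda>s. \<theta> (s - h)) has_real_derivative u (s - h)) (at s)"
    if "s \<in> {a+h<..<b+h} - (\<lambda>s. s + h) ` S" for s
  proof -
    have "s - h \<in> {a<..<b} - S" using that by (force simp: image_iff)
    note d = S(2)[OF this]
    have "((\<lambda>s. s - h) has_vector_derivative 1) (at s)" "((\<lambda>s. s - h) has_real_derivative 1) (at s)"
      by (auto intro!: derivative_eq_intros)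
    then show ?thesis
      using vector_diff_chain_at[of "\<lambda>s. s - h" 1 s P, OF _ conjunct1[OF d], unfolded o_def scaleR_one]
        DERIV_chain2[where g = "\<lambda>s. s - h" and x = s, OF conjunct2[OF d], of 1, unfolded mult_1_right] by blast
  qed
  moreover have "piecewise_continuous_on (a + h) (b + h) (\<lambda>s. u (s - h))"
    unfolding piecewise_continuous_on_iff_isCont
  proof (intro conjI ballI)
    have "isCont (\<lambda>s. u (s - h)) s" if "s \<in> {a+h<..<b+h} - (\<lambda>s. s + h) ` R" for s
    proof -
      have "s - h \<in> {a<..<b} - R" using that by (force simp: image_iff)
      then show ?thesis using isCont_o2[where f = "\<lambda>s. s - h" and a = s and g = u] R(2) by simp
    qed
    then show "\<exists>S. finite S \<and> (\<forall>s\<in>{a+h<..<b+h} - S. isCont (\<lambda>s. u (s - h)) s)"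
      using R(1) by (intro exI[of _ "(\<lambda>s. s + h) ` R"]) auto
    show "\<exists>l. ((\<lambda>s. u (s - h)) \<longlongrightarrow> l) (at_right s)" if s: "s \<in> {a+h..<b+h}" for s
    proof -
      have "filterlim (\<lambda>s. s - h) (at_right (s - h)) (at_right s)"
        unfolding filterlim_at by (auto intro!: tendsto_intros eventually_at_rightI[of _ "s+1"])
      moreover have "\<exists>l. (u \<longlongrightarrow> l) (at_right (s - h))"
        using pc s unfolding piecewise_continuous_on_def by auto
      ultimately show ?thesis by (rule limit_exists_compose)
    qed
    show "\<exists>l. ((\<lambda>s. u (s - h)) \<longlongrightarrow> l) (at_left s)" if s: "s \<in> {a+h<..b+h}" for s
    proof -
      have "filterlim (\<lambda>s. s - h) (at_left (s - h)) (at_left s)"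
        unfolding filterlim_at by (auto intro!: tendsto_intros eventually_at_leftI[of "s-1"])
      moreover have "\<exists>l. (u \<longlongrightarrow> l) (at_left (s - h))"
        using pc s unfolding piecewise_continuous_on_def by auto
      ultimately show ?thesis by (rule limit_exists_compose)
    qed
  qed
  moreover have "continuous_on {a+h..b+h} (\<lambda>s. P (s - h))" "continuous_on {a+h..b+h} (\<lambda>s. \<theta> (s - h))"
    using assms unfolding steers_def
    by (auto intro!: continuous_on_compose2[of "{a..b}" _ _ "\<lambda>s. s - h"] continuous_intros)
  moreover have "\<forall>s\<in>{a+h..b+h}. \<bar>u (s - h)\<bar> \<le> w" using assms unfolding steers_def by auto
  moreover have "finite ((\<lambda>s. s + h) ` S)" using S(1) by simp
  ultimately show ?thesis unfolding steers_def by blast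
qed

text \<open>
  A vehicle that retraces its path points in the opposite direction. The heading is lowered by
  \<open>pi\<close>, so a path that starts with heading \<open>\<beta> + pi\<close> is turned into one that ends with heading
  \<open>\<beta>\<close> exactly, not only up to a full turn.
\<close>

lemma steers_reverse:
  assumes "steers v w P \<theta> u 0 h"
  shows "steers v w (\<lambda>s. P (h - s)) (\<lambda>s. \<theta> (h - s) - pi) (\<lambda>s. - u (h - s)) 0 h"
proof -
  obtain S where S: "finite S" "\<And>s. s \<in> {0<..<h} - S \<Longrightarrow>
        (P has_vector_derivative v *\<^sub>R heading (\<theta> s)) (at s) \<and> (\<theta> has_real_derivative u s) (at s)"
    using assms unfolding steers_def by blast
  have pc: "piecewise_continuous_on 0 h u" using assms by (simp add: steers_def)
  obtain R where R: "finite R" "\<And>s. s \<in> {0<..<h} - R \<Longrightarrow> isCont u s"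
    using pc unfolding piecewise_continuous_on_iff_isCont by blast
  have "((\<lambda>s. P (h - s)) has_vector_derivative v *\<^sub>R heading (\<theta> (h - s) - pi)) (at s) \<and>
      ((\<lambda>s. \<theta> (h - s) - pi) has_real_derivative - u (h - s)) (at s)"
    if "s \<in> {0<..<h} - (\<lambda>s. h - s) ` S" for s
  proof -
    have "h - s \<in> {0<..<h} - S" using that by (force simp: image_iff)
    note d = S(2)[OF this]
    have "((\<lambda>s. h - s) has_vector_derivative -1) (at s)"
      and D: "((\<lambda>s. h - s) has_real_derivative -1) (at s)"
      by (auto intro!: derivative_eq_intros)
    then have "((\<lambda>s. P (h - s)) has_vector_derivative v *\<^sub>R heading (\<theta> (h - s) - pi)) (at s)"
      using vector_diff_chain_at[of "\<lambda>s::real. h - s" "-1" s P, OF _ conjunct1[OF d], unfolded o_def]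
      by (simp add: heading_minus_pi)
    moreover have "((\<lambda>s. \<theta> (h - s) - pi) has_real_derivative - u (h - s)) (at s)"
      using DERIV_diff[OF DERIV_chain2[where g = "\<lambda>s. h - s" and x = s, OF conjunct2[OF d] D] DERIV_const[of pi]] by simp
    ultimately show ?thesis by blast
  qed
  moreover have "piecewise_continuous_on 0 h (\<lambda>s. - u (h - s))"
    unfolding piecewise_continuous_on_iff_isCont
  proof (intro conjI ballI)
    have "isCont (\<lambda>s. - u (h - s)) s" if "s \<in> {0<..<h} - (\<lambda>s. h - s) ` R" for s
    proof -
      have "h - s \<in> {0<..<h} - R" using that by (force simp: image_iff)
      then show ?thesis using isCont_o2[where f = "\<lambda>s. h - s" and a = s and g = u] R(2) by simp
    qed
    then show "\<exists>S. finite S \<and> (\<forall>s\<in>{0<..<h} - S. isCont (\<lambda>s. - u (h - s)) s)"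
      using R(1) by (intro exI[of _ "(\<lambda>s. h - s) ` R"]) auto
    show "\<exists>l. ((\<lambda>s. - u (h - s)) \<longlongrightarrow> l) (at_right s)" if s: "s \<in> {0..<h}" for s
    proof -
      have "filterlim (\<lambda>s. h - s) (at_left (h - s)) (at_right s)"
        unfolding filterlim_at by (auto intro!: tendsto_intros eventually_at_rightI[of _ "s+1"])
      moreover have "\<exists>l. (u \<longlongrightarrow> l) (at_left (h - s))"
        using pc s unfolding piecewise_continuous_on_def by auto
      ultimately show ?thesis by (rule limit_exists_compose)
    qed
    show "\<exists>l. ((\<lambda>s. - u (h - s)) \<longlongrightarrow> l) (at_left s)" if s: "s \<in> {0<..h}" for s
    proof -
      have "filterlim (\<lambda>s. h - s) (at_right (h - s)) (at_left s)"
        unfolding filterlim_at by (auto intro!: tendsto_intros eventually_at_leftI[of "s-1"])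
      moreover have "\<exists>l. (u \<longlongrightarrow> l) (at_right (h - s))"
        using pc s unfolding piecewise_continuous_on_def by auto
      ultimately show ?thesis by (rule limit_exists_compose)
    qed
  qed
  moreover have "continuous_on {0..h} (\<lambda>s. P (h - s))" "continuous_on {0..h} (\<lambda>s. \<theta> (h - s) - pi)"
    using assms unfolding steers_def
    by (auto intro!: continuous_on_compose2[of "{0..h}" _ _ "\<lambda>s. h - s"] continuous_intros)
  moreover have "\<forall>s\<in>{0..h}. \<bar>- u (h - s)\<bar> \<le> w" using assms unfolding steers_def by auto
  moreover have "finite ((\<lambda>s. h - s) ` S)" using S(1) by simp
  ultimately show ?thesis unfolding steers_def by blast
qed

text \<open>
  End points are exempt from lying in \<open>U\<close>, because paths are to start or end on the boundary
  between two regions.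
\<close>

definition travels ::
  "real \<Rightarrow> real \<Rightarrow> (real \<times> real) set \<Rightarrow> real \<times> real \<Rightarrow> real \<Rightarrow> real \<times> real \<Rightarrow> real \<Rightarrow> real \<Rightarrow> bool"
  where "travels v w U A \<alpha> B \<beta> \<tau> \<longleftrightarrow> \<tau> > 0 \<and> (\<exists>P \<theta> u. steers v w P \<theta> u 0 \<tau> \<and>
     P 0 = A \<and> \<theta> 0 = \<alpha> \<and> P \<tau> = B \<and> \<theta> \<tau> = \<beta> \<and> (\<forall>s\<in>{0<..<\<tau>}. P s \<in> U))"

lemma travels_trans:
  assumes "travels v w U A \<alpha> B \<beta> \<tau>" and "travels v w U B \<beta> C \<gamma> \<tau>'" and "B \<in> U"
  shows "travels v w U A \<alpha> C \<gamma> (\<tau> + \<tau>')"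
proof -
  obtain P1 \<theta>1 u1 where 1: "\<tau> > 0" "steers v w P1 \<theta>1 u1 0 \<tau>" "P1 0 = A" "\<theta>1 0 = \<alpha>"
    "P1 \<tau> = B" "\<theta>1 \<tau> = \<beta>" "\<forall>s\<in>{0<..<\<tau>}. P1 s \<in> U"
    using assms(1) unfolding travels_def by blast
  obtain P2 \<theta>2 u2 where 2: "\<tau>' > 0" "steers v w P2 \<theta>2 u2 0 \<tau>'" "P2 0 = B" "\<theta>2 0 = \<beta>"
    "P2 \<tau>' = C" "\<theta>2 \<tau>' = \<gamma>" "\<forall>s\<in>{0<..<\<tau>'}. P2 s \<in> U"
    using assms(2) unfolding travels_def by blast
  let ?P = "\<lambda>s. if s \<le> \<tau> then P1 s else P2 (s - \<tau>)"
  have "steers v w ?P (\<lambda>s. if s \<le> \<tau> then \<theta>1 s else \<theta>2 (s - \<tau>))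
      (\<lambda>s. if s \<le> \<tau> then u1 s else u2 (s - \<tau>)) 0 (\<tau> + \<tau>')"
    using steers_join[OF 1(2), of _ _ _ "\<tau> + \<tau>'"] steers_shift[OF 2(2), of \<tau>] 1 2
    by (simp add: add.commute)
  moreover have "?P s \<in> U" if "s \<in> {0<..<\<tau> + \<tau>'}" for s
    using that 1 2 assms(3) by (cases "s = \<tau>") auto
  ultimately show ?thesis
    unfolding travels_def using 1 2 by (intro conjI exI[of _ ?P]
        exI[of _ "\<lambda>s. if s \<le> \<tau> then \<theta>1 s else \<theta>2 (s - \<tau>)"]
        exI[of _ "\<lambda>s. if s \<le> \<tau> then u1 s else u2 (s - \<tau>)"]) auto
qed

lemma travels_reverse:
  assumes "travels v w U A \<alpha> B \<beta> \<tau>"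
  shows "travels v w U B (\<beta> - pi) A (\<alpha> - pi) \<tau>"
proof -
  obtain P \<theta> u where 1: "\<tau> > 0" "steers v w P \<theta> u 0 \<tau>" "P 0 = A" "\<theta> 0 = \<alpha>"
    "P \<tau> = B" "\<theta> \<tau> = \<beta>" "\<forall>s\<in>{0<..<\<tau>}. P s \<in> U"
    using assms unfolding travels_def by blast
  show ?thesis
    unfolding travels_def using 1 steers_reverse[OF 1(2)]
    by (intro conjI exI[of _ "\<lambda>s. P (\<tau> - s)"] exI[of _ "\<lambda>s. \<theta> (\<tau> - s) - pi"]
        exI[of _ "\<lambda>s. - u (\<tau> - s)"]) auto
qed

lemma steersI_const:
  assumes "\<And>s. (P has_vector_derivative v *\<^sub>R heading (\<theta> s)) (at s)"
    and "\<And>s. (\<theta> has_real_derivative \<kappa>) (at s)" and "\<bar>\<kappa>\<bar> \<le> w"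
  shows "steers v w P \<theta> (\<lambda>_. \<kappa>) a b"
proof -
  have "continuous_on {a..b} P" "continuous_on {a..b} \<theta>"
    using assms(1,2) has_vector_derivative_continuous DERIV_isCont
    by (blast intro: continuous_at_imp_continuous_on)+
  moreover have "piecewise_continuous_on a b (\<lambda>_. \<kappa>)"
    unfolding piecewise_continuous_on_iff_isCont by (auto intro: exI[of _ \<kappa>] exI[of _ "{}"])
  ultimately show ?thesis
    unfolding steers_def using assms by (auto intro: exI[of _ "{}"])
qed

section \<open>S-curves\<close>

text \<open>
  This is \<open>\<integral> heading (\<theta> + \<kappa> t) dt\<close> over \<open>0 \<le> t \<le> s\<close>, the displacement of a vehicle of unit speed that
  turns at the constant rate \<open>\<kappa>\<close>; the closed form is differentiable for all real \<open>s\<close>.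
\<close>

definition turn :: "real \<Rightarrow> real \<Rightarrow> real \<Rightarrow> real \<times> real" where
  "turn \<theta> \<kappa> s = (if \<kappa> = 0 then s *\<^sub>R heading \<theta> else (1 / \<kappa>) *\<^sub>R (rightward \<theta> - rightward (\<theta> + \<kappa> * s)))"

lemma turn_0 [simp]: "turn \<theta> \<kappa> 0 = 0" and turn_straight: "turn \<theta> 0 s = s *\<^sub>R heading \<theta>"
  by (simp_all add: turn_def)

lemma has_vector_derivative_turn:
  "(turn \<theta> \<kappa> has_vector_derivative heading (\<theta> + \<kappa> * s)) (at s)"
proof (cases "\<kappa> = 0")
  case True
  then show ?thesis
    by (auto simp: turn_def[abs_def] intro!: derivative_eq_intros)
next
  case False
  have "((\<lambda>s. rightward (\<theta> + \<kappa> * s)) has_vector_derivative - \<kappa> *\<^sub>R heading (\<theta> + \<kappa> * s)) (at s)"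
    by (rule has_vector_derivative_rightward) (auto intro!: derivative_eq_intros)
  then have "((\<lambda>s. (1 / \<kappa>) *\<^sub>R (rightward \<theta> - rightward (\<theta> + \<kappa> * s)))
      has_vector_derivative (1 / \<kappa>) *\<^sub>R (0 - (- \<kappa> *\<^sub>R heading (\<theta> + \<kappa> * s)))) (at s)"
    by (intro bounded_linear.has_vector_derivative[OF bounded_linear_scaleR_right]
        has_vector_derivative_diff has_vector_derivative_const)
  then show ?thesis using False by (simp add: turn_def[abs_def])
qed

lemma turn_frame:
  "\<kappa> \<noteq> 0 \<Longrightarrow> turn \<theta> \<kappa> s = (sin (\<kappa> * s) / \<kappa>) *\<^sub>R heading \<theta> + ((1 - cos (\<kappa> * s)) / \<kappa>) *\<^sub>R rightward \<theta>"
  by (simp add: turn_def rightward_add algebra_simps divide_inverse)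

lemma steers_turn:
  assumes "\<bar>\<kappa>\<bar> \<le> w"
  shows "steers v w (\<lambda>s. A + v *\<^sub>R turn \<theta> \<kappa> s) (\<lambda>s. \<theta> + \<kappa> * s) (\<lambda>_. \<kappa>) a b"
  using assms
  by (intro steersI_const)
    (auto intro!: derivative_eq_intros bounded_linear.has_vector_derivative[OF bounded_linear_scaleR_right]
      has_vector_derivative_turn)

lemma travels_turn:
  assumes "\<bar>\<kappa>\<bar> \<le> w" "\<tau> > 0" "\<And>s. s \<in> {0<..<\<tau>} \<Longrightarrow> A + v *\<^sub>R turn \<theta> \<kappa> s \<in> U"
  shows "travels v w U A \<theta> (A + v *\<^sub>R turn \<theta> \<kappa> \<tau>) (\<theta> + \<kappa> * \<tau>) \<tau>"
  unfolding travels_def using assms steers_turn[OF assms(1), of v A \<theta> 0 \<tau>]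
  by (intro conjI exI[of _ "\<lambda>s. A + v *\<^sub>R turn \<theta> \<kappa> s"] exI[of _ "\<lambda>s. \<theta> + \<kappa> * s"] exI[of _ "\<lambda>_. \<kappa>"]) auto

lemma parallelogram_in_convex:
  fixes A :: "'a::real_vector"
  assumes "convex U" "A \<in> U" "A + x \<in> U" "A + y \<in> U" "A + x + y \<in> U" "p \<in> {0..1}" "q \<in> {0..1}"
  shows "A + p *\<^sub>R x + q *\<^sub>R y \<in> U"
proof -
  have edges: "(1 - p) *\<^sub>R A + p *\<^sub>R (A + x) \<in> U" "(1 - p) *\<^sub>R (A + y) + p *\<^sub>R (A + x + y) \<in> U"
    using assms by (auto intro: convexD[OF assms(1)])
  have "(1 - q) *\<^sub>R ((1 - p) *\<^sub>R A + p *\<^sub>R (A + x)) + q *\<^sub>R ((1 - p) *\<^sub>R (A + y) + p *\<^sub>R (A + x + y)) \<in> U"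
    using assms(7) by (intro convexD[OF assms(1)] edges) auto
  also have "(1 - q) *\<^sub>R ((1 - p) *\<^sub>R A + p *\<^sub>R (A + x)) + q *\<^sub>R ((1 - p) *\<^sub>R (A + y) + p *\<^sub>R (A + x + y))
      = A + p *\<^sub>R x + q *\<^sub>R y"
    by (simp add: algebra_simps)
  finally show ?thesis .
qed

lemma sin_cos_ratios:
  fixes \<epsilon> x :: real
  assumes "\<bar>\<epsilon>\<bar> < pi / 2" "\<epsilon> \<noteq> 0" "x / \<epsilon> \<in> {0..1}"
  shows "sin x / sin \<epsilon> \<in> {0..1}" "(1 - cos x) / (1 - cos \<epsilon>) \<in> {0..1}"
proof -
  have *: "sin x / sin \<epsilon> \<in> {0..1} \<and> (1 - cos x) / (1 - cos \<epsilon>) \<in> {0..1}"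
    if "0 \<le> x" "x \<le> \<epsilon>" "0 < \<epsilon>" "\<epsilon> < pi / 2" for x \<epsilon> :: real
  proof -
    have "0 < sin \<epsilon>" using that sin_gt_zero[of \<epsilon>] by simp
    moreover have "0 \<le> sin x" using that sin_ge_zero[of x] by simp
    moreover have "sin x \<le> sin \<epsilon>" using that by (intro sin_monotone_2pi_le) auto
    moreover have "cos \<epsilon> < 1" using that cos_monotone_0_pi[of 0 \<epsilon>] by simp
    moreover have "cos \<epsilon> \<le> cos x" using that by (intro cos_monotone_0_pi_le) auto
    ultimately show ?thesis by (simp add: divide_simps)
  qed
  have "sin x / sin \<epsilon> \<in> {0..1} \<and> (1 - cos x) / (1 - cos \<epsilon>) \<in> {0..1}"
  proof (cases "\<epsilon> > 0")
    case True
    then show ?thesis using assms by (intro *) (auto simp: divide_simps)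
  next
    case False
    then show ?thesis using assms *[of "-x" "-\<epsilon>"] by (auto simp: divide_simps split: if_splits)
  qed
  then show "sin x / sin \<epsilon> \<in> {0..1}" "(1 - cos x) / (1 - cos \<epsilon>) \<in> {0..1}" by auto
qed

text \<open>
  Two arcs of equal duration with opposite turning rates \<open>\<kappa>\<close> and \<open>-\<kappa>\<close> lead back to the original
  heading. Turning by \<open>\<epsilon>\<close> and back moves the vehicle in the direction \<open>\<epsilon> / 2\<close>, which determines
  \<open>\<epsilon> = 2 * arctan (m / n)\<close>. The time is
  \<open>(n\<^sup>2 + m\<^sup>2) / (n * v)\<close> times \<open>arctan (m / n) / (m / n)\<close>, which is at most \<open>1\<close>. As the heading
  deviates by less than a right angle, the curve stays in the rectangle spanned by the
  displacement, so that it is enough to know that the corners belong to the convex set \<open>U\<close>.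
\<close>

lemma lateral_shift:
  assumes "v > 0" "convex U" "n > 0" "\<bar>m\<bar> < n" "4 * v * \<bar>m\<bar> / n\<^sup>2 \<le> w"
    and corners: "A \<in> U" "A + n *\<^sub>R heading \<theta> \<in> U" "A + m *\<^sub>R rightward \<theta> \<in> U"
      "A + n *\<^sub>R heading \<theta> + m *\<^sub>R rightward \<theta> \<in> U"
  shows "\<exists>\<tau>\<le>(n\<^sup>2 + m\<^sup>2) / (n * v). travels v w U A \<theta> (A + n *\<^sub>R heading \<theta> + m *\<^sub>R rightward \<theta>) \<theta> \<tau>"
proof (cases "m = 0")
  case True
  have "A + (p * n) *\<^sub>R heading \<theta> \<in> U" if "p \<in> {0..1}" for p
    using parallelogram_in_convex[OF assms(2) corners that, of 0] by simp
  from this[of "v * s / n" for s]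
  have "A + v *\<^sub>R turn \<theta> 0 s \<in> U" if "s \<in> {0<..<n / v}" for s
    using that \<open>v > 0\<close> \<open>n > 0\<close> by (auto simp: turn_straight divide_simps mult.commute)
  then have "travels v w U A \<theta> (A + v *\<^sub>R turn \<theta> 0 (n / v)) (\<theta> + 0 * (n / v)) (n / v)"
    using assms True by (intro travels_turn) auto
  then show ?thesis using True \<open>v > 0\<close> \<open>n > 0\<close>
    by (intro exI[of _ "n / v"]) (auto simp: turn_straight power2_eq_square)
next
  case False
  define t where "t = m / n"
  define \<epsilon> where "\<epsilon> = 2 * arctan t"
  have t: "t \<noteq> 0" "\<bar>t\<bar> < 1" using False assms by (auto simp: t_def)
  have sin: "sin \<epsilon> = 2 * t / (1 + t\<^sup>2)" and cos: "1 - cos \<epsilon> = 2 * t\<^sup>2 / (1 + t\<^sup>2)"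
  proof -
    have q: "(sqrt (1 + t\<^sup>2))\<^sup>2 = 1 + t\<^sup>2" "sqrt (1 + t\<^sup>2) \<noteq> 0" "1 + t\<^sup>2 \<noteq> 0"
      by (simp_all add: add_nonneg_eq_0_iff)
    show "sin \<epsilon> = 2 * t / (1 + t\<^sup>2)"
      using q by (simp add: \<epsilon>_def sin_double sin_arctan cos_arctan power2_eq_square)
    show "1 - cos \<epsilon> = 2 * t\<^sup>2 / (1 + t\<^sup>2)"
      using q by (simp add: \<epsilon>_def cos_double_sin sin_arctan power_divide)
  qed
  have eps: "\<bar>\<epsilon>\<bar> < pi / 2" "\<epsilon> \<noteq> 0"
    using t arctan_less_iff[of t 1] arctan_less_iff[of "-1" t] by (auto simp: \<epsilon>_def arctan_one arctan_minus abs_less_iff)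
  define \<kappa> where "\<kappa> = 2 * v * sin \<epsilon> / n"
  define h where "h = \<epsilon> / \<kappa>"
  have k: "\<kappa> \<noteq> 0" "\<kappa> * h = \<epsilon>" using t \<open>v > 0\<close> \<open>n > 0\<close> by (auto simp: \<kappa>_def h_def sin add_nonneg_eq_0_iff)
  have tt: "1 + t\<^sup>2 > 0" by (simp add: add_pos_nonneg)
  have n: "2 * v * sin \<epsilon> / \<kappa> = n" using t \<open>v > 0\<close> \<open>n > 0\<close> tt by (auto simp: \<kappa>_def sin)
  have "2 * v * (1 - cos \<epsilon>) / \<kappa> = t * (2 * v * sin \<epsilon> / \<kappa>)"
    by (simp add: sin cos power2_eq_square)
  then have m: "2 * v * (1 - cos \<epsilon>) / \<kappa> = m" using n \<open>n > 0\<close> by (simp add: t_def)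
  have h: "h = (n * (1 + t\<^sup>2) / (2 * v)) * (arctan t / t)"
  proof -
    have "h = \<epsilon> * n / (2 * v * (2 * t / (1 + t\<^sup>2)))" by (simp add: h_def \<kappa>_def sin)
    then show ?thesis using t tt by (simp add: \<epsilon>_def mult.commute mult.left_commute)
  qed
  have at: "arctan t / t > 0" "arctan t / t \<le> 1"
  proof -
    show "arctan t / t > 0" using t by (auto simp: zero_less_divide_iff)
    show "arctan t / t \<le> 1" 
      using t arctan_le_self[of t] arctan_le_self[of "-t"] by (cases "t > 0") (auto simp: divide_simps arctan_minus linorder_neq_iff)
  qed
  have "h > 0" unfolding h using at tt \<open>v > 0\<close> \<open>n > 0\<close> by (intro mult_pos_pos) auto
  have "h \<le> n * (1 + t\<^sup>2) / (2 * v)"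
    unfolding h using at tt \<open>v > 0\<close> \<open>n > 0\<close> by (intro mult_left_le) auto
  moreover have "(n\<^sup>2 + m\<^sup>2) / (n * v) = 2 * (n * (1 + t\<^sup>2) / (2 * v))"
    using \<open>v > 0\<close> \<open>n > 0\<close> by (simp add: t_def field_simps power2_eq_square)
  ultimately have time: "h + h \<le> (n\<^sup>2 + m\<^sup>2) / (n * v)" by linarith
  have "\<bar>\<kappa>\<bar> = 4 * v * \<bar>m\<bar> / n\<^sup>2 / (1 + t\<^sup>2)"
    using \<open>v > 0\<close> \<open>n > 0\<close> tt by (simp add: \<kappa>_def sin abs_mult t_def power2_eq_square ac_simps)
  also have "\<dots> \<le> 4 * v * \<bar>m\<bar> / n\<^sup>2"
  proof -
    have "x / (1 + t\<^sup>2) \<le> x / 1" if "x \<ge> 0" for x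
      using that by (intro divide_left_mono) (auto intro: add_pos_nonneg)
    from this[of "4 * v * \<bar>m\<bar> / n\<^sup>2"] show ?thesis using \<open>v > 0\<close> by simp
  qed
  finally have kw: "\<bar>\<kappa>\<bar> \<le> w" using assms by linarith
  let ?C = "A + v *\<^sub>R turn \<theta> \<kappa> h"
  have inU: "A + (p * n) *\<^sub>R heading \<theta> + (q * m) *\<^sub>R rightward \<theta> \<in> U" if "p \<in> {0..1}" "q \<in> {0..1}" for p q
    using parallelogram_in_convex[OF assms(2) corners(1,2,3,4) that] by simp
  have arc1: "A + v *\<^sub>R turn \<theta> \<kappa> s = A + ((sin (\<kappa> * s) / sin \<epsilon> / 2) * n) *\<^sub>R heading \<theta>
      + (((1 - cos (\<kappa> * s)) / (1 - cos \<epsilon>) / 2) * m) *\<^sub>R rightward \<theta>" for s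
  proof -
    have "(sin (\<kappa> * s) / sin \<epsilon> / 2) * n = v * (sin (\<kappa> * s) / \<kappa>)"
      unfolding n[symmetric] using t tt by (simp add: sin)
    moreover have "((1 - cos (\<kappa> * s)) / (1 - cos \<epsilon>) / 2) * m = v * ((1 - cos (\<kappa> * s)) / \<kappa>)"
      unfolding m[symmetric] using t tt by (simp add: cos)
    ultimately show ?thesis by (simp add: turn_frame[OF k(1)] algebra_simps)
  qed
  \<comment> \<open>The second arc is the image of the first one under the point reflection at the middle \<open>?C\<close>.\<close>
  have arc2: "?C + v *\<^sub>R turn (\<theta> + \<epsilon>) (- \<kappa>) s
      = A + n *\<^sub>R heading \<theta> + m *\<^sub>R rightward \<theta> - v *\<^sub>R turn \<theta> \<kappa> (h - s)" for s
  proof -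
    have "v *\<^sub>R turn \<theta> \<kappa> h = (n / 2) *\<^sub>R heading \<theta> + (m / 2) *\<^sub>R rightward \<theta>"
      using arc1[of h] eps t tt by (simp add: k sin cos)
    moreover have "turn (\<theta> + \<epsilon>) (- \<kappa>) s + turn \<theta> \<kappa> (h - s) = turn \<theta> \<kappa> h"
    proof -
      have "\<theta> + \<kappa> * (h - s) = \<theta> + \<epsilon> - \<kappa> * s"
        using k(2) by (simp add: right_diff_distrib)
      then show ?thesis using k by (simp add: turn_def add_diff_eq flip: scaleR_right_distrib scaleR_right_diff_distrib)
    qed
    then have "v *\<^sub>R turn (\<theta> + \<epsilon>) (- \<kappa>) s = v *\<^sub>R turn \<theta> \<kappa> h - v *\<^sub>R turn \<theta> \<kappa> (h - s)"
      by (simp flip: scaleR_diff_right add: eq_diff_eq)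
    moreover have "n *\<^sub>R heading \<theta> = (n / 2) *\<^sub>R heading \<theta> + (n / 2) *\<^sub>R heading \<theta>"
      "m *\<^sub>R rightward \<theta> = (m / 2) *\<^sub>R rightward \<theta> + (m / 2) *\<^sub>R rightward \<theta>"
      by (simp_all flip: scaleR_left_distrib)
    ultimately show ?thesis by (simp add: algebra_simps)
  qed
  have ratio: "sin (\<kappa> * s) / sin \<epsilon> \<in> {0..1}" "(1 - cos (\<kappa> * s)) / (1 - cos \<epsilon>) \<in> {0..1}"
    if "s \<in> {0..h}" for s
  proof -
    have "\<kappa> * s / \<epsilon> = s / h" using k \<open>h > 0\<close> eps by (simp add: h_def)
    then have "\<kappa> * s / \<epsilon> \<in> {0..1}" using that \<open>h > 0\<close> by simp
    from sin_cos_ratios[OF eps this] show "sin (\<kappa> * s) / sin \<epsilon> \<in> {0..1}" "(1 - cos (\<kappa> * s)) / (1 - cos \<epsilon>) \<in> {0..1}" .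
  qed
  have half: "r / 2 \<in> {0..1}" "1 - r / 2 \<in> {0..1}" if "r \<in> {0..1}" for r :: real
    using that by auto
  have U1: "A + v *\<^sub>R turn \<theta> \<kappa> s \<in> U" if "s \<in> {0..h}" for s
    unfolding arc1 by (intro inU half ratio that)
  have U2: "?C + v *\<^sub>R turn (\<theta> + \<epsilon>) (- \<kappa>) s \<in> U" if "s \<in> {0..h}" for s
  proof -
    let ?p = "sin (\<kappa> * (h - s)) / sin \<epsilon> / 2" and ?q = "(1 - cos (\<kappa> * (h - s))) / (1 - cos \<epsilon>) / 2"
    have "?C + v *\<^sub>R turn (\<theta> + \<epsilon>) (- \<kappa>) s
        = A + ((1 - ?p) * n) *\<^sub>R heading \<theta> + ((1 - ?q) * m) *\<^sub>R rightward \<theta>"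
      using arc1[of "h - s"] unfolding arc2 by (simp add: left_diff_distrib scaleR_left_diff_distrib)
    also have "\<dots> \<in> U" using that by (intro inU half ratio) auto
    finally show ?thesis .
  qed
  have "travels v w U A \<theta> ?C (\<theta> + \<kappa> * h) h"
    using U1 kw \<open>h > 0\<close> by (intro travels_turn) auto
  moreover have "travels v w U ?C (\<theta> + \<epsilon>) (?C + v *\<^sub>R turn (\<theta> + \<epsilon>) (- \<kappa>) h) (\<theta> + \<epsilon> + - \<kappa> * h) h"
    using U2 kw \<open>h > 0\<close> by (intro travels_turn) auto
  ultimately have "travels v w U A \<theta> (A + n *\<^sub>R heading \<theta> + m *\<^sub>R rightward \<theta>) \<theta> (h + h)"
    using U1[of h] \<open>h > 0\<close> k(2) arc2[of h] travels_trans[of v w U A \<theta> ?C "\<theta> + \<epsilon>" h _ \<theta> h] by simp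
  then show ?thesis using time by blast
qed

lemma isCont_tendsto_nhds: "isCont f x \<Longrightarrow> (f \<longlongrightarrow> f x) (nhds x)"
  by (simp add: isCont_def tendsto_at_iff_tendsto_nhds)

section \<open>Variation of the approach to a crossing\<close>

text \<open>
  The vehicle follows a line of length \<open>L\<close> and then turns at the rate \<open>\<kappa>\<close> for the time \<open>W\<close>, reaching
  the boundary line through \<open>z\<close> with normal \<open>\<nu>\<close>. In the variation the turn lasts \<open>W + k * h\<close> and ends
  at \<open>z + (c * h) * t\<close>. As the turn starts with the heading of the line in any case, it is the old arc
  translated by \<open>B' h - B\<close> and prolonged, and its starting point \<open>B' h\<close> is reached by an S-curve.
  Far from its end the new arc is close to a compact piece of the old one inside \<open>U\<close>; near the end
  transversality keeps it on the right side of the boundary line.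
\<close>

lemma approach_variation:
  assumes "v > 0" "w > 0" "\<bar>\<kappa>\<bar> \<le> w" "L > 0" "W > 0" "open U" "convex U" "A \<in> U"
    and z: "z = A + L *\<^sub>R heading \<alpha> + v *\<^sub>R turn \<alpha> \<kappa> W"
    and arc: "\<And>s. s \<in> {0..<W} \<Longrightarrow> A + L *\<^sub>R heading \<alpha> + v *\<^sub>R turn \<alpha> \<kappa> s \<in> U"
    and "\<rho> > 0" and half_disc: "\<And>y. y \<in> ball z \<rho> \<Longrightarrow> (y - z) \<bullet> \<nu> < 0 \<Longrightarrow> y \<in> U"
    and "t \<bullet> \<nu> = 0" and transversal: "heading (\<alpha> + \<kappa> * W) \<bullet> \<nu> > 0"
  shows "\<exists>f. f 0 = L / v + W \<and>
    (f has_real_derivative c * (t \<bullet> heading \<alpha>) / v + k * (1 - cos (\<kappa> * W))) (at 0) \<and>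
    (\<forall>\<^sub>F h in nhds 0. \<exists>\<tau>\<le>f h.
       travels v w U A \<alpha> (z + (c * h) *\<^sub>R t) (\<alpha> + \<kappa> * (W + k * h)) \<tau>)"
proof -
  define B where "B = A + L *\<^sub>R heading \<alpha>"
  define B' where "B' h = z + (c * h) *\<^sub>R t - v *\<^sub>R turn \<alpha> \<kappa> (W + k * h)" for h
  define n where "n h = (B' h - A) \<bullet> heading \<alpha>" for h
  define m where "m h = (B' h - A) \<bullet> rightward \<alpha>" for h
  \<comment> \<open>The bound of \<open>lateral_shift\<close> plus the duration of the turn; its derivative at \<open>0\<close> does not
    involve \<open>m\<close>, as \<open>m\<close> enters quadratically and vanishes at \<open>0\<close>.\<close>
  define f where "f h = ((n h)\<^sup>2 + (m h)\<^sup>2) / (n h * v) + (W + k * h)" for h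
  have B'0: "B' 0 = B" by (simp add: B'_def B_def z)
  have n0: "n 0 = L" and m0: "m 0 = 0"
    by (simp_all add: n_def m_def B'0 B_def inner_heading inner_heading_rightward)
  have dB': "(B' has_vector_derivative c *\<^sub>R t - (v * k) *\<^sub>R heading (\<alpha> + \<kappa> * W)) (at 0)"
  proof -
    have "((\<lambda>h. W + k * h) has_vector_derivative k) (at 0)"
      by (auto intro!: derivative_eq_intros)
    then have "((\<lambda>h. turn \<alpha> \<kappa> (W + k * h)) has_vector_derivative k *\<^sub>R heading (\<alpha> + \<kappa> * W)) (at 0)"
      using vector_diff_chain_at[of "\<lambda>h. W + k * h" k 0 "turn \<alpha> \<kappa>" "heading (\<alpha> + \<kappa> * W)"]
        has_vector_derivative_turn[of \<alpha> \<kappa> W] by (simp add: o_def)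
    from bounded_linear.has_vector_derivative[OF bounded_linear_scaleR_right this, of v]
    have "((\<lambda>h. v *\<^sub>R turn \<alpha> \<kappa> (W + k * h)) has_vector_derivative (v * k) *\<^sub>R heading (\<alpha> + \<kappa> * W)) (at 0)"
      by simp
    moreover have "((\<lambda>h. z + (c * h) *\<^sub>R t) has_vector_derivative c *\<^sub>R t) (at 0)"
      by (auto intro!: derivative_eq_intros)
    ultimately show ?thesis unfolding B'_def[abs_def] by (rule has_vector_derivative_diff[rotated])
  qed
  have dn: "(n has_real_derivative c * (t \<bullet> heading \<alpha>) - v * k * cos (\<kappa> * W)) (at 0)"
    and dm: "(m has_real_derivative c * (t \<bullet> rightward \<alpha>) - v * k * sin (\<kappa> * W)) (at 0)"
  proof -
    have d: "((\<lambda>h. (B' h - A) \<bullet> y) has_real_derivative (c *\<^sub>R t - (v * k) *\<^sub>R heading (\<alpha> + \<kappa> * W)) \<bullet> y) (at 0)" for y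
      unfolding has_real_derivative_iff_has_vector_derivative
      by (intro bounded_linear.has_vector_derivative[OF bounded_linear_inner_left]
          has_vector_derivative_diff[OF dB' has_vector_derivative_const, simplified])
    show "(n has_real_derivative c * (t \<bullet> heading \<alpha>) - v * k * cos (\<kappa> * W)) (at 0)"
      using d[of "heading \<alpha>"] by (simp add: n_def[abs_def] inner_diff_left inner_heading)
    show "(m has_real_derivative c * (t \<bullet> rightward \<alpha>) - v * k * sin (\<kappa> * W)) (at 0)"
      using d[of "rightward \<alpha>"] by (simp add: m_def[abs_def] inner_diff_left inner_heading_rightward)
  qed
  have "(f has_real_derivative (c * (t \<bullet> heading \<alpha>) - v * k * cos (\<kappa> * W)) / v + k) (at 0)"
  proof -
    define n' where "n' = c * (t \<bullet> heading \<alpha>) - v * k * cos (\<kappa> * W)"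
    have dn': "(n has_real_derivative n') (at 0)" using dn by (simp add: n'_def)
    have num: "((\<lambda>h. (n h)\<^sup>2 + (m h)\<^sup>2) has_real_derivative 2 * L * n') (at 0)"
      using DERIV_add[OF DERIV_power[OF dn', of 2] DERIV_power[OF dm, of 2]] by (simp add: n0 m0 ac_simps)
    have den: "((\<lambda>h. n h * v) has_real_derivative n' * v) (at 0)"
      by (rule DERIV_cmult_right[OF dn'])
    have "n 0 * v \<noteq> 0" using \<open>L > 0\<close> \<open>v > 0\<close> by (simp add: n0)
    note quot = DERIV_divide[OF num den this]
    have "(2 * L * n' * (n 0 * v) - ((n 0)\<^sup>2 + (m 0)\<^sup>2) * (n' * v)) / (n 0 * v * (n 0 * v)) = n' / v"
      using \<open>L > 0\<close> \<open>v > 0\<close> by (simp add: n0 m0 power2_eq_square field_simps)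
    note quot = DERIV_cong[OF quot this]
    have "((\<lambda>h. W + k * h) has_real_derivative k) (at 0)"
      by (auto intro!: derivative_eq_intros)
    note DERIV_add[OF quot this]
    then show ?thesis unfolding f_def[abs_def] n'_def[symmetric] .
  qed
  then have df: "(f has_real_derivative c * (t \<bullet> heading \<alpha>) / v + k * (1 - cos (\<kappa> * W))) (at 0)"
    using \<open>v > 0\<close> by (simp add: diff_divide_distrib algebra_simps)
  have f0: "f 0 = L / v + W"
    using \<open>L > 0\<close> by (simp add: f_def n0 m0 power2_eq_square)
  have lim: "(B' \<longlongrightarrow> B) (nhds 0)" "(n \<longlongrightarrow> L) (nhds 0)" "(m \<longlongrightarrow> 0) (nhds 0)"
    using isCont_tendsto_nhds[OF has_vector_derivative_continuous[OF dB']]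
      isCont_tendsto_nhds[OF DERIV_isCont[OF dn]] isCont_tendsto_nhds[OF DERIV_isCont[OF dm]]
    by (simp_all add: B'0 n0 m0)
  have turn_cont: "(turn \<alpha> \<kappa> \<longlongrightarrow> turn \<alpha> \<kappa> W) (nhds W)"
    by (rule isCont_tendsto_nhds[OF has_vector_derivative_continuous[OF has_vector_derivative_turn]])
  obtain \<delta> where "\<delta> > 0" "\<delta> < W" and \<delta>: "\<And>s. \<bar>s - W\<bar> \<le> \<delta> \<Longrightarrow>
      heading (\<alpha> + \<kappa> * s) \<bullet> \<nu> > 0 \<and> norm (v *\<^sub>R (turn \<alpha> \<kappa> s - turn \<alpha> \<kappa> W)) < \<rho> / 2"
  proof -
    have "((\<lambda>s. heading (\<alpha> + \<kappa> * s) \<bullet> \<nu>) \<longlongrightarrow> heading (\<alpha> + \<kappa> * W) \<bullet> \<nu>) (nhds W)"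
      unfolding heading_def by (intro tendsto_intros filterlim_ident)
    then have "\<forall>\<^sub>F s in nhds W. heading (\<alpha> + \<kappa> * s) \<bullet> \<nu> > 0"
      using transversal by (rule order_tendstoD)
    moreover have "((\<lambda>s. norm (v *\<^sub>R (turn \<alpha> \<kappa> s - turn \<alpha> \<kappa> W))) \<longlongrightarrow> norm (v *\<^sub>R (turn \<alpha> \<kappa> W - turn \<alpha> \<kappa> W))) (nhds W)"
      by (intro tendsto_intros turn_cont)
    then have "\<forall>\<^sub>F s in nhds W. norm (v *\<^sub>R (turn \<alpha> \<kappa> s - turn \<alpha> \<kappa> W)) < \<rho> / 2"
      using \<open>\<rho> > 0\<close> by (intro order_tendstoD(2)) auto
    ultimately have "\<forall>\<^sub>F s in nhds W. heading (\<alpha> + \<kappa> * s) \<bullet> \<nu> > 0 \<and>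
        norm (v *\<^sub>R (turn \<alpha> \<kappa> s - turn \<alpha> \<kappa> W)) < \<rho> / 2"
      by eventually_elim auto
    then obtain d where "d > 0" "\<And>s. dist s W < d \<Longrightarrow> heading (\<alpha> + \<kappa> * s) \<bullet> \<nu> > 0 \<and>
        norm (v *\<^sub>R (turn \<alpha> \<kappa> s - turn \<alpha> \<kappa> W)) < \<rho> / 2"
      unfolding eventually_nhds_metric by blast
    then show thesis using \<open>W > 0\<close> by (intro that[of "min (d / 2) (W / 2)"]) (auto simp: dist_real_def)
  qed
  define K where "K = (\<lambda>s. B + v *\<^sub>R turn \<alpha> \<kappa> s) ` {0..W - \<delta>}"
  obtain \<eta> where "\<eta> > 0" and \<eta>: "{y. infdist y K \<le> \<eta>} \<subseteq> U"
  proof (rule compact_in_open_separated[of K U])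
    show "K \<noteq> {}" using \<open>\<delta> < W\<close> by (simp add: K_def)
    have "continuous_on {0..W - \<delta>} (turn \<alpha> \<kappa>)"
      using has_vector_derivative_continuous[OF has_vector_derivative_turn]
      by (blast intro: continuous_at_imp_continuous_on)
    then show "compact K" unfolding K_def by (intro compact_continuous_image continuous_intros) auto
    show "K \<subseteq> U" using arc \<open>\<delta> > 0\<close> by (auto simp: K_def B_def)
  qed (use \<open>open U\<close> in auto)
  have "B \<in> U" using arc[of 0] \<open>W > 0\<close> by (simp add: B_def)
  have "\<forall>\<^sub>F h in nhds 0. \<exists>\<tau>\<le>f h.
       travels v w U A \<alpha> (z + (c * h) *\<^sub>R t) (\<alpha> + \<kappa> * (W + k * h)) \<tau>"
  proof -
    have "((\<lambda>h. dist (B' h) B) \<longlongrightarrow> dist B B) (nhds 0)" by (intro tendsto_intros lim)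
    then have 1: "\<forall>\<^sub>F h in nhds 0. dist (B' h) B < min \<eta> (\<rho> / 2)"
      using \<open>\<eta> > 0\<close> \<open>\<rho> > 0\<close> by (intro order_tendstoD(2)) auto
    have "((\<lambda>h. \<bar>k * h\<bar>) \<longlongrightarrow> \<bar>k * 0\<bar>) (nhds 0)" by (intro tendsto_intros filterlim_ident)
    then have 2: "\<forall>\<^sub>F h in nhds 0. \<bar>k * h\<bar> < \<delta>" using \<open>\<delta> > 0\<close> by (intro order_tendstoD(2)) auto
    have 3: "\<forall>\<^sub>F h in nhds 0. n h > 0" by (rule order_tendstoD(1)[OF lim(2) \<open>L > 0\<close>])
    have "((\<lambda>h. n h - \<bar>m h\<bar>) \<longlongrightarrow> L - \<bar>0\<bar>) (nhds 0)" by (intro tendsto_intros lim)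
    then have 4: "\<forall>\<^sub>F h in nhds 0. n h - \<bar>m h\<bar> > 0" using \<open>L > 0\<close> by (intro order_tendstoD(1)) auto
    have "((\<lambda>h. 4 * v * \<bar>m h\<bar> / (n h)\<^sup>2) \<longlongrightarrow> 4 * v * \<bar>0\<bar> / L\<^sup>2) (nhds 0)"
      using \<open>L > 0\<close> by (intro tendsto_intros lim) auto
    then have 5: "\<forall>\<^sub>F h in nhds 0. 4 * v * \<bar>m h\<bar> / (n h)\<^sup>2 < w"
      using \<open>w > 0\<close> by (intro order_tendstoD(2)) auto
    have "((\<lambda>h. A + n h *\<^sub>R heading \<alpha>) \<longlongrightarrow> A + L *\<^sub>R heading \<alpha>) (nhds 0)"
      by (intro tendsto_intros lim)
    then have 6: "\<forall>\<^sub>F h in nhds 0. A + n h *\<^sub>R heading \<alpha> \<in> U"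
      using \<open>B \<in> U\<close> \<open>open U\<close> unfolding B_def by (auto dest: topological_tendstoD)
    have "((\<lambda>h. A + m h *\<^sub>R rightward \<alpha>) \<longlongrightarrow> A + 0 *\<^sub>R rightward \<alpha>) (nhds 0)"
      by (intro tendsto_intros lim)
    then have 7: "\<forall>\<^sub>F h in nhds 0. A + m h *\<^sub>R rightward \<alpha> \<in> U"
      using \<open>A \<in> U\<close> \<open>open U\<close> by (auto dest: topological_tendstoD)
    have 8: "\<forall>\<^sub>F h in nhds 0. B' h \<in> U"
      using lim(1) \<open>B \<in> U\<close> \<open>open U\<close> by (auto dest: topological_tendstoD)
    from 1 2 3 4 5 6 7 8 show ?thesis
    proof eventually_elim
      case (elim h)
      have expand: "A + n h *\<^sub>R heading \<alpha> + m h *\<^sub>R rightward \<alpha> = B' h"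
        using frame_expansion[of "B' h - A" \<alpha>, symmetric] unfolding n_def m_def
        by (metis add.assoc add_diff_cancel_left' diff_add_cancel add.commute)
      obtain \<tau> where \<tau>: "\<tau> \<le> ((n h)\<^sup>2 + (m h)\<^sup>2) / (n h * v)" "travels v w U A \<alpha> (B' h) \<alpha> \<tau>"
        using lateral_shift[of v U "n h" "m h" w A \<alpha>] elim assms(1,7,8) expand by fastforce
      have end_eq: "B' h + v *\<^sub>R turn \<alpha> \<kappa> (W + k * h) = z + (c * h) *\<^sub>R t"
        by (simp add: B'_def)
      have in_U: "B' h + v *\<^sub>R turn \<alpha> \<kappa> s \<in> U" if s: "s \<in> {0<..<W + k * h}" for s
      proof (cases "s \<le> W - \<delta>")
        case True
        have "infdist (B' h + v *\<^sub>R turn \<alpha> \<kappa> s) K \<le> dist (B' h + v *\<^sub>R turn \<alpha> \<kappa> s) (B + v *\<^sub>R turn \<alpha> \<kappa> s)"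
          using True s by (intro infdist_le) (auto simp: K_def)
        also have "\<dots> \<le> \<eta>" using elim by simp
        finally show ?thesis using \<eta> by auto
      next
        case False
        then have s': "\<bar>s - W\<bar> \<le> \<delta>" using s elim by auto
        let ?y = "\<lambda>s. (B' h + v *\<^sub>R turn \<alpha> \<kappa> s - z) \<bullet> \<nu>"
        have "B' h + v *\<^sub>R turn \<alpha> \<kappa> s - z = (B' h - B) + v *\<^sub>R (turn \<alpha> \<kappa> s - turn \<alpha> \<kappa> W)"
          by (simp add: z B_def algebra_simps)
        also have "norm \<dots> \<le> norm (B' h - B) + norm (v *\<^sub>R (turn \<alpha> \<kappa> s - turn \<alpha> \<kappa> W))"
          by (rule norm_triangle_ineq)
        also have "\<dots> < \<rho>" using elim \<delta>[OF s'] by (simp add: dist_norm)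
        finally have near: "B' h + v *\<^sub>R turn \<alpha> \<kappa> s \<in> ball z \<rho>" by (simp add: dist_norm norm_minus_commute)
        have "?y s < ?y (W + k * h)"
        proof (rule DERIV_pos_imp_increasing[of s "W + k * h" ?y])
          show "s < W + k * h" using s by simp
          fix r assume r: "s \<le> r" "r \<le> W + k * h"
          have "((\<lambda>s. B' h + v *\<^sub>R turn \<alpha> \<kappa> s - z) has_vector_derivative v *\<^sub>R heading (\<alpha> + \<kappa> * r)) (at r)"
            by (rule derivative_eq_intros bounded_linear.has_vector_derivative[OF bounded_linear_scaleR_right]
                has_vector_derivative_turn | simp)+
          then have "(?y has_real_derivative v *\<^sub>R heading (\<alpha> + \<kappa> * r) \<bullet> \<nu>) (at r)"
            unfolding has_real_derivative_iff_has_vector_derivative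
            by (rule bounded_linear.has_vector_derivative[OF bounded_linear_inner_left])
          moreover have "heading (\<alpha> + \<kappa> * r) \<bullet> \<nu> > 0" using \<delta>[of r] r s' elim False by auto
          ultimately show "\<exists>y. (?y has_real_derivative y) (at r) \<and> 0 < y"
            using \<open>v > 0\<close> by auto
        qed
        also have "?y (W + k * h) = 0" by (simp add: end_eq \<open>t \<bullet> \<nu> = 0\<close>)
        finally show ?thesis using near half_disc by blast
      qed
      have "travels v w U (B' h) \<alpha> (B' h + v *\<^sub>R turn \<alpha> \<kappa> (W + k * h)) (\<alpha> + \<kappa> * (W + k * h)) (W + k * h)"
        using in_U assms(3) elim \<open>\<delta> < W\<close> by (intro travels_turn) auto
      then have "travels v w U A \<alpha> (z + (c * h) *\<^sub>R t) (\<alpha> + \<kappa> * (W + k * h)) (\<tau> + (W + k * h))"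
        unfolding end_eq using travels_trans[OF \<tau>(2)] elim by blast
      then show ?case using \<tau>(1) unfolding f_def by (intro exI[of _ "\<tau> + (W + k * h)"]) auto
    qed
  qed
  then show ?thesis using f0 df by blast
qed

section \<open>Motion along lines and circles\<close>

lemma zero_derivative_imp_constant:
  fixes f :: "real \<Rightarrow> 'a::banach"
  assumes "continuous_on {a..b} f" "finite S"
    and "\<And>s. s \<in> {a<..<b} - S \<Longrightarrow> (f has_vector_derivative 0) (at s)" "s \<in> {a..b}"
  shows "f s = f a"
proof (rule has_derivative_zero_unique_strong_interval[of "insert a (insert b S)" a b f])
  fix r assume "r \<in> {a..b} - insert a (insert b S)"
  then have "(f has_vector_derivative 0) (at r)" by (intro assms(3)) auto
  then show "(f has_derivative (\<lambda>h. 0)) (at r within {a..b})"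
    unfolding has_vector_derivative_def by (auto intro: has_derivative_at_withinI)
qed (use assms in auto)

text \<open>
  The heading is orthogonal to the normal \<open>n\<close> of the line; differentiating this relation once more
  shows that the turning rate vanishes.
\<close>

lemma steers_along_line:
  assumes st: "steers v w P \<theta> u a b" and "v > 0" "a < b" "n \<noteq> 0"
    and line: "\<And>s. s \<in> {a..b} \<Longrightarrow> (P s - P a) \<bullet> n = 0" and s: "s \<in> {a..b}"
  shows "\<theta> s = \<theta> a" "P s = P a + (v * (s - a)) *\<^sub>R heading (\<theta> a)"
proof -
  obtain S where "finite S" and S: "\<And>s. s \<in> {a<..<b} - S \<Longrightarrow>
        (P has_vector_derivative v *\<^sub>R heading (\<theta> s)) (at s) \<and> (\<theta> has_real_derivative u s) (at s)"
    using st unfolding steers_def by blast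
  have c: "continuous_on {a..b} P" "continuous_on {a..b} \<theta>" using st by (auto simp: steers_def)
  have op: "open ({a<..<b} - S)" using \<open>finite S\<close> by (simp add: open_Diff finite_imp_closed)
  have orth: "heading (\<theta> s) \<bullet> n = 0" if "s \<in> {a<..<b} - S" for s
  proof -
    have "((\<lambda>r. (P r - P a) \<bullet> n) has_vector_derivative (v *\<^sub>R heading (\<theta> s) - 0) \<bullet> n) (at s)"
      using S[OF that] by (intro bounded_linear.has_vector_derivative[OF bounded_linear_inner_left]
          has_vector_derivative_diff has_vector_derivative_const) auto
    moreover have "((\<lambda>r. (P r - P a) \<bullet> n) has_vector_derivative 0) (at s)"
      by (rule has_vector_derivative_transform_within_open[OF has_vector_derivative_const op that])
        (use line in auto)
    ultimately have "(v *\<^sub>R heading (\<theta> s) - 0) \<bullet> n = 0" by (rule vector_derivative_unique_at)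
    then show ?thesis using \<open>v > 0\<close> by simp
  qed
  have "u s = 0" if "s \<in> {a<..<b} - S" for s
  proof -
    have "((\<lambda>r. heading (\<theta> r) \<bullet> n) has_vector_derivative (u s *\<^sub>R rightward (\<theta> s)) \<bullet> n) (at s)"
      using S[OF that] by (intro bounded_linear.has_vector_derivative[OF bounded_linear_inner_left]
          has_vector_derivative_heading) auto
    moreover have "((\<lambda>r. heading (\<theta> r) \<bullet> n) has_vector_derivative 0) (at s)"
      by (rule has_vector_derivative_transform_within_open[OF has_vector_derivative_const op that])
        (use orth in auto)
    ultimately have "(u s *\<^sub>R rightward (\<theta> s)) \<bullet> n = 0" by (rule vector_derivative_unique_at)
    moreover have "rightward (\<theta> s) \<bullet> n \<noteq> 0"
      using frame_expansion[of n "\<theta> s"] orth[OF that] \<open>n \<noteq> 0\<close>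
      by (metis add.right_neutral inner_commute scaleR_zero_left)
    ultimately show ?thesis by simp
  qed
  then have th: "\<theta> s = \<theta> a" if "s \<in> {a..b}" for s
    using S that by (intro zero_derivative_imp_constant[OF c(2) \<open>finite S\<close>])
      (auto simp flip: has_real_derivative_iff_has_vector_derivative)
  show "\<theta> s = \<theta> a" by (rule th[OF s])
  have "(\<lambda>s. P s - (v * (s - a)) *\<^sub>R heading (\<theta> a)) s = (\<lambda>s. P s - (v * (s - a)) *\<^sub>R heading (\<theta> a)) a"
  proof (rule zero_derivative_imp_constant[OF _ \<open>finite S\<close> _ s])
    show "continuous_on {a..b} (\<lambda>s. P s - (v * (s - a)) *\<^sub>R heading (\<theta> a))"
      by (intro continuous_intros c)
    fix r assume r: "r \<in> {a<..<b} - S"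
    then have "(P has_vector_derivative v *\<^sub>R heading (\<theta> a)) (at r)"
      using S[OF r] th[of r] by auto
    moreover have "((\<lambda>s. (v * (s - a)) *\<^sub>R heading (\<theta> a)) has_vector_derivative v *\<^sub>R heading (\<theta> a)) (at r)"
      by (auto intro!: derivative_eq_intros)
    ultimately show "((\<lambda>s. P s - (v * (s - a)) *\<^sub>R heading (\<theta> a)) has_vector_derivative 0) (at r)"
      using has_vector_derivative_diff by fastforce
  qed
  then show "P s = P a + (v * (s - a)) *\<^sub>R heading (\<theta> a)" by (simp add: algebra_simps)
qed

lemma steers_along_segment:
  assumes "steers v w P \<theta> u a b" and "v > 0" "a < b"
    and seg: "P ` {a..b} = closed_segment (P a) (P b)" and "s \<in> {a..b}"
  shows "\<theta> s = \<theta> a" "P s = P a + (v * (s - a)) *\<^sub>R heading (\<theta> a)"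
proof -
  define d where "d = P b - P a"
  obtain n :: "real \<times> real" where n: "n \<noteq> 0" "d \<bullet> n = 0"
  proof (cases "d = 0")
    case False
    then show thesis by (intro that[of "(- snd d, fst d)"]) (auto simp: inner_prod_def prod_eq_iff zero_prod_def)
  next
    case True
    then show thesis by (intro that[of "(1, 0)"]) (auto simp: zero_prod_def)
  qed
  have "(P s - P a) \<bullet> n = 0" if "s \<in> {a..b}" for s
  proof -
    have "P s \<in> closed_segment (P a) (P b)" using seg that by blast
    then obtain l where "P s = (1 - l) *\<^sub>R P a + l *\<^sub>R P b" unfolding closed_segment_def by blast
    then have "P s - P a = l *\<^sub>R d" by (simp add: d_def algebra_simps)
    then show ?thesis using n by simp
  qed
  then show "\<theta> s = \<theta> a" "P s = P a + (v * (s - a)) *\<^sub>R heading (\<theta> a)"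
    using steers_along_line[OF assms(1-3) n(1)] assms(5) by blast+
qed

text \<open>
  The derivative of the center is \<open>(v - \<sigma> * r * u)\<close> times the heading, so the turning rate \<open>u\<close> is
  determined by the fact that the center does not move.
\<close>

lemma steers_along_circle:
  assumes st: "steers v w P \<theta> u a b" and "v > 0" "r > 0" "\<sigma> = 1 \<or> \<sigma> = -1"
    and center: "\<And>s. s \<in> {a..b} \<Longrightarrow> P s + (\<sigma> * r) *\<^sub>R rightward (\<theta> s) = c" and s: "s \<in> {a..b}"
  shows "\<theta> s = \<theta> a + \<sigma> * v / r * (s - a)" "P s = P a + v *\<^sub>R turn (\<theta> a) (\<sigma> * v / r) (s - a)"
proof -
  obtain S where "finite S" and S: "\<And>s. s \<in> {a<..<b} - S \<Longrightarrow>
        (P has_vector_derivative v *\<^sub>R heading (\<theta> s)) (at s) \<and> (\<theta> has_real_derivative u s) (at s)"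
    using st unfolding steers_def by blast
  have c: "continuous_on {a..b} \<theta>" using st by (auto simp: steers_def)
  have u: "u s = \<sigma> * v / r" if "s \<in> {a<..<b} - S" for s
  proof -
    have "((\<lambda>s. P s + (\<sigma> * r) *\<^sub>R rightward (\<theta> s)) has_vector_derivative
        v *\<^sub>R heading (\<theta> s) + (\<sigma> * r) *\<^sub>R (- u s *\<^sub>R heading (\<theta> s))) (at s)"
      using S[OF that] by (intro has_vector_derivative_add has_vector_derivative_rightward
          bounded_linear.has_vector_derivative[OF bounded_linear_scaleR_right]) auto
    moreover have "((\<lambda>s. P s + (\<sigma> * r) *\<^sub>R rightward (\<theta> s)) has_vector_derivative 0) (at s)"
      by (rule has_vector_derivative_transform_within_open[OF has_vector_derivative_const open_greaterThanLessThan[of a b]])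
        (use that in \<open>auto intro!: center[symmetric]\<close>)
    ultimately have "v *\<^sub>R heading (\<theta> s) + (\<sigma> * r) *\<^sub>R (- u s *\<^sub>R heading (\<theta> s)) = 0"
      by (rule vector_derivative_unique_at)
    then have "(v - \<sigma> * r * u s) *\<^sub>R heading (\<theta> s) = 0" by (simp add: algebra_simps)
    then have "v - \<sigma> * r * u s = 0" using norm_heading[of "\<theta> s"] by (metis norm_zero scaleR_eq_0_iff zero_neq_one)
    then show ?thesis using assms(3,4) by (auto simp: field_simps)
  qed
  have "(\<lambda>s. \<theta> s - \<sigma> * v / r * (s - a)) s = (\<lambda>s. \<theta> s - \<sigma> * v / r * (s - a)) a"
  proof (rule zero_derivative_imp_constant[OF _ \<open>finite S\<close> _ s])
    show "continuous_on {a..b} (\<lambda>s. \<theta> s - \<sigma> * v / r * (s - a))" by (intro continuous_intros c)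
    fix q assume q: "q \<in> {a<..<b} - S"
    have "((\<lambda>s. \<sigma> * v / r * (s - a)) has_real_derivative u q) (at q)"
      unfolding u[OF q] using \<open>r > 0\<close> by (auto intro!: derivative_eq_intros)
    then show "((\<lambda>s. \<theta> s - \<sigma> * v / r * (s - a)) has_vector_derivative 0) (at q)"
      using S[OF q] DERIV_diff[of \<theta> "u q" q UNIV] by (fastforce simp flip: has_real_derivative_iff_has_vector_derivative)
  qed
  then show th: "\<theta> s = \<theta> a + \<sigma> * v / r * (s - a)" by simp
  have "P s - P a = (\<sigma> * r) *\<^sub>R (rightward (\<theta> a) - rightward (\<theta> s))"
    using center[OF s] center[of a] s by (simp add: algebra_simps)
  moreover have "v * (1 / (\<sigma> * v / r)) = \<sigma> * r" "\<sigma> * v / r \<noteq> 0" using assms(2-4) by (auto simp: divide_simps)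
  ultimately show "P s = P a + v *\<^sub>R turn (\<theta> a) (\<sigma> * v / r) (s - a)"
    using th by (simp add: turn_def algebra_simps)
qed

section \<open>Geometry of the boundary at a crossing\<close>

text \<open>
  The triangle spanned by the edge and an interior point \<open>q\<close> fills a half disc around \<open>z\<close>. A
  point \<open>y\<close> of it is \<open>(1 - l) * p + l * q\<close> with \<open>p\<close> on the edge, where \<open>l\<close> is the quotient of the
  distances of \<open>y\<close> and \<open>q\<close> from the edge; \<open>\<rho>\<close> is chosen so that \<open>l < 1 / 2\<close> and that \<open>p\<close> is within
  the edge.
\<close>

lemma half_disc_in_convex:
  fixes t \<nu> z :: "'a::euclidean_space"
  assumes frame: "\<And>y. y = (y \<bullet> t) *\<^sub>R t + (y \<bullet> \<nu>) *\<^sub>R \<nu>" and "norm t = 1" "norm \<nu> = 1"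
    and "convex K" "e > 0" and edge: "\<And>s. \<bar>s\<bar> < e \<Longrightarrow> z + s *\<^sub>R t \<in> K"
    and q: "q \<in> interior K" "(q - z) \<bullet> \<nu> < 0"
  shows "\<exists>\<rho>>0. \<forall>y\<in>ball z \<rho>. (y - z) \<bullet> \<nu> < 0 \<longrightarrow> y \<in> interior K"
proof -
  define x0 where "x0 = (q - z) \<bullet> t"
  define y0 where "y0 = - ((q - z) \<bullet> \<nu>)"
  have "y0 > 0" using q by (simp add: y0_def)
  define \<rho> where "\<rho> = min (y0 / 2) (e / (2 * (1 + \<bar>x0\<bar> / y0)))"
  have pos: "1 + \<bar>x0\<bar> / y0 > 0" using \<open>y0 > 0\<close> by (simp add: add_pos_nonneg)
  have "\<rho> > 0" using \<open>y0 > 0\<close> \<open>e > 0\<close> pos by (simp add: \<rho>_def)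
  moreover have "y \<in> interior K" if "y \<in> ball z \<rho>" "(y - z) \<bullet> \<nu> < 0" for y
  proof -
    define x where "x = (y - z) \<bullet> t"
    define l where "l = - ((y - z) \<bullet> \<nu>) / y0"
    define s where "s = (x - l * x0) / (1 - l)"
    have nb: "norm (y - z) < \<rho>" using that by (simp add: dist_norm norm_minus_commute)
    have "\<bar>x\<bar> < \<rho>" "\<bar>(y - z) \<bullet> \<nu>\<bar> < \<rho>"
      using Cauchy_Schwarz_ineq2[of "y - z" t] Cauchy_Schwarz_ineq2[of "y - z" \<nu>] nb assms(2,3)
      by (auto simp: x_def)
    then have l: "0 < l" "l < \<rho> / y0" 
    using that \<open>y0 > 0\<close> divide_strict_right_mono[of "- ((y - z) \<bullet> \<nu>)" \<rho> y0]
    by (auto simp: l_def intro: divide_neg_pos)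
    have "\<rho> \<le> y0 / 2" unfolding \<rho>_def by (rule min.cobounded1)
    then have "\<rho> / y0 \<le> 1 / 2" using \<open>y0 > 0\<close> by (simp add: divide_le_eq)
    then have l2: "l < 1 / 2" using l by linarith
    have "l * \<bar>x0\<bar> \<le> \<rho> * (\<bar>x0\<bar> / y0)" using mult_right_mono[OF less_imp_le[OF l(2)], of "\<bar>x0\<bar>"] by simp
    then have "\<bar>x - l * x0\<bar> < \<rho> * (1 + \<bar>x0\<bar> / y0)"
      using \<open>\<bar>x\<bar> < \<rho>\<close> abs_triangle_ineq4[of x "l * x0"] l by (simp add: abs_mult algebra_simps)
    also have "\<dots> \<le> e / 2"
    proof -
      have "\<rho> \<le> e / (2 * (1 + \<bar>x0\<bar> / y0))" unfolding \<rho>_def by (rule min.cobounded2)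
      moreover have "r * D \<le> e / 2" if "r \<le> e / (2 * D)" "D > 0" for r D
        using that by (simp add: pos_le_divide_eq algebra_simps)
      ultimately show ?thesis using pos by blast
    qed
    finally have "\<bar>x - l * x0\<bar> < e * (1 - l)" using l2 \<open>e > 0\<close> mult_strict_left_mono[of "1/2" "1 - l" e] by linarith
    then have "\<bar>s\<bar> < e" using l2 by (simp add: s_def divide_less_eq)
    define p where "p = z + s *\<^sub>R t"
    have "p \<in> K" using edge \<open>\<bar>s\<bar> < e\<close> by (simp add: p_def)
    have "p - l *\<^sub>R (p - q) = y"
    proof -
      have tt: "t \<bullet> t = 1" "\<nu> \<bullet> \<nu> = 1" using assms(2,3) by (simp_all add: dot_square_norm)
      have "(y - z) \<bullet> \<nu> = - (l * y0)" "(q - z) \<bullet> \<nu> = - y0" using \<open>y0 > 0\<close> by (simp_all add: l_def y0_def)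
      then have "y - z = x *\<^sub>R t + - (l * y0) *\<^sub>R \<nu>" and "q - z = x0 *\<^sub>R t + - y0 *\<^sub>R \<nu>"
        using frame[of "y - z"] frame[of "q - z"] by (simp_all only: x_def[symmetric] x0_def[symmetric])
      then have qz: "q = z + x0 *\<^sub>R t - y0 *\<^sub>R \<nu>" 
        and yz: "y = z + x *\<^sub>R t - (l * y0) *\<^sub>R \<nu>"
        by (simp_all add: diff_eq_eq algebra_simps)
      have "(1 - l) * s + l * x0 = x" using l2 by (simp add: s_def)
      then have "((1 - l) * s) *\<^sub>R t + (l * x0) *\<^sub>R t = x *\<^sub>R t" by (simp flip: scaleR_left_distrib)
      then show ?thesis unfolding p_def yz by (subst qz) (simp add: algebra_simps)
    qed
    then show ?thesis
      using mem_interior_convex_shrink[OF \<open>convex K\<close> q(1) \<open>p \<in> K\<close>, of l] l l2 by simp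
  qed
  ultimately show ?thesis by blast
qed

lemma bdry_coordinates:
  "bdry_x z \<phi> w = (w - z) \<bullet> rightward (- \<phi>)" "bdry_y z \<phi> w = (w - z) \<bullet> heading (- \<phi>)"
  by (simp_all add: bdry_x_def bdry_y_def heading_def rightward_def inner_prod_def algebra_simps)

text \<open>
  A smooth curve contained in a line is a segment of its own tangent line.
\<close>

lemma common_boundary_is_straight:
  assumes "tangent_angle C z \<phi>" "a \<noteq> 0" and line: "\<And>w. w \<in> C \<Longrightarrow> a \<bullet> w = b"
  shows "a \<bullet> rightward (- \<phi>) = 0" "\<exists>e>0. \<forall>s. \<bar>s\<bar> < e \<longrightarrow> z + s *\<^sub>R rightward (- \<phi>) \<in> C"
proof -
  define t where "t = rightward (- \<phi>)"
  define n where "n = heading (- \<phi>)"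
  obtain \<epsilon> \<delta> g g' where "\<epsilon> > 0" "\<delta> > 0"
    and dg: "\<And>s. s \<in> {-\<epsilon><..<\<epsilon>} \<Longrightarrow> (g has_real_derivative g' s) (at s)" and g0: "g 0 = 0" "g' 0 = 0"
    and graph: "\<And>w. \<bar>bdry_x z \<phi> w\<bar> < \<epsilon> \<Longrightarrow> \<bar>bdry_y z \<phi> w\<bar> < \<delta> \<Longrightarrow>
        w \<in> C \<longleftrightarrow> bdry_y z \<phi> w = g (bdry_x z \<phi> w)"
    using assms(1) unfolding tangent_angle_def by blast
  have tn: "t \<bullet> t = 1" "n \<bullet> n = 1" "t \<bullet> n = 0" "n \<bullet> t = 0"
    by (simp_all add: t_def n_def inner_heading inner_rightward inner_heading_rightward inner_commute)
  have coord: "bdry_x z \<phi> (z + s *\<^sub>R t + r *\<^sub>R n) = s" "bdry_y z \<phi> (z + s *\<^sub>R t + r *\<^sub>R n) = r" for s r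
    by (simp_all add: bdry_coordinates tn inner_add_left flip: t_def n_def)
  have D: "(g has_real_derivative 0) (at 0)" using dg[of 0] g0 \<open>\<epsilon> > 0\<close> by auto
  have "(g \<longlongrightarrow> 0) (nhds 0)" using isCont_tendsto_nhds[OF DERIV_isCont[OF D]] g0 by simp
  then have "\<forall>\<^sub>F s in nhds 0. \<bar>g s\<bar> < \<delta>"
    using \<open>\<delta> > 0\<close> by (auto simp: tendsto_iff dist_real_def)
  then obtain d where "d > 0" and d: "\<And>s. \<bar>s\<bar> < d \<Longrightarrow> \<bar>g s\<bar> < \<delta>"
    unfolding eventually_nhds_metric by (auto simp: dist_real_def)
  define e where "e = min d \<epsilon>"
  have "e > 0" using \<open>d > 0\<close> \<open>\<epsilon> > 0\<close> by (simp add: e_def)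
  have on_graph: "z + s *\<^sub>R t + g s *\<^sub>R n \<in> C" if "\<bar>s\<bar> < e" for s
    using graph[of "z + s *\<^sub>R t + g s *\<^sub>R n"] d[of s] that by (simp add: coord e_def)
  have "a \<bullet> z = b" using line on_graph[of 0] g0 \<open>e > 0\<close> by simp
  then have lin: "s * (a \<bullet> t) + g s * (a \<bullet> n) = 0" if "\<bar>s\<bar> < e" for s
    using line[OF on_graph[OF that]] by (simp add: inner_add_right)
  have at0: "a \<bullet> t = 0"
  proof -
    have "((\<lambda>s. s * (a \<bullet> t) + g s * (a \<bullet> n)) has_real_derivative a \<bullet> t) (at 0)"
      using D by (auto intro!: derivative_eq_intros)
    moreover have "((\<lambda>s. s * (a \<bullet> t) + g s * (a \<bullet> n)) has_real_derivative 0) (at 0)"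
      by (rule has_field_derivative_transform_within_open[OF DERIV_const, of "{-e<..<e}" 0])
        (use lin \<open>e > 0\<close> in auto)
    ultimately show ?thesis by (rule DERIV_unique)
  qed
  then show "a \<bullet> rightward (- \<phi>) = 0" by (simp add: t_def)
  have "a \<bullet> n \<noteq> 0"
  proof
    assume "a \<bullet> n = 0"
    then have "a = 0" using at0 frame_expansion[of a "- \<phi>"] by (simp add: t_def n_def)
    then show False using \<open>a \<noteq> 0\<close> by simp
  qed
  then have "z + s *\<^sub>R t \<in> C" if "\<bar>s\<bar> < e" for s
    using on_graph[OF that] lin[OF that] at0 by simp
  then show "\<exists>e>0. \<forall>s. \<bar>s\<bar> < e \<longrightarrow> z + s *\<^sub>R rightward (- \<phi>) \<in> C"
    using \<open>e > 0\<close> by (auto simp: t_def)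
qed

text \<open>
  A hyperplane separating the interiors of the two convex sets contains their common boundary, so
  \<open>common_boundary_is_straight\<close> applies to it. As \<open>\<phi>\<close> is an angle of an unoriented tangent line,
  either of the two unit normals may point from \<open>K\<close> to \<open>K'\<close>.
\<close>

lemma adjacent_half_discs:
  assumes K: "convex K" "closed K" "interior K \<noteq> {}" and K': "convex K'" "closed K'" "interior K' \<noteq> {}"
    and disj: "interior K \<inter> interior K' = {}" and tan: "tangent_angle (frontier K \<inter> frontier K') z \<phi>"
  obtains \<nu> \<rho> where "\<nu> = heading (- \<phi>) \<or> \<nu> = - heading (- \<phi>)" "\<rho> > 0"
    "\<And>y. y \<in> K \<Longrightarrow> (y - z) \<bullet> \<nu> \<le> 0" "\<And>y. y \<in> K' \<Longrightarrow> (y - z) \<bullet> \<nu> \<ge> 0"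
    "\<And>y. y \<in> interior K \<Longrightarrow> (y - z) \<bullet> \<nu> < 0" "\<And>y. y \<in> interior K' \<Longrightarrow> (y - z) \<bullet> \<nu> > 0"
    "\<And>y. y \<in> ball z \<rho> \<Longrightarrow> (y - z) \<bullet> \<nu> < 0 \<Longrightarrow> y \<in> interior K"
    "\<And>y. y \<in> ball z \<rho> \<Longrightarrow> (y - z) \<bullet> \<nu> > 0 \<Longrightarrow> y \<in> interior K'"
    "\<And>s. \<bar>s\<bar> < \<rho> \<Longrightarrow> z + s *\<^sub>R rightward (- \<phi>) \<in> K \<inter> K'"
proof -
  define t where "t = rightward (- \<phi>)"
  define n where "n = heading (- \<phi>)"
  obtain a b where "a \<noteq> 0" and le: "\<And>x. x \<in> interior K \<Longrightarrow> a \<bullet> x \<le> b"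
    and ge: "\<And>x. x \<in> interior K' \<Longrightarrow> a \<bullet> x \<ge> b"
    using separating_hyperplane_sets[OF convex_interior[OF K(1)] convex_interior[OF K'(1)] K(3) K'(3) disj] by blast
  have "closure (interior K) \<subseteq> {x. a \<bullet> x \<le> b}"
    using le by (intro closure_minimal closed_halfspace_le) auto
  then have le: "a \<bullet> x \<le> b" if "x \<in> K" for x
    using that convex_closure_interior[OF K(1,3)] K(2) by auto
  have "closure (interior K') \<subseteq> {x. a \<bullet> x \<ge> b}"
    using ge by (intro closure_minimal closed_halfspace_ge) auto
  then have ge: "a \<bullet> x \<ge> b" if "x \<in> K'" for x
    using that convex_closure_interior[OF K'(1,3)] K'(2) by auto
  have sub: "frontier K \<subseteq> K" "frontier K' \<subseteq> K'" using K(2) K'(2) by (simp_all add: frontier_subset_eq)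
  have line: "a \<bullet> w = b" if "w \<in> frontier K \<inter> frontier K'" for w
    using that sub le[of w] ge[of w] by fastforce
  have at0: "a \<bullet> t = 0" unfolding t_def by (rule common_boundary_is_straight(1)[OF tan \<open>a \<noteq> 0\<close> line])
  obtain e where "e > 0" and edge: "\<And>s. \<bar>s\<bar> < e \<Longrightarrow> z + s *\<^sub>R t \<in> frontier K \<inter> frontier K'"
    using common_boundary_is_straight(2)[OF tan \<open>a \<noteq> 0\<close> line] unfolding t_def by blast
  have az: "a \<bullet> z = b" using line[OF edge[of 0]] \<open>e > 0\<close> by simp
  have an: "a = (a \<bullet> n) *\<^sub>R n" using frame_expansion[of a "- \<phi>"] at0 by (simp add: t_def n_def)
  define \<nu> where "\<nu> = sgn (a \<bullet> n) *\<^sub>R n"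
  have "a \<bullet> n \<noteq> 0" using an \<open>a \<noteq> 0\<close> by auto
  then have nu: "\<nu> = n \<or> \<nu> = - n" by (auto simp: \<nu>_def sgn_if)
  have a\<nu>: "a = \<bar>a \<bullet> n\<bar> *\<^sub>R \<nu>" by (subst an) (simp add: \<nu>_def abs_mult_sgn)
  have side: "a \<bullet> y - b = \<bar>a \<bullet> n\<bar> * ((y - z) \<bullet> \<nu>)" for y
    using arg_cong[OF a\<nu>, of "\<lambda>x. (y - z) \<bullet> x"] az
    by (simp add: inner_commute[of "y - z"]) (simp add: inner_diff_right)
  have s1: "(y - z) \<bullet> \<nu> \<le> 0" if "y \<in> K" for y
    using le[OF that] side[of y] \<open>a \<bullet> n \<noteq> 0\<close> by (metis diff_le_0_iff_le mult_le_0_iff not_le zero_less_abs_iff)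
  have s2: "(y - z) \<bullet> \<nu> \<ge> 0" if "y \<in> K'" for y
    using ge[OF that] side[of y] \<open>a \<bullet> n \<noteq> 0\<close> by (metis diff_ge_0_iff_ge zero_le_mult_iff not_le zero_less_abs_iff)
  have nn: "norm \<nu> = 1" "\<nu> \<noteq> 0" using nu norm_heading[of "- \<phi>"] unfolding n_def
    by (auto simp del: norm_heading)
  have flip: "(y - z) \<bullet> \<nu> = \<nu> \<bullet> y - \<nu> \<bullet> z" for y by (metis inner_commute inner_diff_right)
  have i1: "(y - z) \<bullet> \<nu> < 0" if "y \<in> interior K" for y
  proof -
    have "interior K \<subseteq> interior {x. \<nu> \<bullet> x \<le> \<nu> \<bullet> z}"
      using s1 unfolding flip by (intro interior_mono) auto
    then show ?thesis using that nn unfolding flip by (auto simp: interior_halfspace_le)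
  qed
  have i2: "(y - z) \<bullet> \<nu> > 0" if "y \<in> interior K'" for y
  proof -
    have "interior K' \<subseteq> interior {x. \<nu> \<bullet> x \<ge> \<nu> \<bullet> z}"
      using s2 unfolding flip by (intro interior_mono) auto
    then show ?thesis using that nn unfolding flip by (auto simp: interior_halfspace_ge)
  qed
  have frame: "y = (y \<bullet> t) *\<^sub>R t + (y \<bullet> \<nu>) *\<^sub>R \<nu>" "y = (y \<bullet> t) *\<^sub>R t + (y \<bullet> - \<nu>) *\<^sub>R - \<nu>" for y
    using frame_expansion[of y "- \<phi>"] nu by (auto simp: t_def n_def add.commute)
  obtain k k' where k: "k \<in> interior K" "k' \<in> interior K'" using K(3) K'(3) by blast
  have nt: "norm t = 1" "norm (- \<nu>) = 1" using nn by (simp_all add: t_def)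
  have edges: "z + s *\<^sub>R t \<in> K" "z + s *\<^sub>R t \<in> K'" if "\<bar>s\<bar> < e" for s
    using edge[OF that] sub by auto
  have "(k' - z) \<bullet> - \<nu> < 0" using i2[OF k(2)] by simp
  from half_disc_in_convex[OF frame(2) nt K'(1) \<open>e > 0\<close> edges(2) k(2) this]
  obtain \<rho>2 where \<rho>2: "\<rho>2 > 0" "\<forall>y\<in>ball z \<rho>2. (y - z) \<bullet> - \<nu> < 0 \<longrightarrow> y \<in> interior K'"
    by blast
  from half_disc_in_convex[OF frame(1) nt(1) nn(1) K(1) \<open>e > 0\<close> edges(1) k(1) i1[OF k(1)]]
  obtain \<rho>1 where \<rho>1: "\<rho>1 > 0" "\<forall>y\<in>ball z \<rho>1. (y - z) \<bullet> \<nu> < 0 \<longrightarrow> y \<in> interior K"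
    by blast
  show thesis
  proof (rule that[of \<nu> "min e (min \<rho>1 \<rho>2)"])
    show "\<nu> = heading (- \<phi>) \<or> \<nu> = - heading (- \<phi>)" using nu by (simp add: n_def)
    show "min e (min \<rho>1 \<rho>2) > 0" using \<rho>1 \<rho>2 \<open>e > 0\<close> by simp
    show "z + s *\<^sub>R rightward (- \<phi>) \<in> K \<inter> K'" if "\<bar>s\<bar> < min e (min \<rho>1 \<rho>2)" for s
      using edges[of s] that by (simp add: t_def)
    show "y \<in> interior K" if "y \<in> ball z (min e (min \<rho>1 \<rho>2))" "(y - z) \<bullet> \<nu> < 0" for y
      using \<rho>1(2) that by simp
    show "y \<in> interior K'" if "y \<in> ball z (min e (min \<rho>1 \<rho>2))" "(y - z) \<bullet> \<nu> > 0" for y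
      using \<rho>2(2) that by simp
  qed (use s1 s2 i1 i2 in blast)+
qed

text \<open>The closure is a face of itself, with the interior of the closure as its relative interior.\<close>

lemma interior_closure_polytope_region:
  assumes "polytope_region S"
  shows "interior (closure S) = interior S" "convex (closure S)" "interior (closure S) \<noteq> {}"
proof -
  have ne: "interior S \<noteq> {}" and faces: "\<And>F. F face_of closure S \<Longrightarrow> rel_interior F \<subseteq> S \<or> rel_interior F \<inter> S = {}"
    and cv: "convex (closure S)"
    using assms by (auto simp: polytope_region_def polytope_imp_convex)
  have mono: "interior S \<subseteq> interior (closure S)" by (intro interior_mono closure_subset)
  then show ne': "interior (closure S) \<noteq> {}" using ne by auto
  have "rel_interior (closure S) = interior (closure S)" using ne' by (rule rel_interior_nonempty_interior)
  then have "interior (closure S) \<subseteq> S"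
    using faces[OF face_of_refl[OF cv]] mono ne interior_subset[of S] by auto
  then show "interior (closure S) = interior S" using mono by (simp add: interior_maximal subset_antisym)
  show "convex (closure S)" by (rule cv)
qed

text \<open>
  The points of the edge near \<open>z\<close> all lie in the relative interior of one face, which is contained
  in \<open>S\<close> together with \<open>z\<close>.
\<close>

lemma edge_in_polytope_region:
  assumes S: "polytope_region S" and frame: "\<And>y. y = (y \<bullet> t) *\<^sub>R t + (y \<bullet> \<nu>) *\<^sub>R \<nu>" and "norm t = 1" "t \<bullet> \<nu> = 0"
    and side: "\<And>y. y \<in> closure S \<Longrightarrow> (y - z) \<bullet> \<nu> \<le> 0"
    and edge: "\<And>s. \<bar>s\<bar> < \<rho> \<Longrightarrow> z + s *\<^sub>R t \<in> closure S" and "z \<in> S" and s: "\<bar>s\<bar> < \<rho>"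
  shows "z + s *\<^sub>R t \<in> S"
proof -
  define F where "F = closure S \<inter> {x. \<nu> \<bullet> x = \<nu> \<bullet> z}"
  have flip: "(y - z) \<bullet> \<nu> = \<nu> \<bullet> y - \<nu> \<bullet> z" for y by (metis inner_commute inner_diff_right)
  have "F face_of closure S"
    unfolding F_def using side unfolding flip
    by (intro face_of_Int_supporting_hyperplane_le interior_closure_polytope_region(2)[OF S]) auto
  then have dich: "rel_interior F \<subseteq> S \<or> rel_interior F \<inter> S = {}"
    using S by (simp add: polytope_region_def)
  have rel: "z + s *\<^sub>R t \<in> rel_interior F" if s: "\<bar>s\<bar> < \<rho>" for s
    unfolding mem_rel_interior_ball
  proof (intro conjI exI[of _ "\<rho> - \<bar>s\<bar>"])
    show "z + s *\<^sub>R t \<in> F" using edge[OF s] \<open>t \<bullet> \<nu> = 0\<close> by (simp add: F_def inner_add_right inner_commute)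
    show "\<rho> - \<bar>s\<bar> > 0" using s by simp
    show "ball (z + s *\<^sub>R t) (\<rho> - \<bar>s\<bar>) \<inter> affine hull F \<subseteq> F"
    proof
      fix y assume y: "y \<in> ball (z + s *\<^sub>R t) (\<rho> - \<bar>s\<bar>) \<inter> affine hull F"
      have "affine hull F \<subseteq> {x. \<nu> \<bullet> x = \<nu> \<bullet> z}"
        by (intro hull_minimal affine_hyperplane) (auto simp: F_def)
      then have "\<nu> \<bullet> y = \<nu> \<bullet> z" using y by auto
      then have "(y - z) \<bullet> \<nu> = 0" by (simp add: flip)
      then have "y - z = ((y - z) \<bullet> t) *\<^sub>R t"
        using frame[of "y - z"] by (metis add.right_neutral scaleR_zero_left)
      then have yz: "y = z + ((y - z) \<bullet> t) *\<^sub>R t" by (metis add.commute diff_add_cancel)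
      have "t \<bullet> t = 1" using \<open>norm t = 1\<close> by (simp add: dot_square_norm)
      then have "(y - z) \<bullet> t = s + (y - (z + s *\<^sub>R t)) \<bullet> t" by (simp add: inner_diff_left inner_add_left)
      moreover have "\<bar>(y - (z + s *\<^sub>R t)) \<bullet> t\<bar> < \<rho> - \<bar>s\<bar>"
        using Cauchy_Schwarz_ineq2[of "y - (z + s *\<^sub>R t)" t] y \<open>norm t = 1\<close>
        by (simp add: dist_norm norm_minus_commute)
      ultimately have "\<bar>(y - z) \<bullet> t\<bar> < \<rho>" by linarith
      from edge[OF this] have "y \<in> closure S" by (subst yz)
      then show "y \<in> F" using \<open>\<nu> \<bullet> y = \<nu> \<bullet> z\<close> by (simp add: F_def)
    qed
  qed
  have "z \<in> rel_interior F" using rel[of 0] s by simp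
  then have "rel_interior F \<subseteq> S" using dich \<open>z \<in> S\<close> by blast
  then show ?thesis using rel[OF s] by blast
qed

text \<open>
  A competing path may have to cross at other points of the edge, which must therefore belong to the
  terrain. The region containing \<open>z\<close> is one of the two adjacent ones, because the interior of
  any other region with \<open>z\<close> in its closure would meet one of the half discs.
\<close>

lemma edge_in_terrain:
  assumes val: "valid_terrain T" and p: "p \<in> indices T" "p' \<in> indices T" and "z \<in> whole T"
    and frame: "\<And>y. y = (y \<bullet> t) *\<^sub>R t + (y \<bullet> \<nu>) *\<^sub>R \<nu>" and "norm t = 1" "norm \<nu> = 1" "t \<bullet> \<nu> = 0"
    and side: "\<And>y. y \<in> closure (region T p) \<Longrightarrow> (y - z) \<bullet> \<nu> \<le> 0"
      "\<And>y. y \<in> closure (region T p') \<Longrightarrow> (y - z) \<bullet> \<nu> \<ge> 0"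
    and disc: "\<And>y. y \<in> ball z \<rho> \<Longrightarrow> (y - z) \<bullet> \<nu> < 0 \<Longrightarrow> y \<in> interior (region T p)"
      "\<And>y. y \<in> ball z \<rho> \<Longrightarrow> (y - z) \<bullet> \<nu> > 0 \<Longrightarrow> y \<in> interior (region T p')"
    and edge: "\<And>s. \<bar>s\<bar> < \<rho> \<Longrightarrow> z + s *\<^sub>R t \<in> closure (region T p) \<inter> closure (region T p')"
    and s: "\<bar>s\<bar> < \<rho>"
  shows "z + s *\<^sub>R t \<in> whole T"
proof -
  have reg: "polytope_region (region T q)" if "q \<in> indices T" for q using val that by (simp add: valid_terrain_def)
  obtain q where q: "q \<in> indices T" "z \<in> region T q" using \<open>z \<in> whole T\<close> by (auto simp: whole_def)
  have "q = p \<or> q = p'"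
  proof (rule ccontr)
    assume *: "\<not> (q = p \<or> q = p')"
    then have disj: "region T q \<inter> region T p = {}" "region T q \<inter> region T p' = {}"
      using val q p by (auto simp: valid_terrain_def)
    have "closure (interior (closure (region T q))) = closure (region T q)"
      using convex_closure_interior[OF interior_closure_polytope_region(2,3)[OF reg[OF q(1)]]] by simp
    then have "z \<in> closure (interior (region T q))"
      using q(2) closure_subset interior_closure_polytope_region(1)[OF reg[OF q(1)]] by auto
    moreover have "\<rho> > 0" using s by linarith
    ultimately obtain y where "y \<in> interior (region T q)" "y \<in> ball z \<rho>"
      by (auto simp: closure_approachable dist_commute)
    then have "y \<in> interior (region T q) \<inter> ball z \<rho>" by simp
    moreover have op: "open (interior (region T q) \<inter> ball z \<rho>)" by auto
    ultimately obtain e where "e > 0" and e: "cball y e \<subseteq> interior (region T q) \<inter> ball z \<rho>"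
      using open_contains_cball by blast
    have "y \<in> cball y e" "y + e *\<^sub>R \<nu> \<in> cball y e"
      using \<open>e > 0\<close> \<open>norm \<nu> = 1\<close> by (auto simp: dist_norm)
    moreover have "(y + e *\<^sub>R \<nu> - z) \<bullet> \<nu> = (y - z) \<bullet> \<nu> + e"
      using \<open>norm \<nu> = 1\<close> by (simp add: inner_diff_left inner_add_left dot_square_norm)
    ultimately obtain x where x: "x \<in> cball y e" "(x - z) \<bullet> \<nu> \<noteq> 0"
      using \<open>e > 0\<close> by (metis add_0 less_irrefl)
    then have "x \<in> ball z \<rho>" "x \<in> interior (region T q)" using e by auto
    then show False using disc[of x] x(2) disj interior_subset by (meson disjoint_iff linorder_neqE_linordered_idom subsetD)
  qed
  then have "z + s *\<^sub>R t \<in> region T q"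
  proof
    assume "q = p"
    then show ?thesis
      using edge_in_polytope_region[OF reg[OF p(1)] frame \<open>norm t = 1\<close> \<open>t \<bullet> \<nu> = 0\<close> side(1) _ _ s] edge q by blast
  next
    assume "q = p'"
    have frame': "y = (y \<bullet> t) *\<^sub>R t + (y \<bullet> - \<nu>) *\<^sub>R - \<nu>" for y using frame[of y] by simp
    have "t \<bullet> - \<nu> = 0" "(y - z) \<bullet> - \<nu> \<le> 0" if "y \<in> closure (region T p')" for y
      using side(2)[OF that] \<open>t \<bullet> \<nu> = 0\<close> by simp_all
    with \<open>q = p'\<close> show ?thesis
      using edge_in_polytope_region[OF reg[OF p(2)] frame' \<open>norm t = 1\<close> _ _ _ _ s] edge q s
      by (smt (verit) IntD2 \<open>t \<bullet> \<nu> = 0\<close> inner_minus_right)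
  qed
  then show ?thesis using q by (auto simp: whole_def)
qed

section \<open>Replacing the path around a crossing\<close>

text \<open>
  \<open>F\<close> is kept up to the time \<open>a\<close> on piece \<open>m\<close> and from the time \<open>d\<close> on piece \<open>m + 1\<close>; in
  between it is replaced by \<open>G\<close>, of duration \<open>\<tau>\<close>, and \<open>G'\<close>, of duration \<open>\<tau>'\<close>. All that follows is
  delayed by \<open>\<tau> + \<tau>' - (d - a)\<close>.
\<close>

definition patch :: "nat \<Rightarrow> real \<Rightarrow> real \<Rightarrow> real \<Rightarrow> real \<Rightarrow>
    (real \<times> nat \<Rightarrow> 'a) \<Rightarrow> (real \<Rightarrow> 'a) \<Rightarrow> (real \<Rightarrow> 'a) \<Rightarrow> real \<times> nat \<Rightarrow> 'a" where
  "patch m a d \<tau> \<tau>' F G G' = (\<lambda>(s, i).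
     if i < m then F (s, i)
     else if i = m then if s \<le> a then F (s, i) else G (s - a)
     else if i = Suc m \<and> s \<le> a + \<tau> + \<tau>' then G' (s - (a + \<tau>))
     else F (s - (\<tau> + \<tau>' - (d - a)), i))"

lemma solution_with_replaced_crossing:
  assumes X: "solves T B X" and m: "Suc m < pieces X"
    and a: "time X m \<le> a" "a < time X (Suc m)" and d: "time X (Suc m) < d" "d \<le> time X (Suc (Suc m))"
    and reg: "pos X (a, m) \<in> region T (reg X m)" "pos X (d, Suc m) \<in> region T (reg X (Suc m))"
    and in1: "travels (speed T (reg X m)) (max_turn_rate T (reg X m)) (region T (reg X m))
        (pos X (a, m)) (orient X (a, m)) z \<eta> \<tau>"
    and in2: "travels (speed T (reg X (Suc m))) (max_turn_rate T (reg X (Suc m))) (region T (reg X (Suc m)))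
        z \<eta> (pos X (d, Suc m)) (orient X (d, Suc m)) \<tau>'"
    and z: "z \<in> whole T"
  shows "\<exists>Y. solves T B Y \<and> duration Y = duration X + (\<tau> + \<tau>' - (d - a))"
proof -
  obtain P1 \<theta>1 u1 where 1: "\<tau> > 0"
    "steers (speed T (reg X m)) (max_turn_rate T (reg X m)) P1 \<theta>1 u1 0 \<tau>"
    "P1 0 = pos X (a, m)" "\<theta>1 0 = orient X (a, m)" "P1 \<tau> = z" "\<theta>1 \<tau> = \<eta>"
    "\<And>s. s \<in> {0<..<\<tau>} \<Longrightarrow> P1 s \<in> region T (reg X m)"
    using in1 unfolding travels_def by blast
  obtain P2 \<theta>2 u2 where 2: "\<tau>' > 0"
    "steers (speed T (reg X (Suc m))) (max_turn_rate T (reg X (Suc m))) P2 \<theta>2 u2 0 \<tau>'"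
    "P2 0 = z" "\<theta>2 0 = \<eta>" "P2 \<tau>' = pos X (d, Suc m)" "\<theta>2 \<tau>' = orient X (d, Suc m)"
    "\<And>s. s \<in> {0<..<\<tau>'} \<Longrightarrow> P2 s \<in> region T (reg X (Suc m))"
    using in2 unfolding travels_def by blast
  have sol: "hybrid_solution T X" using X by (simp add: solves_def)
  have t_less: "time X i < time X (Suc i)" and q_in: "reg X i \<in> indices T"
    and dyn: "dynamics_on_piece T X i" 
    and inside: "\<And>s. s \<in> {time X i<..<time X (Suc i)} \<Longrightarrow> pos X (s, i) \<in> region T (reg X i)"
    and in_whole: "\<And>s. s \<in> {time X i..time X (Suc i)} \<Longrightarrow> pos X (s, i) \<in> whole T" if "i < pieces X" for i
    using sol that unfolding hybrid_solution_def hdom_def by auto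
  have cross: "reg X i \<noteq> reg X (Suc i)" "pos X (time X (Suc i), Suc i) = pos X (time X (Suc i), i)"
    "orient X (time X (Suc i), Suc i) = orient X (time X (Suc i), i)" if "Suc i < pieces X" for i
    using sol that unfolding hybrid_solution_def by (auto simp: pos_def)
  have st: "steers (speed T (reg X i)) (max_turn_rate T (reg X i)) (\<lambda>s. pos X (s, i))
      (\<lambda>s. orient X (s, i)) (\<lambda>s. ctrl X (s, i)) (time X i) (time X (Suc i))" if "i < pieces X" for i
    using dyn[OF that] by (simp add: dynamics_on_piece_iff_steers)
  define h where "h = \<tau> + \<tau>' - (d - a)"
  define c where "c = a + \<tau>"
  define e where "e = a + \<tau> + \<tau>'"
  have e: "e = d + h" "c < e" "a < c" using 1(1) 2(1) by (simp_all add: e_def h_def c_def)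
  have ec: "e - c = \<tau>'" "e - h = d" using e(1) by (simp_all add: e_def c_def)
  define Y where "Y = \<lparr>pieces = pieces X,
    time = (\<lambda>i. if i \<le> m then time X i else if i = Suc m then c else time X i + h), reg = reg X,
    xpos = fst \<circ> patch m a d \<tau> \<tau>' (pos X) P1 P2, ypos = snd \<circ> patch m a d \<tau> \<tau>' (pos X) P1 P2,
    orient = patch m a d \<tau> \<tau>' (orient X) \<theta>1 \<theta>2, ctrl = patch m a d \<tau> \<tau>' (ctrl X) u1 u2\<rparr>"
  have Y: "pieces Y = pieces X" "reg Y = reg X" "pos Y = patch m a d \<tau> \<tau>' (pos X) P1 P2"
    "orient Y = patch m a d \<tau> \<tau>' (orient X) \<theta>1 \<theta>2" "ctrl Y = patch m a d \<tau> \<tau>' (ctrl X) u1 u2"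
    "\<And>i. i \<le> m \<Longrightarrow> time Y i = time X i" "time Y (Suc m) = c" "\<And>i. i > Suc m \<Longrightarrow> time Y i = time X i + h"
    by (auto simp: Y_def pos_def fun_eq_iff)
  have before: "patch m a d \<tau> \<tau>' F G G' (s, i) = F (s, i)" if "i < m" for F :: "real \<times> nat \<Rightarrow> 'a" and G G' s i
    using that by (simp add: patch_def)
  have at_m: "patch m a d \<tau> \<tau>' F G G' (s, m) = (if s \<le> a then F (s, m) else G (s - a))"
    for F :: "real \<times> nat \<Rightarrow> 'a" and G G' s by (simp add: patch_def)
  have at_Suc: "patch m a d \<tau> \<tau>' F G G' (s, Suc m) = (if s \<le> e then G' (s - c) else F (s - h, Suc m))"
    for F :: "real \<times> nat \<Rightarrow> 'a" and G G' s by (simp add: patch_def e_def c_def h_def)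
  have after: "patch m a d \<tau> \<tau>' F G G' (s, i) = F (s - h, i)" if "i > Suc m" for F :: "real \<times> nat \<Rightarrow> 'a" and G G' s i
    using that by (simp add: patch_def h_def)
  have piece: "time Y i < time Y (Suc i) \<and>
      steers (speed T (reg X i)) (max_turn_rate T (reg X i)) (\<lambda>s. pos Y (s, i))
        (\<lambda>s. orient Y (s, i)) (\<lambda>s. ctrl Y (s, i)) (time Y i) (time Y (Suc i)) \<and>
      (\<forall>s\<in>{time Y i<..<time Y (Suc i)}. pos Y (s, i) \<in> region T (reg X i)) \<and>
      pos Y (time Y i, i) \<in> whole T \<and> pos Y (time Y (Suc i), i) \<in> whole T"
    if i: "i < pieces X" for i
  proof -
    consider "i < m" | "i = m" | "i = Suc m" | "i > Suc m" by linarith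
    then show ?thesis
    proof cases
      case 1
      then show ?thesis using t_less[OF i] st[OF i] inside[OF i] in_whole[OF i] by (simp add: Y before)
    next
      case 2
      have "steers (speed T (reg X m)) (max_turn_rate T (reg X m))
          (\<lambda>s. if s \<le> a then pos X (s, m) else P1 (s - a))
          (\<lambda>s. if s \<le> a then orient X (s, m) else \<theta>1 (s - a))
          (\<lambda>s. if s \<le> a then ctrl X (s, m) else u1 (s - a)) (time X m) (\<tau> + a)"
        using steers_shift[OF 1(2), of a] 1 a i 2
        by (intro steers_join[OF steers_subinterval[OF st]]) auto
      moreover have "pos Y (s, m) \<in> region T (reg X m)" if s: "s \<in> {time X m<..<c}" for s
        using s reg(1) a i 2 inside[of m s] 1(7)[of "s - a"] by (cases "s = a") (auto simp: Y at_m c_def)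
      moreover have "pos Y (time X m, m) \<in> whole T" "pos Y (c, m) \<in> whole T"
        using a i 2 in_whole[of m "time X m"] t_less[of m] z 1(1,5) by (auto simp: Y at_m c_def)
      ultimately show ?thesis
        using 2 a e by (simp add: Y at_m c_def add.commute)
    next
      case 3
      have shifted: "steers (speed T (reg X (Suc m))) (max_turn_rate T (reg X (Suc m))) (\<lambda>s. P2 (s - c)) (\<lambda>s. \<theta>2 (s - c))
          (\<lambda>s. u2 (s - c)) c e"
        using steers_shift[OF 2(2), of c] by (simp add: e_def c_def add.commute)
      have "steers (speed T (reg X (Suc m))) (max_turn_rate T (reg X (Suc m))) (\<lambda>s. pos X (s - h, Suc m))
          (\<lambda>s. orient X (s - h, Suc m)) (\<lambda>s. ctrl X (s - h, Suc m)) e (time X (Suc (Suc m)) + h)"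
        using steers_shift[OF steers_subinterval[OF st[OF m], of d "time X (Suc (Suc m))"], of h] d
        by (simp add: e(1))
      from steers_join[OF shifted this]
      have "steers (speed T (reg X (Suc m))) (max_turn_rate T (reg X (Suc m)))
          (\<lambda>s. if s \<le> e then P2 (s - c) else pos X (s - h, Suc m))
          (\<lambda>s. if s \<le> e then \<theta>2 (s - c) else orient X (s - h, Suc m))
          (\<lambda>s. if s \<le> e then u2 (s - c) else ctrl X (s - h, Suc m)) c (time X (Suc (Suc m)) + h)"
        using 2 d ec by simp
      moreover have "pos Y (s, Suc m) \<in> region T (reg X (Suc m))" if s: "s \<in> {c<..<time X (Suc (Suc m)) + h}" for s
      proof -
        consider "s < e" | "s = e" | "s > e" by linarith
        then show ?thesis
          using s reg(2) d inside[OF m, of "s - h"] 2(5) 2(7)[of "s - c"] ec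
          by cases (auto simp: Y at_Suc)
      qed
      moreover have "pos Y (c, Suc m) \<in> whole T" using z 2(3) e by (simp add: Y at_Suc)
      moreover have "pos Y (time X (Suc (Suc m)) + h, Suc m) \<in> whole T"
      proof (cases "time X (Suc (Suc m)) = d")
        case True
        then show ?thesis using 2(5) ec in_whole[OF m, of d] d e(1)[symmetric] by (simp add: Y at_Suc)
      next
        case False
        then show ?thesis using in_whole[OF m, of "time X (Suc (Suc m))"] t_less[OF m] d e(1) by (simp add: Y at_Suc)
      qed
      ultimately show ?thesis
        using 3 d e by (simp add: Y at_Suc)
    next
      case 4
      then show ?thesis
        using t_less[OF i] steers_shift[OF st[OF i], of h] inside[OF i] in_whole[OF i]
        by (auto simp: Y after)
    qed
  qed
  have "hybrid_solution T Y"
    unfolding hybrid_solution_def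
  proof (intro conjI allI impI ballI)
    show "1 \<le> pieces Y" "time Y 0 = 0" using sol by (simp_all add: Y hybrid_solution_def)
    fix i assume i: "i < pieces Y"
    then show "time Y i < time Y (Suc i)" "reg Y i \<in> indices T" "dynamics_on_piece T Y i"
      using piece[of i] q_in[of i] by (simp_all add: Y dynamics_on_piece_iff_steers)
    show "pos Y (s, i) \<in> region T (reg Y i)" if "s \<in> {time Y i<..<time Y (Suc i)}" for s
      using piece[of i] i that by (simp add: Y)
  next
    fix x assume "x \<in> hdom Y"
    then obtain s i where x: "x = (s, i)" "i < pieces X" "s \<in> {time Y i..time Y (Suc i)}"
      by (auto simp: hdom_def Y)
    then consider "s = time Y i" | "s = time Y (Suc i)" | "s \<in> {time Y i<..<time Y (Suc i)}" by fastforce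
    then show "pos Y x \<in> whole T"
      using piece[OF x(2)] q_in[OF x(2)] unfolding x(1) by cases (auto simp: whole_def)
  next
    fix i assume "Suc i < pieces Y"
    then have i: "Suc i < pieces X" by (simp add: Y)
    have "pos Y (time Y (Suc i), Suc i) = pos Y (time Y (Suc i), i) \<and>
      orient Y (time Y (Suc i), Suc i) = orient Y (time Y (Suc i), i)"
    proof -
      consider "Suc i < m" | "Suc i = m" | "i = m" | "i = Suc m" | "i > Suc m" by linarith
      then show ?thesis
      proof cases
        case 2
        then show ?thesis using cross[OF i] a by (auto simp: Y(3-6) before at_m)
      next
        case 3
        then show ?thesis using 1 2 e by (auto simp: Y(3-7) at_m at_Suc c_def)
      next
        case 4
        then show ?thesis
        proof (cases "time X (Suc (Suc m)) = d")
          case True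
          then show ?thesis using cross[OF i] 2(5,6) 4 by (simp add: Y(3-8) after at_Suc e(1)[symmetric] ec)
        next
          case False
          then show ?thesis using cross[OF i] d e 4 by (auto simp: Y(3-8) after at_Suc)
        qed
      qed (use cross[OF i] in \<open>simp_all add: Y(3-8) before after\<close>)
    qed
    then show "reg Y i \<noteq> reg Y (Suc i)" "xpos Y (time Y (Suc i), Suc i) = xpos Y (time Y (Suc i), i)"
      "ypos Y (time Y (Suc i), Suc i) = ypos Y (time Y (Suc i), i)"
      "orient Y (time Y (Suc i), Suc i) = orient Y (time Y (Suc i), i)"
      using cross(1)[OF i] by (simp_all add: pos_def Y(2))
  qed
  moreover have dur: "duration Y = duration X + h"
    using m by (simp add: duration_def Y)
  moreover have "pos Y (0, 0) = pos X (0, 0)" "orient Y (0, 0) = orient X (0, 0)"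
  proof -
    have "0 \<le> a" if "m = 0" using a(1) sol that by (simp add: hybrid_solution_def)
    then show "pos Y (0, 0) = pos X (0, 0)" "orient Y (0, 0) = orient X (0, 0)"
      by (auto simp: Y patch_def)
  qed
  moreover have "pos Y (duration X + h, pieces X - 1) = pos X (duration X, pieces X - 1)"
    "orient Y (duration X + h, pieces X - 1) = orient X (duration X, pieces X - 1)"
  proof -
    consider "pieces X - 1 = Suc m" "d < duration X" | "pieces X - 1 = Suc m" "d = duration X" | "pieces X - 1 > Suc m"
    proof (cases "pieces X = Suc (Suc m)")
      case True
      then show thesis using that(1,2) d by (cases "d = duration X") (auto simp: duration_def)
    next
      case False
      then show thesis using m by (intro that(3)) linarith
    qed
    then have "pos Y (duration X + h, pieces X - 1) = pos X (duration X, pieces X - 1) \<and>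
      orient Y (duration X + h, pieces X - 1) = orient X (duration X, pieces X - 1)"
    proof cases
      case 2
      then show ?thesis using 2(1) 2(2)[symmetric] \<open>P2 \<tau>' = _\<close> \<open>\<theta>2 \<tau>' = _\<close> by (simp add: Y at_Suc e(1)[symmetric] ec)
    qed (use e in \<open>simp_all add: Y at_Suc after\<close>)
    then show "pos Y (duration X + h, pieces X - 1) = pos X (duration X, pieces X - 1)"
      "orient Y (duration X + h, pieces X - 1) = orient X (duration X, pieces X - 1)" by auto
  qed
  ultimately have "hybrid_solution T Y" "duration Y = duration X + h"
    "pos Y (0, 0) = pos X (0, 0)" "velocity T Y (0, 0) = velocity T X (0, 0)"
    "pos Y (duration X + h, pieces X - 1) = pos X (duration X, pieces X - 1)"
    "velocity T Y (duration X + h, pieces X - 1) = velocity T X (duration X, pieces X - 1)"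
    by (simp_all add: velocity_def Y(2))
  then have "solves T B Y"
    using X unfolding solves_def Let_def by (simp add: Y(1,2))
  then show ?thesis using dur h_def by blast
qed

section \<open>The refraction law\<close>

lemma turn_reversed:
  "turn (\<alpha> + \<kappa> * W + pi) (- \<kappa>) s = turn \<alpha> \<kappa> (W - s) - turn \<alpha> \<kappa> W"
proof (cases "\<kappa> = 0")
  case True
  then show ?thesis by (simp add: turn_def heading_plus_pi scaleR_left_diff_distrib)
next
  case False
  have pi: "rightward (x + pi) = - rightward x" for x by (simp add: rightward_def)
  have "rightward (\<alpha> + \<kappa> * W + pi + - \<kappa> * s) = - rightward (\<alpha> + \<kappa> * (W - s))"
    unfolding pi[symmetric] by (rule arg_cong[of _ _ rightward]) (simp add: algebra_simps)
  then show ?thesis using False by (simp add: turn_def pi scaleR_right_diff_distrib)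
qed

lemma travels_mono: "travels v w U A \<alpha> B \<beta> \<tau> \<Longrightarrow> U \<subseteq> U' \<Longrightarrow> travels v w U' A \<alpha> B \<beta> \<tau>"
  unfolding travels_def by blast

text \<open>
  The approach is varied directly and the departure as an approach of the reversed path, from
  \<open>pos X (d, Suc m)\<close> with heading \<open>\<beta> + pi\<close>, turning rate \<open>-\<kappa>'\<close> and normal \<open>-\<nu>\<close>. The last
  assumption makes the headings of the two varied parts agree at the boundary, so they form a
  competitor of \<open>X\<close>. The sum of the two time bounds therefore has a minimum at \<open>0\<close>.
\<close>

lemma crossing_is_stationary:
  fixes T :: terrain and X :: hybrid_path and m :: nat and a d :: real
  defines "v \<equiv> speed T (reg X m)" and "v' \<equiv> speed T (reg X (Suc m))"
    and "w \<equiv> max_turn_rate T (reg X m)" and "w' \<equiv> max_turn_rate T (reg X (Suc m))"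
    and "U \<equiv> interior (region T (reg X m))" and "U' \<equiv> interior (region T (reg X (Suc m)))"
    and "\<alpha> \<equiv> orient X (a, m)" and "\<beta> \<equiv> orient X (d, Suc m)"
  assumes val: "valid_terrain T" and min: "minimum_time T B X" and m: "Suc m < pieces X"
    and a: "time X m \<le> a" "a < time X (Suc m)" and d: "time X (Suc m) < d" "d \<le> time X (Suc (Suc m))"
    and ends: "pos X (a, m) \<in> U" "pos X (d, Suc m) \<in> U'"
    and pos: "L > 0" "W > 0" "W' > 0" "L' > 0" and total: "L / v + W + (L' / v' + W') = d - a"
    and kap: "\<bar>\<kappa>\<bar> \<le> w" "\<bar>\<kappa>'\<bar> \<le> w'" and \<beta>: "\<beta> = \<alpha> + \<kappa> * W + \<kappa>' * W'"
    and z: "z = pos X (a, m) + L *\<^sub>R heading \<alpha> + v *\<^sub>R turn \<alpha> \<kappa> W"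
    and D: "pos X (d, Suc m) = z + v' *\<^sub>R turn (\<alpha> + \<kappa> * W) \<kappa>' W' + L' *\<^sub>R heading \<beta>"
    and arc: "\<And>s. s \<in> {0..<W} \<Longrightarrow> pos X (a, m) + L *\<^sub>R heading \<alpha> + v *\<^sub>R turn \<alpha> \<kappa> s \<in> U"
      "\<And>s. s \<in> {0<..W'} \<Longrightarrow> z + v' *\<^sub>R turn (\<alpha> + \<kappa> * W) \<kappa>' s \<in> U'"
    and "\<rho> > 0" and disc: "\<And>y. y \<in> ball z \<rho> \<Longrightarrow> (y - z) \<bullet> \<nu> < 0 \<Longrightarrow> y \<in> U"
      "\<And>y. y \<in> ball z \<rho> \<Longrightarrow> (y - z) \<bullet> \<nu> > 0 \<Longrightarrow> y \<in> U'"
    and edge: "\<And>s. \<bar>s\<bar> < \<rho> \<Longrightarrow> z + s *\<^sub>R t \<in> whole T"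
    and "t \<bullet> \<nu> = 0" and transversal: "heading (\<alpha> + \<kappa> * W) \<bullet> \<nu> > 0"
    and match: "\<kappa> * k + \<kappa>' * k' = 0"
  shows "c * (t \<bullet> heading \<alpha>) / v + k * (1 - cos (\<kappa> * W)) =
    c * (t \<bullet> heading \<beta>) / v' - k' * (1 - cos (\<kappa>' * W'))"
proof -
  have sol: "solves T B X" and opt: "\<And>Y. solves T B Y \<Longrightarrow> duration X \<le> duration Y"
    using min by (auto simp: minimum_time_def)
  have ind: "reg X m \<in> indices T" "reg X (Suc m) \<in> indices T"
    using sol m by (auto simp: solves_def hybrid_solution_def)
  have "v > 0" "v' > 0" "w > 0" "w' > 0"
    using val ind by (auto simp: valid_terrain_def v_def v'_def w_def w'_def max_turn_rate_def)
  have "polytope_region (region T (reg X m))" "polytope_region (region T (reg X (Suc m)))"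
    using val ind by (auto simp: valid_terrain_def)
  then have U: "open U" "open U'" "convex U" "convex U'"
    unfolding U_def U'_def by (metis open_interior convex_interior interior_closure_polytope_region(1,2))+
  obtain f where f0: "f 0 = L / v + W"
    and df: "(f has_real_derivative c * (t \<bullet> heading \<alpha>) / v + k * (1 - cos (\<kappa> * W))) (at 0)"
    and f: "\<forall>\<^sub>F h in nhds 0. \<exists>\<tau>\<le>f h. travels v w U (pos X (a, m)) \<alpha> (z + (c * h) *\<^sub>R t) (\<alpha> + \<kappa> * (W + k * h)) \<tau>"
    using approach_variation[OF \<open>v > 0\<close> \<open>w > 0\<close> kap(1) pos(1,2) U(1,3) ends(1) z arc(1) \<open>\<rho> > 0\<close> disc(1)
        \<open>t \<bullet> \<nu> = 0\<close> transversal, of c k] by blast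
  have end_heading: "\<beta> + pi = \<alpha> + \<kappa> * W + \<kappa>' * W' + pi" by (simp add: \<beta>)
  have retraced: "pos X (d, Suc m) + L' *\<^sub>R heading (\<beta> + pi) + v' *\<^sub>R turn (\<beta> + pi) (- \<kappa>') s
      = z + v' *\<^sub>R turn (\<alpha> + \<kappa> * W) \<kappa>' (W' - s)" for s
  proof -
    have rev: "turn (\<beta> + pi) (- \<kappa>') s = turn (\<alpha> + \<kappa> * W) \<kappa>' (W' - s) - turn (\<alpha> + \<kappa> * W) \<kappa>' W'"
      unfolding end_heading by (rule turn_reversed)
    show ?thesis unfolding D rev heading_plus_pi by (simp add: scaleR_right_diff_distrib)
  qed
  have z': "z = pos X (d, Suc m) + L' *\<^sub>R heading (\<beta> + pi) + v' *\<^sub>R turn (\<beta> + pi) (- \<kappa>') W'"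
    unfolding retraced by simp
  have arc': "pos X (d, Suc m) + L' *\<^sub>R heading (\<beta> + pi) + v' *\<^sub>R turn (\<beta> + pi) (- \<kappa>') s \<in> U'"
    if "s \<in> {0..<W'}" for s
    unfolding retraced using arc(2)[of "W' - s"] that by simp
  have disc': "y \<in> U'" if "y \<in> ball z \<rho>" "(y - z) \<bullet> - \<nu> < 0" for y using disc(2) that by simp
  have "\<beta> + pi + - \<kappa>' * W' = (\<alpha> + \<kappa> * W) + pi" by (simp add: \<beta>)
  then have transversal': "heading (\<beta> + pi + - \<kappa>' * W') \<bullet> - \<nu> > 0" using transversal by (simp only: heading_plus_pi) simp
  have kap': "\<bar>- \<kappa>'\<bar> \<le> w'" using kap(2) by simp
  have t\<nu>: "t \<bullet> - \<nu> = 0" using \<open>t \<bullet> \<nu> = 0\<close> by simp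
  obtain g where g0: "g 0 = L' / v' + W'"
    and dg: "(g has_real_derivative c * (t \<bullet> heading (\<beta> + pi)) / v' + k' * (1 - cos (- \<kappa>' * W'))) (at 0)"
    and g: "\<forall>\<^sub>F h in nhds 0. \<exists>\<tau>\<le>g h. travels v' w' U' (pos X (d, Suc m)) (\<beta> + pi) (z + (c * h) *\<^sub>R t)
        (\<beta> + pi + - \<kappa>' * (W' + k' * h)) \<tau>"
    using approach_variation[OF \<open>v' > 0\<close> \<open>w' > 0\<close> kap' pos(4,3) U(2,4) ends(2) z' arc' \<open>\<rho> > 0\<close> disc'
        t\<nu> transversal', of c k'] by blast
  have "((\<lambda>h. \<bar>c * h\<bar>) \<longlongrightarrow> \<bar>c * 0\<bar>) (nhds 0)" by (intro tendsto_intros filterlim_ident)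
  then have "\<forall>\<^sub>F h in nhds 0. \<bar>c * h\<bar> < \<rho>" using \<open>\<rho> > 0\<close> by (intro order_tendstoD(2)) auto
  with f g have "\<forall>\<^sub>F h in nhds 0. f 0 + g 0 \<le> f h + g h"
  proof eventually_elim
    case (elim h)
    obtain \<tau> where \<tau>: "\<tau> \<le> f h" "travels v w U (pos X (a, m)) \<alpha> (z + (c * h) *\<^sub>R t) (\<alpha> + \<kappa> * (W + k * h)) \<tau>"
      using elim by blast
    obtain \<tau>' where \<tau>': "\<tau>' \<le> g h" "travels v' w' U' (pos X (d, Suc m)) (\<beta> + pi) (z + (c * h) *\<^sub>R t)
        (\<beta> + pi + - \<kappa>' * (W' + k' * h)) \<tau>'"
      using elim by blast
    have "\<kappa> * (k * h) + \<kappa>' * (k' * h) = 0" using match by (metis distrib_right mult.assoc mult_zero_left)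
    then have heading_eq: "\<beta> + pi + - \<kappa>' * (W' + k' * h) - pi = \<alpha> + \<kappa> * (W + k * h)"
      by (simp add: \<beta> algebra_simps)
    have "travels v' w' U' (z + (c * h) *\<^sub>R t) (\<alpha> + \<kappa> * (W + k * h)) (pos X (d, Suc m)) \<beta> \<tau>'"
      using travels_reverse[OF \<tau>'(2)] unfolding heading_eq by simp
    then have "travels v' w' (region T (reg X (Suc m))) (z + (c * h) *\<^sub>R t) (\<alpha> + \<kappa> * (W + k * h)) (pos X (d, Suc m)) \<beta> \<tau>'"
      by (rule travels_mono) (simp add: U'_def interior_subset)
    moreover have "travels v w (region T (reg X m)) (pos X (a, m)) \<alpha> (z + (c * h) *\<^sub>R t) (\<alpha> + \<kappa> * (W + k * h)) \<tau>"
      by (rule travels_mono[OF \<tau>(2)]) (simp add: U_def interior_subset)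
    moreover have "pos X (a, m) \<in> region T (reg X m)" "pos X (d, Suc m) \<in> region T (reg X (Suc m))"
      using ends interior_subset by (auto simp: U_def U'_def)
    ultimately obtain Y where "solves T B Y" "duration Y = duration X + (\<tau> + \<tau>' - (d - a))"
      using solution_with_replaced_crossing[OF sol m a d] edge[OF elim(3)]
      unfolding v_def v'_def w_def w'_def \<alpha>_def \<beta>_def by blast
    then show ?case using opt[of Y] \<tau>(1) \<tau>'(1) f0 g0 total by linarith
  qed
  then obtain \<epsilon> where "\<epsilon> > 0" "\<And>h. \<bar>0 - h\<bar> < \<epsilon> \<Longrightarrow> f 0 + g 0 \<le> f h + g h"
    unfolding eventually_nhds_metric by (auto simp: dist_real_def)
  with DERIV_local_min[OF DERIV_add[OF df dg] \<open>\<epsilon> > 0\<close>]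
  have "c * (t \<bullet> heading \<alpha>) / v + k * (1 - cos (\<kappa> * W)) +
    (c * (t \<bullet> heading (\<beta> + pi)) / v' + k' * (1 - cos (- \<kappa>' * W'))) = 0" by blast
  then show ?thesis by (simp add: heading_plus_pi)
qed

text \<open>
  A circle that touches a line stays on one side of it; in formulas, the terms with
  \<open>1 - cos x\<close> cancel in the difference of the two assumptions on the signed distances, which
  leaves \<open>2 * sin x * (heading \<eta> \<bullet> \<nu>) > 0\<close>.
\<close>

lemma circle_crosses_transversally:
  fixes \<nu> :: "real \<times> real"
  assumes "\<sigma> = 1 \<or> \<sigma> = -1" "0 < x" "x < pi"
    and "\<sigma> * ((rightward \<eta> - rightward (\<eta> - \<sigma> * x)) \<bullet> \<nu>) < 0"
    and "\<sigma> * ((rightward \<eta> - rightward (\<eta> + \<sigma> * x)) \<bullet> \<nu>) > 0"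
  shows "heading \<eta> \<bullet> \<nu> > 0"
proof -
  have "rightward (\<eta> - \<sigma> * x) = cos x *\<^sub>R rightward \<eta> + (\<sigma> * sin x) *\<^sub>R heading \<eta>"
    "rightward (\<eta> + \<sigma> * x) = cos x *\<^sub>R rightward \<eta> - (\<sigma> * sin x) *\<^sub>R heading \<eta>"
    using rightward_add[of \<eta> x] rightward_add[of \<eta> "-x"] assms(1) by auto
  with assms(4,5) have "\<sigma> * (rightward \<eta> \<bullet> \<nu> - (cos x * (rightward \<eta> \<bullet> \<nu>) + \<sigma> * sin x * (heading \<eta> \<bullet> \<nu>))) < 0"
    "\<sigma> * (rightward \<eta> \<bullet> \<nu> - (cos x * (rightward \<eta> \<bullet> \<nu>) - \<sigma> * sin x * (heading \<eta> \<bullet> \<nu>))) > 0"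
    by (simp_all only: inner_diff_left inner_add_left inner_scaleR_left)
  then have "sin x * (heading \<eta> \<bullet> \<nu>) > 0" using assms(1) by auto
  then show ?thesis using sin_gt_zero[OF assms(2,3)] by (simp add: zero_less_mult_iff)
qed

lemma signed_normal_frame:
  assumes "\<nu> = heading (- \<phi>) \<or> \<nu> = - heading (- \<phi>)"
  shows "y = (y \<bullet> rightward (- \<phi>)) *\<^sub>R rightward (- \<phi>) + (y \<bullet> \<nu>) *\<^sub>R \<nu>"
    "norm \<nu> = 1" "rightward (- \<phi>) \<bullet> \<nu> = 0"
    "sin (x + \<phi>) = 0 \<Longrightarrow> rightward x \<bullet> \<nu> = 0"
  using assms frame_expansion[of y "- \<phi>"]
  by (auto simp: add.commute inner_commute[of "rightward _"] inner_heading_rightward)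
    (simp_all add: sin_add sin_diff add.commute)

theorem theorem3p3:
  fixes T :: terrain and B :: endpoint_data and X :: hybrid_path
    and j p p' :: nat and a d \<phi> \<theta>\<^sub>p \<theta>\<^sub>p' \<theta>star \<Delta>\<theta>\<^sub>p \<Delta>\<theta>\<^sub>p' :: real
  assumes "valid_terrain T"
    and "valid_endpoints T B"
    and "minimum_time T B X"
    and "crossing_assumption T X"
    and "j \<in> {1..pieces X - 1}"
    and "p = reg X (j - 1)" and "p' = reg X j"
    and "time X (j - 1) \<le> a" and "a < time X j"
    and "time X j < d" and "d \<le> time X (Suc j)"
    and "pos X (a, j - 1) \<in> interior (region T p)"
    and "pos X (d, j) \<in> interior (region T p')"
    and "tangent_angle (closed_boundary T p \<inter> closed_boundary T p') (pos X (time X j, j)) \<phi>"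
    and "\<theta>\<^sub>p = orient X (a, j - 1) + \<phi>"
    and "\<theta>\<^sub>p' = orient X (d, j) + \<phi>"
    and "\<theta>star = orient X (time X j, j) + \<phi>"
    and "\<Delta>\<theta>\<^sub>p = \<theta>star - \<theta>\<^sub>p"
    and "\<Delta>\<theta>\<^sub>p' = \<theta>\<^sub>p' - \<theta>star"
  shows "(crosses_LCL T X j a d \<longrightarrow>
            speed T p / speed T p' = sin \<theta>\<^sub>p / sin \<theta>\<^sub>p' \<and>
            radius T p / radius T p' =
              speed T p / speed T p' * ((1 - cos \<Delta>\<theta>\<^sub>p') / (1 - cos \<Delta>\<theta>\<^sub>p)) \<and>
            speed T p / speed T p' * ((1 - cos \<Delta>\<theta>\<^sub>p') / (1 - cos \<Delta>\<theta>\<^sub>p)) =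
              (sin \<theta>\<^sub>p * (1 - cos \<Delta>\<theta>\<^sub>p')) / (sin \<theta>\<^sub>p' * (1 - cos \<Delta>\<theta>\<^sub>p))) \<and>
         (crosses_L X j a d \<and> speed T p \<noteq> speed T p' \<longrightarrow>
            (\<exists>k :: int. \<theta>\<^sub>p = of_int k * pi) \<and> (\<exists>k :: int. \<theta>\<^sub>p' = of_int k * pi))"
proof -
  define m where "m = j - 1"
  have j: "j = Suc m" "j - 1 = m" "Suc m < pieces X" using assms(5) by (auto simp: m_def)
  have p: "reg X m = p" "reg X (Suc m) = p'" using assms(6,7) j by auto
  note val = assms(1) and opt = assms(3)
  have a: "time X m \<le> a" "a < time X (Suc m)" and d: "time X (Suc m) < d" "d \<le> time X (Suc (Suc m))"
    and A: "pos X (a, m) \<in> interior (region T p)" and D: "pos X (d, Suc m) \<in> interior (region T p')"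
    using assms(8-13) j by auto
  have sol: "hybrid_solution T X" using opt by (simp add: minimum_time_def solves_def)
  have ind: "p \<in> indices T" "p' \<in> indices T" and "p \<noteq> p'"
    using sol j(3) p unfolding hybrid_solution_def by auto
  define v where "v = speed T p"
  define v' where "v' = speed T p'"
  define r where "r = radius T p"
  define r' where "r' = radius T p'"
  have pos: "v > 0" "v' > 0" "r > 0" "r' > 0"
    using val ind by (auto simp: valid_terrain_def v_def v'_def r_def r'_def)
  have poly: "polytope_region (region T p)" "polytope_region (region T p')"
    using val ind by (auto simp: valid_terrain_def)
  note int = interior_closure_polytope_region(1)[OF poly(1)] interior_closure_polytope_region(1)[OF poly(2)]
  have steer: "steers v (v / r) (\<lambda>s. pos X (s, m)) (\<lambda>s. orient X (s, m)) (\<lambda>s. ctrl X (s, m)) (time X m) (time X (Suc m))"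
    "steers v' (v' / r') (\<lambda>s. pos X (s, Suc m)) (\<lambda>s. orient X (s, Suc m)) (\<lambda>s. ctrl X (s, Suc m))
      (time X (Suc m)) (time X (Suc (Suc m)))"
    using sol j(3) p unfolding hybrid_solution_def dynamics_on_piece_iff_steers max_turn_rate_def v_def v'_def r_def r'_def
    by (metis Suc_lessD)+
  define tc where "tc = time X (Suc m)"
  define z where "z = pos X (tc, Suc m)"
  define \<eta> where "\<eta> = orient X (tc, Suc m)"
  define \<alpha> where "\<alpha> = orient X (a, m)"
  define \<beta> where "\<beta> = orient X (d, Suc m)"
  have cross: "pos X (tc, m) = z" "orient X (tc, m) = \<eta>"
    using sol j(3) unfolding hybrid_solution_def z_def \<eta>_def tc_def pos_def by auto
  have "(tc, m) \<in> hdom X" using j(3) a by (auto simp: hdom_def tc_def intro!: bexI[of _ m])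
  then have "z \<in> whole T" using sol cross(1) unfolding hybrid_solution_def by metis
  have angles: "\<theta>\<^sub>p = \<alpha> + \<phi>" "\<theta>\<^sub>p' = \<beta> + \<phi>" "\<Delta>\<theta>\<^sub>p = \<eta> - \<alpha>" "\<Delta>\<theta>\<^sub>p' = \<beta> - \<eta>"
    using assms(15-19) j by (auto simp: \<alpha>_def \<beta>_def \<eta>_def tc_def)
  have disj: "interior (closure (region T p)) \<inter> interior (closure (region T p')) = {}"
    using val ind \<open>p \<noteq> p'\<close> interior_subset unfolding int valid_terrain_def by blast
  have tan: "tangent_angle (frontier (closure (region T p)) \<inter> frontier (closure (region T p'))) z \<phi>"
    using assms(14) j by (simp add: closed_boundary_def z_def tc_def)
  obtain \<nu> \<rho> where \<nu>: "\<nu> = heading (- \<phi>) \<or> \<nu> = - heading (- \<phi>)" and "\<rho> > 0"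
    and side: "\<And>y. y \<in> closure (region T p) \<Longrightarrow> (y - z) \<bullet> \<nu> \<le> 0" "\<And>y. y \<in> closure (region T p') \<Longrightarrow> (y - z) \<bullet> \<nu> \<ge> 0"
    and strict: "\<And>y. y \<in> interior (region T p) \<Longrightarrow> (y - z) \<bullet> \<nu> < 0" "\<And>y. y \<in> interior (region T p') \<Longrightarrow> (y - z) \<bullet> \<nu> > 0"
    and disc: "\<And>y. y \<in> ball z \<rho> \<Longrightarrow> (y - z) \<bullet> \<nu> < 0 \<Longrightarrow> y \<in> interior (region T p)"
      "\<And>y. y \<in> ball z \<rho> \<Longrightarrow> (y - z) \<bullet> \<nu> > 0 \<Longrightarrow> y \<in> interior (region T p')"
    and edge: "\<And>s. \<bar>s\<bar> < \<rho> \<Longrightarrow> z + s *\<^sub>R rightward (- \<phi>) \<in> closure (region T p) \<inter> closure (region T p')"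
    using adjacent_half_discs[OF interior_closure_polytope_region(2)[OF poly(1)] closed_closure
        interior_closure_polytope_region(3)[OF poly(1)] interior_closure_polytope_region(2)[OF poly(2)] closed_closure
        interior_closure_polytope_region(3)[OF poly(2)] disj tan] unfolding int by blast
  note frame = signed_normal_frame[OF \<nu>]
  have on_edge: "z + s *\<^sub>R rightward (- \<phi>) \<in> whole T" if "\<bar>s\<bar> < \<rho>" for s
    using edge_in_terrain[OF val ind \<open>z \<in> whole T\<close> frame(1) norm_rightward frame(2,3) side disc edge that] .
  have tangential: "rightward (- \<phi>) \<bullet> heading \<alpha> = sin \<theta>\<^sub>p" "rightward (- \<phi>) \<bullet> heading \<beta> = sin \<theta>\<^sub>p'"
    by (simp_all add: angles inner_commute[of "rightward _"] inner_heading_rightward)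
  have stationary: "c * sin \<theta>\<^sub>p / v + k * (1 - cos (\<kappa> * W)) = c * sin \<theta>\<^sub>p' / v' - k' * (1 - cos (\<kappa>' * W'))"
    if b: "b \<in> {a<..<tc}" "b' \<in> {tc<..<d}" and W: "W = tc - b" "W' = b' - tc"
      and kap: "\<bar>\<kappa>\<bar> \<le> v / r" "\<bar>\<kappa>'\<bar> \<le> v' / r'" and hd: "\<eta> = \<alpha> + \<kappa> * W" "\<beta> = \<eta> + \<kappa>' * W'"
      and lines: "pos X (b, m) = pos X (a, m) + (v * (b - a)) *\<^sub>R heading \<alpha>"
        "pos X (d, Suc m) = pos X (b', Suc m) + (v' * (d - b')) *\<^sub>R heading \<beta>"
      and turns: "\<And>s. s \<in> {b..tc} \<Longrightarrow> pos X (s, m) = pos X (b, m) + v *\<^sub>R turn \<alpha> \<kappa> (s - b)"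
        "\<And>s. s \<in> {tc..b'} \<Longrightarrow> pos X (s, Suc m) = z + v' *\<^sub>R turn \<eta> \<kappa>' (s - tc)"
      and inside: "\<And>s. s \<in> {b..<tc} \<Longrightarrow> pos X (s, m) \<in> interior (region T p)"
        "\<And>s. s \<in> {tc<..b'} \<Longrightarrow> pos X (s, Suc m) \<in> interior (region T p')"
      and "heading \<eta> \<bullet> \<nu> > 0" "\<kappa> * k + \<kappa>' * k' = 0"
    for b b' W W' \<kappa> \<kappa>' c k k'
  proof -
    have "v * (b - a) > 0" "W > 0" "W' > 0" "v' * (d - b') > 0" using b W pos by auto
    moreover have "v * (b - a) / v + W + (v' * (d - b') / v' + W') = d - a" using pos W by simp
    moreover have "z = pos X (a, m) + (v * (b - a)) *\<^sub>R heading \<alpha> + v *\<^sub>R turn \<alpha> \<kappa> W"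
      using turns(1)[of tc] b W lines cross by simp
    moreover have "pos X (d, Suc m) = z + v' *\<^sub>R turn (\<alpha> + \<kappa> * W) \<kappa>' W' + (v' * (d - b')) *\<^sub>R heading \<beta>"
      using turns(2)[of b'] b W lines hd(1) by simp
    moreover have "pos X (a, m) + (v * (b - a)) *\<^sub>R heading \<alpha> + v *\<^sub>R turn \<alpha> \<kappa> s \<in> interior (region T p)"
      if "s \<in> {0..<W}" for s
      using turns(1)[of "b + s"] inside(1)[of "b + s"] lines(1) W(1) that by simp
    moreover have "z + v' *\<^sub>R turn (\<alpha> + \<kappa> * W) \<kappa>' s \<in> interior (region T p')" if "s \<in> {0<..W'}" for s
      using turns(2)[of "tc + s"] inside(2)[of "tc + s"] hd(1) W(2) that by simp
    moreover have "heading (\<alpha> + \<kappa> * W) \<bullet> \<nu> > 0" "\<beta> = \<alpha> + \<kappa> * W + \<kappa>' * W'"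
      using \<open>heading \<eta> \<bullet> \<nu> > 0\<close> hd by simp_all
    ultimately show ?thesis
      using crossing_is_stationary[OF val opt j(3) a d, of "v * (b - a)" W W' "v' * (d - b')" \<kappa> \<kappa>' z \<rho> \<nu> "rightward (- \<phi>)" k k' c,
          unfolded p max_turn_rate_def, folded \<alpha>_def \<beta>_def v_def v'_def r_def r'_def, OF A D _ _ _ _ _ kap _ _ _ _ _ \<open>\<rho> > 0\<close> disc on_edge frame(3)]
        \<open>\<kappa> * k + \<kappa>' * k' = 0\<close>
      unfolding tangential by blast
  qed
  show ?thesis
  proof (intro conjI impI)
    assume "crosses_LCL T X j a d"
    then obtain \<sigma>\<^sub>0 b c where bc: "b < tc" "tc < c"
      and line: "line_piece X m a b" "line_piece X (Suc m) c d"
      and arc: "arc_piece T X \<sigma>\<^sub>0 m b tc" "arc_piece T X \<sigma>\<^sub>0 (Suc m) tc c"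
      and inside: "\<And>s. s \<in> {b..<tc} \<Longrightarrow> pos X (s, m) \<in> interior (region T p)"
        "\<And>s. s \<in> {tc<..c} \<Longrightarrow> pos X (s, Suc m) \<in> interior (region T p')"
      unfolding crosses_LCL_def j(1) diff_Suc_1 p tc_def by blast
    define \<sigma> where "\<sigma> = sense_sign \<sigma>\<^sub>0"
    have \<sigma>: "\<sigma> = 1 \<or> \<sigma> = -1" by (cases \<sigma>\<^sub>0) (simp_all add: \<sigma>_def)
    have ab: "a < b" "c < d" using line by (auto simp: line_piece_def)
    have sub: "steers v (v / r) (\<lambda>s. pos X (s, m)) (\<lambda>s. orient X (s, m)) (\<lambda>s. ctrl X (s, m)) a b"
      "steers v (v / r) (\<lambda>s. pos X (s, m)) (\<lambda>s. orient X (s, m)) (\<lambda>s. ctrl X (s, m)) b tc"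
      "steers v' (v' / r') (\<lambda>s. pos X (s, Suc m)) (\<lambda>s. orient X (s, Suc m)) (\<lambda>s. ctrl X (s, Suc m)) tc c"
      "steers v' (v' / r') (\<lambda>s. pos X (s, Suc m)) (\<lambda>s. orient X (s, Suc m)) (\<lambda>s. ctrl X (s, Suc m)) c d"
      using steer a d ab bc by (auto intro: steers_subinterval simp: tc_def)
    have line1: "orient X (b, m) = \<alpha>" "pos X (b, m) = pos X (a, m) + (v * (b - a)) *\<^sub>R heading \<alpha>"
      using steers_along_segment[OF sub(1) pos(1) ab(1), of b] line(1) ab(1) by (auto simp: line_piece_def \<alpha>_def)
    have line2: "orient X (c, Suc m) = \<beta>" "pos X (d, Suc m) = pos X (c, Suc m) + (v' * (d - c)) *\<^sub>R heading \<beta>"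
      using steers_along_segment[OF sub(4) pos(2) ab(2), of d] line(2) ab(2) by (auto simp: line_piece_def \<beta>_def)
    obtain o1 where o1: "\<And>s. s \<in> {b..tc} \<Longrightarrow> pos X (s, m) + (\<sigma> * r) *\<^sub>R rightward (orient X (s, m)) = o1"
      using arc(1) unfolding arc_piece_def p \<sigma>_def[symmetric] r_def[symmetric] rightward_def by metis
    obtain o2 where o2: "\<And>s. s \<in> {tc..c} \<Longrightarrow> pos X (s, Suc m) + (\<sigma> * r') *\<^sub>R rightward (orient X (s, Suc m)) = o2"
      using arc(2) unfolding arc_piece_def p \<sigma>_def[symmetric] r'_def[symmetric] rightward_def by metis
    define \<kappa> where "\<kappa> = \<sigma> * v / r"
    define \<kappa>' where "\<kappa>' = \<sigma> * v' / r'"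
    have arc1: "orient X (s, m) = \<alpha> + \<kappa> * (s - b)" "pos X (s, m) = pos X (b, m) + v *\<^sub>R turn \<alpha> \<kappa> (s - b)"
      if "s \<in> {b..tc}" for s
      using steers_along_circle[OF sub(2) pos(1,3) \<sigma> o1 that] line1(1) by (simp_all add: \<kappa>_def)
    have arc2: "orient X (s, Suc m) = \<eta> + \<kappa>' * (s - tc)" "pos X (s, Suc m) = z + v' *\<^sub>R turn \<eta> \<kappa>' (s - tc)"
      if "s \<in> {tc..c}" for s
      using steers_along_circle[OF sub(3) pos(2,4) \<sigma> o2 that] by (simp_all add: \<kappa>'_def z_def \<eta>_def)
    have \<eta>: "\<eta> = \<alpha> + \<kappa> * (tc - b)" using arc1(1)[of tc] bc cross by simp
    have \<beta>: "\<beta> = \<eta> + \<kappa>' * (c - tc)" using arc2(1)[of c] bc line2 by simp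
    have height1: "(pos X (s, m) - z) \<bullet> \<nu> = r * (\<sigma> * ((rightward \<eta> - rightward (orient X (s, m))) \<bullet> \<nu>))"
      if "s \<in> {b..tc}" for s
    proof -
      have "pos X (s, m) - z = (\<sigma> * r) *\<^sub>R (rightward \<eta> - rightward (orient X (s, m)))"
        using o1[OF that] o1[of tc] bc cross by (simp add: algebra_simps)
      then show ?thesis by simp
    qed
    have height2: "(pos X (s, Suc m) - z) \<bullet> \<nu> = r' * (\<sigma> * ((rightward \<eta> - rightward (orient X (s, Suc m))) \<bullet> \<nu>))"
      if "s \<in> {tc..c}" for s
    proof -
      have "pos X (s, Suc m) - z = (\<sigma> * r') *\<^sub>R (rightward \<eta> - rightward (orient X (s, Suc m)))"
        using o2[OF that] o2[of tc] bc by (simp add: algebra_simps z_def \<eta>_def)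
      then show ?thesis by simp
    qed
    have below: "\<sigma> * ((rightward \<eta> - rightward (orient X (s, m))) \<bullet> \<nu>) < 0" if "s \<in> {b..<tc}" for s
      using strict(1)[OF inside(1)[OF that]] height1[of s] that pos(3) by (simp add: mult_less_0_iff)
    have above: "\<sigma> * ((rightward \<eta> - rightward (orient X (s, Suc m))) \<bullet> \<nu>) > 0" if "s \<in> {tc<..c}" for s
      using strict(2)[OF inside(2)[OF that]] height2[of s] that pos(4) by (simp add: zero_less_mult_iff)
    have transversal: "heading \<eta> \<bullet> \<nu> > 0"
    proof -
      \<comment> \<open>An angle by which the vehicle turns both before and after the crossing.\<close>
      define x where "x = min 1 (min ((tc - b) * v / r) ((c - tc) * v' / r'))"
      have x: "x > 0" "x \<le> 1" "x \<le> (tc - b) * v / r" "x \<le> (c - tc) * v' / r'"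
        unfolding x_def using bc pos by auto
      have s: "tc - x * r / v \<in> {b..<tc}" "tc + x * r' / v' \<in> {tc<..c}"
        using x pos by (auto simp: field_simps)
      have "orient X (tc - x * r / v, m) = \<eta> - \<sigma> * x" "orient X (tc + x * r' / v', Suc m) = \<eta> + \<sigma> * x"
      proof -
        have "\<kappa> * (x * r / v) = \<sigma> * x" "\<kappa>' * (x * r' / v') = \<sigma> * x" using pos by (simp_all add: \<kappa>_def \<kappa>'_def)
        moreover have "\<kappa> * (tc - x * r / v - b) = \<kappa> * (tc - b) - \<kappa> * (x * r / v)" by (simp only: right_diff_distrib)
        ultimately show "orient X (tc - x * r / v, m) = \<eta> - \<sigma> * x" "orient X (tc + x * r' / v', Suc m) = \<eta> + \<sigma> * x"
          using arc1(1)[of "tc - x * r / v"] arc2(1)[of "tc + x * r' / v'"] s \<eta> by simp_all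
      qed
      then show ?thesis
        using circle_crosses_transversally[OF \<sigma> x(1)] below[OF s(1)] above[OF s(2)] x(2) pi_gt3 by simp
    qed
    have kap: "\<bar>\<kappa>\<bar> \<le> v / r" "\<bar>\<kappa>'\<bar> \<le> v' / r'" using \<sigma> pos by (auto simp: \<kappa>_def \<kappa>'_def)
    have \<Delta>: "\<kappa> * (tc - b) = \<Delta>\<theta>\<^sub>p" "\<kappa>' * (c - tc) = \<Delta>\<theta>\<^sub>p'" using \<eta> \<beta> by (simp_all add: angles)
    have b: "b \<in> {a<..<tc}" "c \<in> {tc<..<d}" using ab bc by auto
    note st = stationary[OF b refl refl kap \<eta> \<beta> line1(2) line2(2) arc1(2) arc2(2) inside transversal, unfolded \<Delta>]
    \<comment> \<open>Displacement of the crossing point with unchanged arcs.\<close>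
    have snell: "sin \<theta>\<^sub>p / v = sin \<theta>\<^sub>p' / v'" using st[of 0 0 1] by simp
    \<comment> \<open>Change of the crossing heading at a fixed point; these prolongations change it equally on
      both sides.\<close>
    have turning: "\<kappa>' * (1 - cos \<Delta>\<theta>\<^sub>p) = \<kappa> * (1 - cos \<Delta>\<theta>\<^sub>p')" using st[of "\<kappa>'" "- \<kappa>" 0] by (simp add: mult.commute)
    \<comment> \<open>After a full turn the arc would have started at the crossing point.\<close>
    have nz: "cos \<Delta>\<theta>\<^sub>p \<noteq> 1"
    proof
      assume 1: "cos \<Delta>\<theta>\<^sub>p = 1"
      then have "sin \<Delta>\<theta>\<^sub>p = 0" using sin_cos_squared_add[of "\<Delta>\<theta>\<^sub>p"] by simp
      then have "rightward \<eta> = rightward \<alpha>" using 1 rightward_add[of \<alpha> "\<Delta>\<theta>\<^sub>p"] by (simp add: angles)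
      then show False using below[of b] bc line1 by simp
    qed
    \<comment> \<open>If both lines were perpendicular to the edge, then the far ends of both arcs would have the
      height \<open>\<sigma> * (rightward \<eta> \<bullet> \<nu>)\<close> up to positive factors, but they are on opposite sides.\<close>
    have sin_nz: "sin \<theta>\<^sub>p' \<noteq> 0"
    proof
      assume 0: "sin \<theta>\<^sub>p' = 0"
      then have "sin \<theta>\<^sub>p = 0" using snell pos by simp
      then have "rightward \<alpha> \<bullet> \<nu> = 0" "rightward \<beta> \<bullet> \<nu> = 0" using 0 frame(4) by (simp_all add: angles)
      then show False using below[of b] above[of c] bc line1 line2 by (simp add: inner_diff_left)
    qed
    show ratio: "speed T p / speed T p' = sin \<theta>\<^sub>p / sin \<theta>\<^sub>p'"
      using snell sin_nz pos by (simp add: v_def v'_def frac_eq_eq mult.commute)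
    have "v' / r' * (1 - cos \<Delta>\<theta>\<^sub>p) = v / r * (1 - cos \<Delta>\<theta>\<^sub>p')"
      using turning \<sigma> by (auto simp: \<kappa>_def \<kappa>'_def)
    then show "radius T p / radius T p' = speed T p / speed T p' * ((1 - cos \<Delta>\<theta>\<^sub>p') / (1 - cos \<Delta>\<theta>\<^sub>p))"
      using nz pos by (simp add: v_def v'_def r_def r'_def field_simps)
    show "speed T p / speed T p' * ((1 - cos \<Delta>\<theta>\<^sub>p') / (1 - cos \<Delta>\<theta>\<^sub>p)) =
        (sin \<theta>\<^sub>p * (1 - cos \<Delta>\<theta>\<^sub>p')) / (sin \<theta>\<^sub>p' * (1 - cos \<Delta>\<theta>\<^sub>p))"
      by (simp add: ratio)
  next
    assume *: "crosses_L X j a d \<and> speed T p \<noteq> speed T p'"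
    then have line: "line_piece X m a tc" "line_piece X (Suc m) tc d"
      by (simp_all add: crosses_L_def j tc_def)
    have ac: "a < tc" "tc < d" using a d by (simp_all add: tc_def)
    have sub: "steers v (v / r) (\<lambda>s. pos X (s, m)) (\<lambda>s. orient X (s, m)) (\<lambda>s. ctrl X (s, m)) a tc"
      "steers v' (v' / r') (\<lambda>s. pos X (s, Suc m)) (\<lambda>s. orient X (s, Suc m)) (\<lambda>s. ctrl X (s, Suc m)) tc d"
      using steer a d by (auto intro: steers_subinterval simp: tc_def)
    have l1: "orient X (s, m) = \<alpha>" "pos X (s, m) = pos X (a, m) + (v * (s - a)) *\<^sub>R heading \<alpha>" if "s \<in> {a..tc}" for s
      using steers_along_segment[OF sub(1) pos(1) ac(1) _ that] line(1) by (auto simp: line_piece_def \<alpha>_def)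
    have l2: "orient X (s, Suc m) = \<eta>" "pos X (s, Suc m) = z + (v' * (s - tc)) *\<^sub>R heading \<eta>" if "s \<in> {tc..d}" for s
      using steers_along_segment[OF sub(2) pos(2) ac(2) _ that] line(2) by (auto simp: line_piece_def \<eta>_def z_def)
    have same: "\<eta> = \<alpha>" "\<beta> = \<eta>" using l1(1)[of tc] l2(1)[of d] ac cross by (simp_all add: \<beta>_def)
    have zA: "z = pos X (a, m) + (v * (tc - a)) *\<^sub>R heading \<alpha>" using l1(2)[of tc] ac cross by simp
    have zD: "pos X (d, Suc m) = z + (v' * (d - tc)) *\<^sub>R heading \<alpha>" using l2(2)[of d] ac same by simp
    have transversal: "heading \<eta> \<bullet> \<nu> > 0"
    proof -
      have "pos X (a, m) - z = - ((v * (tc - a)) *\<^sub>R heading \<eta>)" by (subst zA) (simp add: same)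
      then have "(pos X (a, m) - z) \<bullet> \<nu> = - (v * (tc - a) * (heading \<eta> \<bullet> \<nu>))" by simp
      then have prod: "0 < v * (tc - a) * (heading \<eta> \<bullet> \<nu>)" using strict(1)[OF A] by linarith
      have "0 < v * (tc - a)" using pos(1) ac(1) by simp
      then show ?thesis by (rule zero_less_mult_pos[OF prod])
    qed
    have cl: "z \<in> closure (region T p)" "z \<in> closure (region T p')" using edge[of 0] \<open>\<rho> > 0\<close> by auto
    have in1: "pos X (s, m) \<in> interior (region T p)" if "s \<in> {a..<tc}" for s
    proof -
      define e where "e = (tc - s) / (tc - a)"
      have e: "0 < e" "e \<le> 1" "e * (v * (tc - a)) = v * (tc - s)" using that by (auto simp: e_def)
      have "z - e *\<^sub>R (z - pos X (a, m)) = z - (v * (tc - s)) *\<^sub>R heading \<alpha>"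
        using e(3) by (simp add: zA)
      also have "\<dots> = pos X (s, m)" unfolding zA using l1(2)[of s] that by (simp add: algebra_simps)
      finally show ?thesis
        using mem_interior_convex_shrink[OF interior_closure_polytope_region(2)[OF poly(1)] _ cl(1) e(1,2), of "pos X (a, m)"] A
        unfolding int by simp
    qed
    have in2: "pos X (s, Suc m) \<in> interior (region T p')" if "s \<in> {tc<..d}" for s
    proof -
      define e where "e = (s - tc) / (d - tc)"
      have e: "0 < e" "e \<le> 1" "e * (v' * (d - tc)) = v' * (s - tc)" using that by (auto simp: e_def)
      have "z - e *\<^sub>R (z - pos X (d, Suc m)) = z + (v' * (s - tc)) *\<^sub>R heading \<alpha>"
        using e(3) by (simp add: zD)
      also have "\<dots> = pos X (s, Suc m)" using l2(2)[of s] that same by simp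
      finally show ?thesis
        using mem_interior_convex_shrink[OF interior_closure_polytope_region(2)[OF poly(2)] _ cl(2) e(1,2), of "pos X (d, Suc m)"] D
        unfolding int by simp
    qed
    \<comment> \<open>The last half of each line serves as a turn with rate \<open>0\<close>, so that only a part of the line
      away from the boundary is replaced by an S-curve.\<close>
    define b where "b = (a + tc) / 2"
    define b' where "b' = (tc + d) / 2"
    have b: "b \<in> {a<..<tc}" "b' \<in> {tc<..<d}" using ac by (auto simp: b_def b'_def)
    have "sin \<theta>\<^sub>p / v = sin \<theta>\<^sub>p' / v'"
    proof -
      have "1 * sin \<theta>\<^sub>p / v + 0 * (1 - cos (0 * (tc - b))) = 1 * sin \<theta>\<^sub>p' / v' - 0 * (1 - cos (0 * (b' - tc)))"
      proof (rule stationary[OF b refl refl])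
        show "pos X (b, m) = pos X (a, m) + (v * (b - a)) *\<^sub>R heading \<alpha>" using l1(2)[of b] b by simp
        show "pos X (d, Suc m) = pos X (b', Suc m) + (v' * (d - b')) *\<^sub>R heading \<beta>"
        proof -
          have "d \<in> {tc..d}" "b' \<in> {tc..d}" using b by auto
          then show ?thesis unfolding same by (simp add: l2(2) same algebra_simps)
        qed
        show "pos X (s, m) = pos X (b, m) + v *\<^sub>R turn \<alpha> 0 (s - b)" if "s \<in> {b..tc}" for s
        proof -
          have "b \<in> {a..tc}" "s \<in> {a..tc}" using b that by auto
          note ends = this[THEN l1(2)]
          show ?thesis unfolding ends turn_straight by (simp add: algebra_simps)
        qed
        show "pos X (s, Suc m) = z + v' *\<^sub>R turn \<eta> 0 (s - tc)" if "s \<in> {tc..b'}" for s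
          using l2(2)[of s] b that by (simp add: turn_straight)
      qed (use in1 in2 b pos same transversal in auto)
      then show ?thesis by simp
    qed
    then have "sin \<theta>\<^sub>p * (v' - v) = 0" using pos same by (auto simp: angles frac_eq_eq algebra_simps)
    then have "sin \<theta>\<^sub>p = 0" using * by (simp add: v_def v'_def)
    then show "\<exists>k :: int. \<theta>\<^sub>p = of_int k * pi" "\<exists>k :: int. \<theta>\<^sub>p' = of_int k * pi"
      using same by (simp_all add: sin_zero_iff_int2 angles)
  qed
qed

end
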